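(* Let $(A(n))_{n\in\mathbb{N}}$ be a sequence of i.i.d. random matrices with values in $(\mathbb{R}\cup\{-\infty\})^{d\times d}$, such that $A(0)$ almost surely has at least one finite entry on each row, and such that $\max_{A_{ij}(0)\neq-\infty}|A_{ij}(0)|$ is integrable. Let $x(n,0)=A(n-1)\cdots A(0)\,0$ (max-plus product, applied to the zero vector). Then the sequence $\left(\frac1n x(n,0)\right)_{n}$ converges almost surely if and only if, for every strongly connected component $c$ of $\mathcal{G}(A)$, the submatrix $A^{\{c\}}$ of $A(0)$ whose indices are in $\{c\}$ almost surely has at least one finite entry on each row. In that case the limit is given by $$\forall i\in\{1,\dots,d\},\quad \lim_n \frac1n x_i(n,0)=\max_{i\to c}\gamma^{(c)}\quad\text{a.s.},$$ the maximum being over all strongly connected components $c$ of $\mathcal{G}(A)$ reachable from $i$.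
   Context: Max-plus conventions: for matrices and vectors with entries in $\mathbb{R}\cup\{-\infty\}$, products are max-plus products: $(AB)_{ij}=\max_k(A_{ik}+B_{kj})$ and $(Ax)_i=\max_j(A_{ij}+x_j)$. "Finite" means $\neq-\infty$. $0$ denotes also the vector with all coordinates equal to $0$. So $x(0,0)=0$ and $x_i(n+1,0)=\max_j(A_{ij}(n)+x_j(n,0))$. Maximal Lyapunov exponent: if $(M(n))$ is a stationary ergodic sequence of random square matrices with entries in $\mathbb{R}\cup\{-\infty\}$ (rows without finite entries allowed) such that the positive part of $\max_{ij}M_{ij}(0)$ is integrable, then by Kingman's theorem $\frac1n\max_{ij}(M(n-1)\cdots M(0))_{ij}$ converges almost surely to a constant $\gamma(M)\in\mathbb{R}\cup\{-\infty\}$, called the maximal Lyapunov exponent. Graph: $\mathcal{G}(A)$ is the directed graph with nodes $1,\dots,d$ and arcs the pairs $(i,j)$ such that $\mathbb{P}(A_{ij}(0)\neq-\infty)>0$. Strongly connected components (s.c.c.) are taken in this graph; a node that lies on no circuit forms by itself an s.c.c., called trivial. For an s.c.c. $c$, $A^{(c)}(n)=(A_{ij}(n))_{i,j\in c}$ and $\gamma^{(c)}=\gamma(A^{(c)})$ (so $\gamma^{(c)}=-\infty$ if $c$ is trivial). An s.c.c. $\tilde c$ is reachable from an s.c.c. $c$ (resp. from a node $i$), written $c\to\tilde c$ (resp. $i\to\tilde c$), if $c=\tilde c$ (resp. $i\in\tilde c$) or there is a path in $\mathcal{G}(A)$ from a node of $c$ (resp. from $i$) to a node of $\tilde c$; $c\to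 i$ means that $i\in c$ or there is a path from a node of $c$ to $i$. For an s.c.c. $c$, the set $\{c\}$ of nodes is defined by $$\{c\}:=\left\{i\in\{1,\dots,d\}\;:\;\exists\,\tilde c,\ c\to i\to\tilde c,\ \gamma^{(\tilde c)}=\max_{c\to\bar c}\gamma^{(\bar c)}\right\},$$ where $\tilde c,\bar c$ range over s.c.c.'s; and $A^{\{c\}}=(A_{ij}(0))_{i,j\in\{c\}}$. *)

theory Defs
  imports "HOL-Probability.Probability"
begin

text \<open>
  The max-plus semiring is embedded in \<open>ereal\<close> (matrices are required elsewhere never to
  take the value \<open>\<infinity>\<close>).  Matrices are functions of two indices, and all max-plus operations
  carry the index set \<open>I\<close> (finite and nonempty in all uses) over which the matrices are read,
  so that the submatrix with indices in \<open>I\<close> needs no separate representation.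
\<close>

type_synonym 'd mp_matrix = "'d \<Rightarrow> 'd \<Rightarrow> ereal"

definition mp_id :: "'d mp_matrix" where
  "mp_id i j = (if i = j then 0 else -\<infinity>)"

definition mp_mult :: "'d set \<Rightarrow> 'd mp_matrix \<Rightarrow> 'd mp_matrix \<Rightarrow> 'd mp_matrix" where
  "mp_mult I A B = (\<lambda>i j. MAX k\<in>I. A i k + B k j)"

definition mp_apply :: "'d set \<Rightarrow> 'd mp_matrix \<Rightarrow> ('d \<Rightarrow> ereal) \<Rightarrow> 'd \<Rightarrow> ereal" where
  "mp_apply I A v = (\<lambda>i. MAX j\<in>I. A i j + v j)"

text \<open>\<open>mp_prod I B n\<close> is \<open>B (n - 1) \<cdots> B 0\<close>, the latest factor being on the left.\<close>

primrec mp_prod :: "'d set \<Rightarrow> (nat \<Rightarrow> 'd mp_matrix) \<Rightarrow> nat \<Rightarrow> 'd mp_matrix" where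
  "mp_prod I B 0 = mp_id"
| "mp_prod I B (Suc n) = mp_mult I (B n) (mp_prod I B n)"

definition mp_orbit :: "(nat \<Rightarrow> ('d::finite) mp_matrix) \<Rightarrow> nat \<Rightarrow> 'd \<Rightarrow> ereal" where
  "mp_orbit B n = mp_apply UNIV (mp_prod UNIV B n) (\<lambda>_. 0)"

definition mp_matrix_space :: "('d::finite) mp_matrix measure" where
  "mp_matrix_space = (\<Pi>\<^sub>M i\<in>UNIV. \<Pi>\<^sub>M j\<in>UNIV. borel)"

definition iid_mp_matrices :: "'w measure \<Rightarrow> (nat \<Rightarrow> 'w \<Rightarrow> ('d::finite) mp_matrix) \<Rightarrow> bool" where
  "iid_mp_matrices M A \<longleftrightarrow>
     (\<forall>n. A n \<in> measurable M mp_matrix_space) \<and>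
     (\<forall>n. \<forall>\<omega>\<in>space M. \<forall>i j. A n \<omega> i j \<noteq> \<infinity>) \<and>
     prob_space.indep_vars M (\<lambda>_. mp_matrix_space) A UNIV \<and>
     (\<forall>n. distr M mp_matrix_space (A n) = distr M mp_matrix_space (A 0))"

text \<open>
  The maximal Lyapunov exponent of the submatrices with indices in \<open>I\<close>, as the almost sure
  limit in Kingman's theorem (under whose hypotheses it exists and is unique).
\<close>

definition lyapunov ::
    "'w measure \<Rightarrow> (nat \<Rightarrow> 'w \<Rightarrow> 'd mp_matrix) \<Rightarrow> 'd set \<Rightarrow> ereal" where
  "lyapunov M A I = (THE \<gamma>. AE \<omega> in M.
     (\<lambda>n. (MAX i\<in>I. MAX j\<in>I. mp_prod I (\<lambda>k. A k \<omega>) n i j) / ereal (real n)) \<longlonglongrightarrow> \<gamma>)"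

definition mp_arcs :: "'w measure \<Rightarrow> (nat \<Rightarrow> 'w \<Rightarrow> 'd mp_matrix) \<Rightarrow> ('d \<times> 'd) set" where
  "mp_arcs M A = {(i, j). measure M {\<omega> \<in> space M. A 0 \<omega> i j \<noteq> -\<infinity>} > 0}"

text \<open>
  Closures are reflexive: a node on no circuit is the singleton class of itself, and the
  reachability relations below hold within a component.
\<close>

definition mp_sccs :: "'w measure \<Rightarrow> (nat \<Rightarrow> 'w \<Rightarrow> 'd mp_matrix) \<Rightarrow> 'd set set" where
  "mp_sccs M A = UNIV // ((mp_arcs M A)\<^sup>* \<inter> ((mp_arcs M A)\<^sup>*)\<inverse>)"

definition sccs_from :: "'w measure \<Rightarrow> (nat \<Rightarrow> 'w \<Rightarrow> 'd mp_matrix) \<Rightarrow> 'd \<Rightarrow> 'd set set" where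
  "sccs_from M A i = {c \<in> mp_sccs M A. \<exists>j\<in>c. (i, j) \<in> (mp_arcs M A)\<^sup>*}"

definition sccs_from_scc ::
    "'w measure \<Rightarrow> (nat \<Rightarrow> 'w \<Rightarrow> 'd mp_matrix) \<Rightarrow> 'd set \<Rightarrow> 'd set set" where
  "sccs_from_scc M A c = {c' \<in> mp_sccs M A. \<exists>i\<in>c. \<exists>j\<in>c'. (i, j) \<in> (mp_arcs M A)\<^sup>*}"

text \<open>The set of nodes written \<open>{c}\<close> (in braces) for a component \<open>c\<close>.\<close>

definition dominant_nodes ::
    "'w measure \<Rightarrow> (nat \<Rightarrow> 'w \<Rightarrow> 'd mp_matrix) \<Rightarrow> 'd set \<Rightarrow> 'd set" where
  "dominant_nodes M A c = {i. (\<exists>k\<in>c. (k, i) \<in> (mp_arcs M A)\<^sup>*) \<and>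
     (\<exists>c'\<in>sccs_from M A i. lyapunov M A c' = (MAX b\<in>sccs_from_scc M A c. lyapunov M A b))}"

end

theory Submission
  imports Defs
begin

text \<open>
Unfolding the max-plus products, $x_i(n,0)$ is the largest weight of a walk of $n$ arcs that starts
in $i$ and reads the matrices backwards in time: its first arc is weighted by the matrix of time
$n - 1$, its last one by the matrix of time \<open>0\<close> (\<open>bwalk\<close>).  Since the matrices are independent and
identically distributed, everything takes place on the space of sequences of matrices with the
product law; the final proof carries the results over to the given probability space.

Two tools carry the probabilistic part.  The first one is a zero-one law (\<open>zero_one_step\<close>): take a
family of events \<open>E i\<close> with probabilities bounded away from \<open>0\<close>; if for every \<open>i\<close> and almost every
matrix \<open>a\<close> there is some \<open>j\<close> such that prefixing \<open>a\<close> to a sequence of \<open>E j\<close> yields a sequence of \<open>E i\<close>,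
then all these events have probability one.  The second one is the greedy
decomposition of Katznelson and Weiss: if with high probability some block of length at most \<open>N\<close> is
good (its weight per unit of time is at most, or at least, \<open>a\<close>), then any long interval is cut
greedily into good blocks and a small proportion of bad single steps.  Together they give an upper
bound for Birkhoff sums of nonnegative functions (\<open>ergodic_upper_bound\<close>), which controls the
cost of the bad steps in all later applications.  Statements of the form "the limit superior is at
most \<open>a\<close>" are phrased as "$f(n) - an$ is bounded above": prefixing a coordinate lowers
this difference at most by an amount independent of \<open>n\<close>, so that a sequence with an unbounded
difference keeps this property and the zero-one law applies.

For a set \<open>I\<close> of nodes let \<open>peak I n\<close> be the largest weight of a walk of \<open>n\<close> arcs inside \<open>I\<close>.  It is
subadditive, and \<open>falling I a\<close> (the event that $\mathrm{peak} - an$ is unbounded below) has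
probability \<open>0\<close> or \<open>1\<close>; the exponent of \<open>I\<close> is the threshold between the two cases, and Kingman's
limit exists and equals it (\<open>peak_ratio_tendsto\<close>).  Above the threshold one even gets a bound on all
time intervals at once (\<open>peak_le_linear\<close>).

This uniformity gives the upper bound for the orbit (\<open>walk_upper_bound\<close>): a walk from \<open>i\<close> visits the
components reachable from \<open>i\<close> one after the other, so that, up to $o(n)$, its growth rate is at most
the largest exponent of these components; call it $\Gamma_i$ (\<open>limit_rate\<close>).

For the lower bound (\<open>walk_lower_bound\<close>), let \<open>H\<close> be the set $\{c\}$.  All its nodes reach, inside
\<open>H\<close>, a component of the same maximal exponent.  If every row of $A^{\{c\}}$ has a finite entry, a walk
can always be continued inside \<open>H\<close>, and the zero-one law, applied to the walks that read time
forwards (\<open>fwalk\<close>), shows that from every node of \<open>H\<close> these walks almost surely reach arbitrarily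
good values at some time.  Good blocks of bounded length therefore exist with high
probability; reversing a block of i.i.d. matrices does not change its law, and the greedy
decomposition turns them into a walk of rate $\Gamma_i$ backwards in time, for every \<open>n\<close>.

Conversely, if $\frac1n x(n,0)$ converges to \<open>l\<close>, then $l_i \ge l_j$ along every arc, because the arc
is present infinitely often; with the upper bound, and with the growth rate of \<open>peak\<close> on each component, this forces
$l_i = \Gamma_i$ (\<open>convergent_rate_eq\<close>).  If some row \<open>i\<close> of $A^{\{c\}}$ is empty with positive probability, this
happens infinitely often, and the walk is then thrown out of $\{c\}$ to some fixed node \<open>j\<close>
infinitely often; hence $\Gamma_i = l_i \le l_j = \Gamma_j$, although $\Gamma_j < \Gamma_i$ for every
successor \<open>j\<close> of \<open>i\<close> outside $\{c\}$ (\<open>diverges_of_row_escape\<close>).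
\<close>

section \<open>Sequences of independent identically distributed elements and a zero-one law\<close>

definition seq_drop :: "nat \<Rightarrow> (nat \<Rightarrow> 'a) \<Rightarrow> nat \<Rightarrow> 'a" where
  "seq_drop s \<omega> = (\<lambda>k. \<omega> (s + k))"

lemma seq_drop_apply [simp]: "seq_drop s \<omega> k = \<omega> (s + k)"
  by (simp add: seq_drop_def)

lemma seq_drop_0 [simp]: "seq_drop 0 \<omega> = \<omega>"
  by (simp add: seq_drop_def)

lemma seq_drop_seq_drop [simp]: "seq_drop s (seq_drop t \<omega>) = seq_drop (t + s) \<omega>"
  by (simp add: seq_drop_def add.assoc)

lemma seq_drop_case_nat [simp]: "seq_drop (Suc s) (case_nat a \<omega>) = seq_drop s \<omega>"
  by (simp add: seq_drop_def)

text \<open>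
Only the first \<open>n\<close> coordinates are reversed, so that the map permutes the coordinates and therefore
preserves the product law.
\<close>

definition rev_prefix :: "nat \<Rightarrow> (nat \<Rightarrow> 'a) \<Rightarrow> nat \<Rightarrow> 'a" where
  "rev_prefix n \<omega> = (\<lambda>k. if k < n then \<omega> (n - Suc k) else \<omega> k)"

definition depends_below :: "nat \<Rightarrow> 'a set \<Rightarrow> (nat \<Rightarrow> 'a) set \<Rightarrow> bool" where
  "depends_below m X F \<longleftrightarrow>
     (\<forall>\<omega>\<in>UNIV \<rightarrow> X. \<forall>\<omega>'\<in>UNIV \<rightarrow> X. (\<forall>k<m. \<omega> k = \<omega>' k) \<longrightarrow> (\<omega> \<in> F \<longleftrightarrow> \<omega>' \<in> F))"

lemma depends_below_mono: "depends_below m X F \<Longrightarrow> m \<le> n \<Longrightarrow> depends_below n X F"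
  unfolding depends_below_def by (meson order_less_le_trans)

context sequence_space
begin

lemma space_S: "space S = UNIV \<rightarrow> space M"
  by (simp add: space_PiM PiE_def)

lemma measurable_seq_drop [measurable]: "seq_drop s \<in> measurable S S"
  unfolding seq_drop_def by (rule measurable_PiM_single') (auto simp: space_PiM PiE_iff)

lemma measurable_rev_prefix [measurable]: "rev_prefix n \<in> measurable S S"
  unfolding rev_prefix_def by (rule measurable_PiM_single') (auto simp: space_PiM PiE_iff)

lemma distr_S_reindex:
  assumes "inj f"
  shows "distr S S (\<lambda>\<omega> k. \<omega> (f k)) = S"
  using distr_PiM_reindex[of UNIV "\<lambda>_. M" f UNIV] assms
  by (simp add: M.prob_space_axioms restrict_UNIV)

lemma distr_seq_drop: "distr S S (seq_drop s) = S"
  unfolding seq_drop_def by (rule distr_S_reindex) (simp add: inj_def)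

lemma distr_rev_prefix: "distr S S (rev_prefix n) = S"
proof -
  have "inj (\<lambda>k. if k < n then n - Suc k else k)"
    by (auto simp: inj_def split: if_splits)
  from distr_S_reindex[OF this] show ?thesis
    unfolding rev_prefix_def by (simp add: if_distrib cong: if_cong)
qed

lemma AE_seq_drop:
  assumes "AE \<omega> in S. Q \<omega>"
  shows "AE \<omega> in S. \<forall>s. Q (seq_drop s \<omega>)"
proof -
  have "AE \<omega> in S. Q (seq_drop s \<omega>)" for s
    using assms by (intro AE_distrD[OF measurable_seq_drop]) (unfold distr_seq_drop)
  then show ?thesis by (simp add: AE_all_countable)
qed

lemma AE_S_coordinate:
  assumes "AE a in M. Q a"
  shows "AE \<omega> in S. \<forall>k. Q (\<omega> k)"
  using AE_PiM_component[of "UNIV :: nat set" "\<lambda>_. M" _ Q] assms M.prob_space_axioms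
  by (simp add: AE_all_countable)

lemma nn_integral_S_Cons:
  assumes [measurable]: "f \<in> borel_measurable S"
  shows "(\<integral>\<^sup>+\<omega>. f \<omega> \<partial>S) = (\<integral>\<^sup>+a. \<integral>\<^sup>+\<omega>. f (case_nat a \<omega>) \<partial>S \<partial>M)"
proof -
  have "(\<integral>\<^sup>+\<omega>. f \<omega> \<partial>S) = (\<integral>\<^sup>+\<omega>. f \<omega> \<partial>distr (M \<Otimes>\<^sub>M S) S (\<lambda>(s, \<omega>). case_nat s \<omega>))"
    by (simp add: PiM_iter)
  also have "\<dots> = (\<integral>\<^sup>+z. f (case_prod case_nat z) \<partial>(M \<Otimes>\<^sub>M S))"
    by (subst nn_integral_distr) (auto simp: case_prod_beta')
  also have "\<dots> = (\<integral>\<^sup>+a. \<integral>\<^sup>+\<omega>. f (case_nat a \<omega>) \<partial>S \<partial>M)"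
    by (subst P.nn_integral_fst[symmetric]) auto
  finally show ?thesis .
qed

lemma emeasure_S_Cons:
  assumes [measurable]: "E \<in> sets S"
  shows "emeasure S E = (\<integral>\<^sup>+a. emeasure S {\<omega>\<in>space S. case_nat a \<omega> \<in> E} \<partial>M)"
proof -
  have "emeasure S E = (\<integral>\<^sup>+\<omega>. indicator E \<omega> \<partial>S)" by simp
  also have "\<dots> = (\<integral>\<^sup>+a. \<integral>\<^sup>+\<omega>. indicator E (case_nat a \<omega>) \<partial>S \<partial>M)"
    by (rule nn_integral_S_Cons) simp
  also have "\<dots> = (\<integral>\<^sup>+a. emeasure S {\<omega>\<in>space S. case_nat a \<omega> \<in> E} \<partial>M)"
  proof (intro nn_integral_cong)
    fix a assume [measurable]: "a \<in> space M"
    have "(\<integral>\<^sup>+\<omega>. indicator E (case_nat a \<omega>) \<partial>S) =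
      (\<integral>\<^sup>+\<omega>. indicator {\<omega>\<in>space S. case_nat a \<omega> \<in> E} \<omega> \<partial>S)"
      by (intro nn_integral_cong) (auto simp: indicator_def)
    also have "\<dots> = emeasure S {\<omega>\<in>space S. case_nat a \<omega> \<in> E}"
      by (intro nn_integral_indicator) measurable
    finally show "(\<integral>\<^sup>+\<omega>. indicator E (case_nat a \<omega>) \<partial>S) = emeasure S {\<omega>\<in>space S. case_nat a \<omega> \<in> E}" .
  qed
  finally show ?thesis .
qed

text \<open>
Cylinders approximate the measurable sets in measure: the sets that can be approximated are closed
under complements and disjoint countable unions.
\<close>

lemma cylinder_approximation:
  assumes "E \<in> sets S" "\<epsilon> > 0"
  shows "\<exists>m F. F \<in> sets S \<and> depends_below m (space M) F \<and> P.prob ((E - F) \<union> (F - E)) < \<epsilon>"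
proof -
  let ?\<Omega> = "\<Pi>\<^sub>E i\<in>(UNIV::nat set). space M"
  have E: "E \<in> sigma_sets ?\<Omega> (prod_algebra UNIV (\<lambda>_. M))"
    using assms(1) by (simp add: sets_PiM)
  have sets_S: "sigma_sets ?\<Omega> (prod_algebra UNIV (\<lambda>_. M)) = sets S"
    by (simp add: sets_PiM)
  have "\<forall>\<epsilon>>0. \<exists>m F. F \<in> sets S \<and> depends_below m (space M) F \<and> P.prob ((E - F) \<union> (F - E)) < \<epsilon>"
    using Int_stable_prod_algebra prod_algebra_sets_into_space E
  proof (induction rule: sigma_sets_induct_disjoint)
    case (basic A)
    then obtain J X where J: "A = prod_emb UNIV (\<lambda>_. M) J (Pi\<^sub>E J X)" "finite J"
      "\<And>i. i \<in> J \<Longrightarrow> X i \<in> sets M"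
      by (auto elim!: prod_algebraE)
    then obtain m where m: "\<forall>j\<in>J. j < m"
      using finite_nat_set_iff_bounded by auto
    have "depends_below m (space M) A"
      using m unfolding depends_below_def J(1) prod_emb_def
      by (auto simp: PiE_iff Pi_iff extensional_def)
    moreover have "A \<in> sets S"
      using J by (auto intro!: sets_PiM_I)
    ultimately show ?case by (auto intro!: exI[of _ m] exI[of _ A])
  next
    case empty
    show ?case by (auto intro!: exI[of _ 0] exI[of _ "{}"] simp: depends_below_def)
  next
    case (compl A)
    show ?case
    proof (intro allI impI)
      fix \<epsilon> :: real assume "\<epsilon> > 0"
      with compl obtain m F where F: "F \<in> sets S" "depends_below m (space M) F"
        "P.prob ((A - F) \<union> (F - A)) < \<epsilon>" by blast
      have "((?\<Omega> - A) - (?\<Omega> - F)) \<union> ((?\<Omega> - F) - (?\<Omega> - A)) \<subseteq> (A - F) \<union> (F - A)" by auto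
      moreover have "A \<in> sets S" using compl sets_S by auto
      ultimately have "P.prob (((?\<Omega> - A) - (?\<Omega> - F)) \<union> ((?\<Omega> - F) - (?\<Omega> - A))) < \<epsilon>"
        using F by (intro le_less_trans[OF P.finite_measure_mono F(3)]) auto
      moreover have "?\<Omega> - F \<in> sets S"
        using sets.compl_sets[OF F(1)] by (simp add: space_PiM)
      moreover have "depends_below m (space M) (?\<Omega> - F)"
        using F(2) unfolding depends_below_def by (metis Diff_iff PiE_UNIV_domain)
      ultimately show "\<exists>m F. F \<in> sets S \<and> depends_below m (space M) F \<and>
          P.prob (((?\<Omega> - A) - F) \<union> (F - (?\<Omega> - A))) < \<epsilon>"
        by blast
    qed
  next
    case (union A)
    have A: "range A \<subseteq> sets S" using union sets_S by auto
    show ?case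
    proof (intro allI impI)
      fix \<epsilon> :: real assume e: "\<epsilon> > 0"
      have "(\<lambda>n. P.prob (\<Union>i<n. A i)) \<longlonglongrightarrow> P.prob (\<Union>n. \<Union>i<n. A i)"
        using A by (intro P.finite_Lim_measure_incseq) (auto simp: incseq_def intro: order_less_le_trans)
      moreover have "(\<Union>n. \<Union>i<n. A i) = (\<Union>i. A i)" by auto
      ultimately have "(\<lambda>n. P.prob (\<Union>i<n. A i)) \<longlonglongrightarrow> P.prob (\<Union>i. A i)" by simp
      from order_tendstoD(1)[OF this, of "P.prob (\<Union>i. A i) - \<epsilon>/2"] e
      obtain n where n: "P.prob (\<Union>i. A i) - \<epsilon>/2 < P.prob (\<Union>i<n. A i)"
        by (auto simp: eventually_sequentially)
      have "\<forall>i. \<exists>m F. F \<in> sets S \<and> depends_below m (space M) F \<and>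
          P.prob ((A i - F) \<union> (F - A i)) < \<epsilon> / (2 * (n + 1))"
        using union e by auto
      then obtain m F where F: "\<And>i. F i \<in> sets S" "\<And>i. depends_below (m i) (space M) (F i)"
        "\<And>i. P.prob ((A i - F i) \<union> (F i - A i)) < \<epsilon> / (2 * (n + 1))" by metis
      define G where "G = (\<Union>i<n. F i)"
      have "G \<in> sets S" using F by (auto simp: G_def)
      moreover have "depends_below (\<Sum>i<n. m i) (space M) G"
      proof -
        have "depends_below (\<Sum>i<n. m i) (space M) (F i)" if "i < n" for i
          using F(2)[of i] by (rule depends_below_mono) (use that in \<open>simp add: member_le_sum\<close>)
        then show ?thesis
          unfolding depends_below_def G_def UN_iff by (meson lessThan_iff)
      qed
      moreover have "P.prob (((\<Union>i. A i) - G) \<union> (G - (\<Union>i. A i))) < \<epsilon>"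
      proof -
        have "((\<Union>i. A i) - G) \<union> (G - (\<Union>i. A i)) \<subseteq>
            ((\<Union>i. A i) - (\<Union>i<n. A i)) \<union> (\<Union>i<n. (A i - F i) \<union> (F i - A i))"
          unfolding G_def by auto
        then have "P.prob (((\<Union>i. A i) - G) \<union> (G - (\<Union>i. A i))) \<le>
            P.prob (((\<Union>i. A i) - (\<Union>i<n. A i)) \<union> (\<Union>i<n. (A i - F i) \<union> (F i - A i)))"
          using A F by (intro P.finite_measure_mono) auto
        also have "\<dots> \<le> P.prob ((\<Union>i. A i) - (\<Union>i<n. A i)) + P.prob (\<Union>i<n. (A i - F i) \<union> (F i - A i))"
          using A F by (intro measure_Un_le) auto
        also have "P.prob ((\<Union>i. A i) - (\<Union>i<n. A i)) = P.prob (\<Union>i. A i) - P.prob (\<Union>i<n. A i)"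
          using A by (intro P.finite_measure_Diff) auto
        also have "P.prob (\<Union>i<n. (A i - F i) \<union> (F i - A i)) \<le> (\<Sum>i<n. P.prob ((A i - F i) \<union> (F i - A i)))"
          using A F by (intro P.finite_measure_subadditive_finite) auto
        also have "\<dots> \<le> (\<Sum>i<n. \<epsilon> / (2 * (n + 1)))"
          using F(3) by (intro sum_mono) (auto intro: less_imp_le)
        also have "\<dots> \<le> \<epsilon> / 2"
          using e by (simp add: field_simps)
        finally show ?thesis using n by simp
      qed
      ultimately show "\<exists>m G. G \<in> sets S \<and> depends_below m (space M) G \<and>
          P.prob (((\<Union>i. A i) - G) \<union> (G - (\<Union>i. A i))) < \<epsilon>" by blast
    qed
  qed
  with assms(2) show ?thesis by blast
qed

text \<open>
Conditionally on the first \<open>m\<close> coordinates, each of the events \<open>E i\<close> has probability at least \<open>q\<close>: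
by \<open>step\<close>, applied \<open>m\<close> times, \<open>E i\<close> contains a copy of some \<open>E j\<close> on the remaining coordinates.  So the
complement \<open>D\<close> of \<open>E i\<close> satisfies \<open>P (F \<inter> D) \<le> (1 - q) P F\<close> for all cylinders \<open>F\<close>, hence for all
measurable \<open>F\<close>, and \<open>F = D\<close> gives \<open>P D = 0\<close>.
\<close>

lemma zero_one_step:
  assumes E: "\<And>i. i \<in> J \<Longrightarrow> E i \<in> sets S"
    and q: "\<And>i. i \<in> J \<Longrightarrow> q \<le> P.prob (E i)" "q > 0"
    and step: "\<And>i. i \<in> J \<Longrightarrow>
      AE a in M. \<exists>j\<in>J. AE \<omega> in S. \<omega> \<in> E j \<longrightarrow> case_nat a \<omega> \<in> E i"
    and i: "i \<in> J"
  shows "AE \<omega> in S. \<omega> \<in> E i"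
proof -
  have q1: "q \<le> 1" using q(1)[OF i] P.prob_le_1 by (rule order_trans)
  \<comment> \<open>The induction removes the first coordinate of the cylinder and uses Fubini.\<close>
  have cyl: "emeasure S (F - E i) \<le> ennreal (1 - q) * emeasure S F"
    if "F \<in> sets S" "depends_below m (space M) F" "i \<in> J" for F m i
    using that
  proof (induction m arbitrary: F i)
    case 0
    have "F = {} \<or> F = space S"
    proof (cases "F = {}")
      case False
      then obtain \<omega> where "\<omega> \<in> F" by auto
      moreover have FS: "F \<subseteq> space S" using 0 sets.sets_into_space by blast
      ultimately have "\<omega>' \<in> F" if "\<omega>' \<in> space S" for \<omega>'
        using 0(2) that unfolding depends_below_def space_S by (metis less_nat_zero_code subsetD)
      with FS show ?thesis by blast
    qed auto
    then show ?case
    proof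
      assume "F = space S"
      moreover have "emeasure S (space S - E i) = ennreal (1 - P.prob (E i))"
        using E[OF 0(3)] by (simp add: P.emeasure_eq_measure P.prob_compl)
      moreover have "\<dots> \<le> ennreal (1 - q)" using q(1)[OF 0(3)] by (intro ennreal_leI) auto
      ultimately show ?case by (simp add: P.emeasure_space_1)
    qed simp
  next
    case (Suc m)
    note [measurable] = Suc.prems(1) E[OF Suc.prems(3)]
    have "emeasure S (F - E i) = (\<integral>\<^sup>+a. emeasure S {\<omega>\<in>space S. case_nat a \<omega> \<in> F - E i} \<partial>M)"
      by (rule emeasure_S_Cons) simp
    also have "\<dots> \<le> (\<integral>\<^sup>+a. ennreal (1 - q) * emeasure S {\<omega>\<in>space S. case_nat a \<omega> \<in> F} \<partial>M)"
    proof (intro nn_integral_mono_AE)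
      from step[OF Suc.prems(3)]
      show "AE a in M. emeasure S {\<omega>\<in>space S. case_nat a \<omega> \<in> F - E i} \<le>
          ennreal (1 - q) * emeasure S {\<omega>\<in>space S. case_nat a \<omega> \<in> F}"
      proof (rule AE_mp, intro AE_I2 impI)
        fix a assume a[measurable]: "a \<in> space M"
          and "\<exists>j\<in>J. AE \<omega> in S. \<omega> \<in> E j \<longrightarrow> case_nat a \<omega> \<in> E i"
        then obtain j where j: "j \<in> J" "AE \<omega> in S. \<omega> \<in> E j \<longrightarrow> case_nat a \<omega> \<in> E i" by auto
        note [measurable] = E[OF j(1)]
        let ?Fa = "{\<omega>\<in>space S. case_nat a \<omega> \<in> F}"
        have meas: "?Fa \<in> sets S" by measurable
        have "emeasure S {\<omega>\<in>space S. case_nat a \<omega> \<in> F - E i} \<le> emeasure S (?Fa - E j)"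
          using j(2) by (intro emeasure_mono_AE) (auto elim!: eventually_mono)
        also have "\<dots> \<le> ennreal (1 - q) * emeasure S ?Fa"
        proof (rule Suc.IH[OF meas _ j(1)])
          show "depends_below m (space M) ?Fa"
            unfolding depends_below_def
          proof (intro ballI impI)
            fix \<omega> \<omega>' assume *: "\<omega> \<in> UNIV \<rightarrow> space M" "\<omega>' \<in> UNIV \<rightarrow> space M" "\<forall>k<m. \<omega> k = \<omega>' k"
            have "\<forall>k<Suc m. case_nat a \<omega> k = case_nat a \<omega>' k"
              using *(3) by (auto split: nat.split)
            moreover have "case_nat a \<omega> \<in> UNIV \<rightarrow> space M" "case_nat a \<omega>' \<in> UNIV \<rightarrow> space M"
              using * a by (auto split: nat.split simp: Pi_iff)
            ultimately have "case_nat a \<omega> \<in> F \<longleftrightarrow> case_nat a \<omega>' \<in> F"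
              using Suc.prems(2) unfolding depends_below_def by blast
            then show "\<omega> \<in> ?Fa \<longleftrightarrow> \<omega>' \<in> ?Fa" using * by (simp add: space_S)
          qed
        qed
        finally show "emeasure S {\<omega>\<in>space S. case_nat a \<omega> \<in> F - E i} \<le>
          ennreal (1 - q) * emeasure S {\<omega>\<in>space S. case_nat a \<omega> \<in> F}" .
      qed
    qed
    also have "\<dots> = ennreal (1 - q) * (\<integral>\<^sup>+a. emeasure S {\<omega>\<in>space S. case_nat a \<omega> \<in> F} \<partial>M)"
      by (rule nn_integral_cmult) measurable
    also have "\<dots> = ennreal (1 - q) * emeasure S F"
      by (simp add: emeasure_S_Cons[symmetric])
    finally show ?case .
  qed
  note Ei[measurable] = E[OF i]
  define D where "D = space S - E i"
  have D[measurable]: "D \<in> sets S" by (simp add: D_def)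
  have le: "P.prob D \<le> (1 - q) * P.prob D + 2 * \<epsilon>" if e: "\<epsilon> > 0" for \<epsilon>
  proof -
    obtain m F where F[measurable]: "F \<in> sets S" and Fm: "depends_below m (space M) F"
      and Fe: "P.prob ((D - F) \<union> (F - D)) < \<epsilon>"
      using cylinder_approximation[OF D e] by blast
    have FS: "F \<subseteq> space S" using F sets.sets_into_space by blast
    have "ennreal (P.prob (F - E i)) \<le> ennreal ((1 - q) * P.prob F)"
      using cyl[OF F Fm i] q1 by (simp add: P.emeasure_eq_measure ennreal_mult)
    then have 1: "P.prob (F - E i) \<le> (1 - q) * P.prob F"
      using q1 by (subst (asm) ennreal_le_iff) auto
    have "P.prob D \<le> P.prob ((F - E i) \<union> ((D - F) \<union> (F - D)))"
      by (intro P.finite_measure_mono) (auto simp: D_def)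
    also have "\<dots> \<le> P.prob (F - E i) + P.prob ((D - F) \<union> (F - D))"
      by (intro measure_Un_le) auto
    finally have 2: "P.prob D \<le> P.prob (F - E i) + \<epsilon>" using Fe by simp
    have "P.prob F \<le> P.prob (D \<union> ((D - F) \<union> (F - D)))"
      by (intro P.finite_measure_mono) auto
    also have "\<dots> \<le> P.prob D + P.prob ((D - F) \<union> (F - D))"
      by (intro measure_Un_le) auto
    finally have "P.prob F \<le> P.prob D + \<epsilon>" using Fe by simp
    then have "(1 - q) * P.prob F \<le> (1 - q) * P.prob D + (1 - q) * \<epsilon>"
      using q1 by (metis diff_ge_0_iff_ge distrib_left mult_left_mono)
    also have "(1 - q) * \<epsilon> \<le> \<epsilon>" using q e by (simp add: algebra_simps)
    finally show ?thesis using 1 2 by linarith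
  qed
  have "P.prob D \<le> (1 - q) * P.prob D + \<delta>" if "\<delta> > 0" for \<delta>
    using le[of "\<delta> / 2"] that by simp
  then have "P.prob D \<le> (1 - q) * P.prob D" by (rule field_le_epsilon)
  then have "q * P.prob D \<le> 0" by (simp add: algebra_simps)
  then have "P.prob D = 0" using q(2) measure_nonneg[of S D]
    by (simp add: mult_le_0_iff)
  then have "D \<in> null_sets S" by (simp add: P.emeasure_eq_measure null_sets_def)
  from AE_not_in[OF this] AE_space show ?thesis
    by eventually_elim (simp add: D_def)
qed

end

section \<open>The greedy decomposition and Birkhoff sums\<close>

text \<open>
\<open>V p i\<close> is the value of a problem of length \<open>p\<close> in state \<open>i\<close>; each step solves a piece of length \<open>k\<close> at
rate \<open>a\<close> and passes to a state \<open>j\<close> that it may choose.  The error \<open>e p\<close> is paid only at the positions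
\<open>p\<close> that are visited, hence the sum over all positions is an upper bound for the total error.
\<close>

lemma greedy_upper_bound:
  fixes V :: "nat \<Rightarrow> 'i \<Rightarrow> ereal" and e :: "nat \<Rightarrow> real"
  assumes V0: "\<And>i. i \<in> J \<Longrightarrow> V 0 i \<le> 0"
    and e: "\<And>p. 0 \<le> e p"
    and step: "\<And>p i. p \<in> {1..n} \<Longrightarrow> i \<in> J \<Longrightarrow>
      \<exists>k\<in>{1..p}. \<exists>j\<in>J. V p i \<le> ereal (a * k + e p) + V (p - k) j"
    and p: "p \<le> n" "i \<in> J"
  shows "V p i \<le> ereal (a * p + (\<Sum>u\<in>{1..p}. e u))"
  using p
proof (induction p arbitrary: i rule: less_induct)
  case (less p)
  show ?case
  proof (cases "p = 0")
    case True
    then show ?thesis using V0[OF less.prems(2)] by (simp add: zero_ereal_def)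
  next
    case False
    with less.prems have "p \<in> {1..n}" by auto
    from step[OF this less.prems(2)] obtain k j where kj: "k \<in> {1..p}" "j \<in> J"
      "V p i \<le> ereal (a * k + e p) + V (p - k) j" by blast
    have "(\<Sum>u\<in>{1..p - k}. e u) + e p = (\<Sum>u\<in>insert p {1..p - k}. e u)"
      using kj(1) by (subst sum.insert) auto
    also have "\<dots> \<le> (\<Sum>u\<in>{1..p}. e u)"
      using kj(1) e by (intro sum_mono2) auto
    finally have es: "(\<Sum>u\<in>{1..p - k}. e u) + e p \<le> (\<Sum>u\<in>{1..p}. e u)" .
    have "V (p - k) j \<le> ereal (a * (p - k) + (\<Sum>u\<in>{1..p - k}. e u))"
      using kj less.prems by (intro less.IH) auto
    then have "V p i \<le> ereal (a * k + e p) + ereal (a * (p - k) + (\<Sum>u\<in>{1..p - k}. e u))"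
      using kj(3) by (meson add_left_mono order_trans)
    also have "\<dots> = ereal (a * p + ((\<Sum>u\<in>{1..p - k}. e u) + e p))"
      using kj(1) by (simp add: of_nat_diff algebra_simps)
    also have "\<dots> \<le> ereal (a * p + (\<Sum>u\<in>{1..p}. e u))" using es by simp
    finally show ?thesis .
  qed
qed

text \<open>
The mirror image, for superadditive quantities.
\<close>

lemma greedy_lower_bound:
  fixes V :: "nat \<Rightarrow> 'i \<Rightarrow> ereal" and e :: "nat \<Rightarrow> real"
  assumes V0: "\<And>i. i \<in> J \<Longrightarrow> 0 \<le> V 0 i"
    and e: "\<And>p. 0 \<le> e p"
    and step: "\<And>p i. p \<in> {1..n} \<Longrightarrow> i \<in> J \<Longrightarrow>
      \<exists>k\<in>{1..p}. \<exists>j\<in>J. ereal (a * k - e p) + V (p - k) j \<le> V p i"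
    and p: "p \<le> n" "i \<in> J"
  shows "ereal (a * p - (\<Sum>u\<in>{1..p}. e u)) \<le> V p i"
proof -
  have "- V p i \<le> ereal (- a * p + (\<Sum>u\<in>{1..p}. e u))"
  proof (rule greedy_upper_bound[where V = "\<lambda>p i. - V p i" and n = n and J = J])
    fix p i assume "p \<in> {1..n}" "i \<in> J"
    from step[OF this] obtain k j where kj: "k \<in> {1..p}" "j \<in> J"
      "ereal (a * k - e p) + V (p - k) j \<le> V p i" by blast
    have "- V p i \<le> - (ereal (a * k - e p) + V (p - k) j)" using kj(3) by simp
    also have "\<dots> = ereal (- a * k + e p) + - V (p - k) j"
      by (cases "V (p - k) j") auto
    finally show "\<exists>k\<in>{1..p}. \<exists>j\<in>J. - V p i \<le> ereal (- a * k + e p) + - V (p - k) j"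
      using kj by blast
  qed (use V0 e p in auto)
  then have "- ereal (- a * p + (\<Sum>u\<in>{1..p}. e u)) \<le> V p i"
    by (cases "V p i") auto
  then show ?thesis by simp
qed

lemma AE_all_pos:
  fixes Q :: "real \<Rightarrow> 'a \<Rightarrow> bool"
  assumes "\<And>\<epsilon>. \<epsilon> > 0 \<Longrightarrow> AE x in N. Q \<epsilon> x"
    and mono: "\<And>\<epsilon> \<epsilon>' x. \<epsilon> \<le> \<epsilon>' \<Longrightarrow> Q \<epsilon> x \<Longrightarrow> Q \<epsilon>' x"
  shows "AE x in N. \<forall>\<epsilon>>0. Q \<epsilon> x"
proof -
  have "AE x in N. \<forall>n. Q (1 / Suc n) x"
    using assms(1) by (simp add: AE_all_countable)
  then show ?thesis
  proof eventually_elim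
    case (elim x)
    show ?case
    proof (intro allI impI)
      fix \<epsilon> :: real assume "\<epsilon> > 0"
      then obtain n where "1 / Suc n < \<epsilon>" using nat_approx_posE by blast
      then show "Q \<epsilon> x" using elim mono by (meson less_imp_le)
    qed
  qed
qed

definition drop_sum :: "((nat \<Rightarrow> 'a) \<Rightarrow> real) \<Rightarrow> nat \<Rightarrow> (nat \<Rightarrow> 'a) \<Rightarrow> real" where
  "drop_sum h n \<omega> = (\<Sum>s<n. h (seq_drop s \<omega>))"

lemma drop_sum_add: "drop_sum h (m + n) \<omega> = drop_sum h m \<omega> + drop_sum h n (seq_drop m \<omega>)"
  by (induction n) (auto simp: drop_sum_def seq_drop_def add.assoc)

lemma drop_sum_0 [simp]: "drop_sum h 0 \<omega> = 0"
  by (simp add: drop_sum_def)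

lemma drop_sum_1 [simp]: "drop_sum h (Suc 0) \<omega> = h \<omega>"
  by (simp add: drop_sum_def)

lemma drop_sum_nonneg: "(\<And>\<omega>. 0 \<le> h \<omega>) \<Longrightarrow> 0 \<le> drop_sum h n \<omega>"
  by (simp add: drop_sum_def sum_nonneg)

context sequence_space
begin

lemma measurable_drop_sum [measurable]:
  assumes [measurable]: "h \<in> borel_measurable S"
  shows "drop_sum h n \<in> borel_measurable S"
  unfolding drop_sum_def by measurable

lemma integrable_seq_drop:
  fixes h :: "_ \<Rightarrow> real"
  assumes "integrable S h"
  shows "integrable S (\<lambda>\<omega>. h (seq_drop s \<omega>))"
  using integrable_distr[OF measurable_seq_drop[of s], of h] assms unfolding distr_seq_drop by simp

lemma integral_seq_drop:
  fixes h :: "_ \<Rightarrow> real"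
  assumes "h \<in> borel_measurable S"
  shows "(\<integral>\<omega>. h (seq_drop s \<omega>) \<partial>S) = (\<integral>\<omega>. h \<omega> \<partial>S)"
  using integral_distr[OF measurable_seq_drop[of s] assms] unfolding distr_seq_drop by simp

lemma integral_drop_sum:
  fixes h :: "_ \<Rightarrow> real"
  assumes "integrable S h"
  shows "integrable S (drop_sum h n)" "(\<integral>\<omega>. drop_sum h n \<omega> \<partial>S) = n * (\<integral>\<omega>. h \<omega> \<partial>S)"
  using assms unfolding drop_sum_def
  by (auto simp: integrable_seq_drop integral_seq_drop borel_measurable_integrable)

lemma integrable_coordinate:
  fixes f :: "_ \<Rightarrow> real"
  assumes "integrable M f"
  shows "integrable S (\<lambda>\<omega>. f (\<omega> n))" "(\<integral>\<omega>. f (\<omega> n) \<partial>S) = (\<integral>a. f a \<partial>M)"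
proof -
  have c: "distr S M (\<lambda>\<omega>. \<omega> n) = M" by (rule PiM_component) simp
  have m: "(\<lambda>\<omega>. \<omega> n) \<in> measurable S M" by measurable
  show "integrable S (\<lambda>\<omega>. f (\<omega> n))"
    using integrable_distr[OF m, of f] assms unfolding c by simp
  show "(\<integral>\<omega>. f (\<omega> n) \<partial>S) = (\<integral>a. f a \<partial>M)"
    using integral_distr[OF m, of f] assms unfolding c by (simp add: borel_measurable_integrable)
qed

lemma integral_off_increasing_events:
  fixes h :: "_ \<Rightarrow> real"
  assumes h: "integrable S h" and G: "\<And>N. G N \<in> sets S" "incseq G"
    and all: "AE \<omega> in S. \<exists>N. \<omega> \<in> G N"
  shows "(\<lambda>N. \<integral>\<omega>. indicator (space S - G N) \<omega> * h \<omega> \<partial>S) \<longlonglongrightarrow> 0"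
proof -
  have [measurable]: "h \<in> borel_measurable S" using h by simp
  note [measurable] = G(1)
  have "(\<lambda>N. \<integral>\<omega>. indicator (space S - G N) \<omega> * h \<omega> \<partial>S) \<longlonglongrightarrow> (\<integral>\<omega>. 0 \<partial>S)"
  proof (rule integral_dominated_convergence[where w = "\<lambda>\<omega>. norm (h \<omega>)"])
    show "AE \<omega> in S. (\<lambda>N. indicator (space S - G N) \<omega> * h \<omega>) \<longlonglongrightarrow> 0"
      using all
    proof eventually_elim
      case (elim \<omega>)
      then obtain N where N: "\<omega> \<in> G N" by auto
      have "indicator (space S - G n) \<omega> * h \<omega> = 0" if "n \<ge> N" for n
        using N incseqD[OF G(2) that] by auto
      then show ?case
        by (intro tendsto_eventually) (auto simp: eventually_sequentially)
    qed
  qed (use h in \<open>auto simp: abs_mult indicator_def\<close>)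
  then show ?thesis by simp
qed

text \<open>
If \<open>drop_sum h n - a n\<close> were unbounded above with positive probability, it would be so almost surely by
the zero-one law: as \<open>h\<close> is nonnegative, prefixing a coordinate lowers this difference by at most \<open>a\<close>.  Then
almost every sequence starts with a block of rate at least \<open>a\<close>, and the greedy decomposition shows
that the mean of \<open>h\<close> is at least \<open>a\<close>.
\<close>

theorem ergodic_upper_bound:
  assumes h: "integrable S h" and nonneg: "\<And>\<omega>. 0 \<le> h \<omega>"
    and a: "(\<integral>\<omega>. h \<omega> \<partial>S) < a"
  shows "AE \<omega> in S. \<exists>C::nat. \<forall>n. drop_sum h n \<omega> \<le> a * n + C"
proof -
  have [measurable]: "h \<in> borel_measurable S" using h by simp
  have "0 \<le> (\<integral>\<omega>. h \<omega> \<partial>S)" using nonneg by simp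
  then have a0: "a > 0" using a by simp
  define E where "E = {\<omega>\<in>space S. \<forall>C::nat. \<exists>n. a * n + C \<le> drop_sum h n \<omega>}"
  have E[measurable]: "E \<in> sets S" unfolding E_def by measurable
  have "P.prob E = 0"
  proof (rule ccontr)
    assume "P.prob E \<noteq> 0"
    then have pos: "P.prob E > 0" by (simp add: zero_less_measure_iff)
    have AE_E: "AE \<omega> in S. \<omega> \<in> E"
    proof (rule zero_one_step[where J = "{()}" and E = "\<lambda>_. E" and q = "P.prob E"])
      show "AE x in M. \<exists>j\<in>{()}. AE \<omega> in S. \<omega> \<in> E \<longrightarrow> case_nat x \<omega> \<in> E"
      proof (intro AE_I2 bexI[of _ "()"] impI)
        fix x \<omega> assume x: "x \<in> space M" and \<omega>: "\<omega> \<in> E"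
        have "\<exists>n. a * n + C \<le> drop_sum h n (case_nat x \<omega>)" for C :: nat
        proof -
          obtain n where n: "a * n + (C + nat \<lceil>a\<rceil>) \<le> drop_sum h n \<omega>"
            using \<omega> unfolding E_def by (auto dest!: spec[of _ "C + nat \<lceil>a\<rceil>"])
          have "drop_sum h n \<omega> \<le> drop_sum h (Suc 0 + n) (case_nat x \<omega>)"
            unfolding drop_sum_add using nonneg by simp
          moreover have "a \<le> nat \<lceil>a\<rceil>" by linarith
          ultimately have "a * (Suc n) + C \<le> drop_sum h (Suc n) (case_nat x \<omega>)"
            using n by (simp add: algebra_simps)
          then show ?thesis by blast
        qed
        moreover have "case_nat x \<omega> \<in> space S"
          using x \<omega> by (auto simp: E_def space_S Pi_iff split: nat.split)
        ultimately show "case_nat x \<omega> \<in> E" by (simp add: E_def)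
      qed simp
    qed (use pos in auto)
    define G where "G N = {\<omega>\<in>space S. \<exists>k\<in>{1..N}. a * k \<le> drop_sum h k \<omega>}" for N :: nat
    have G[measurable]: "G N \<in> sets S" for N unfolding G_def by measurable
    have "incseq G" unfolding G_def incseq_def by force
    moreover have "AE \<omega> in S. \<exists>N. \<omega> \<in> G N"
      using AE_E
    proof eventually_elim
      case (elim \<omega>)
      \<comment> \<open>The level \<open>1\<close> excludes the empty block.\<close>
      then obtain n where n: "a * n + 1 \<le> drop_sum h n \<omega>"
        unfolding E_def by (auto dest!: spec[of _ 1])
      moreover from n have "n \<noteq> 0" by (auto intro: ccontr)
      ultimately have "\<omega> \<in> G n" using elim unfolding G_def E_def
        by (auto intro!: bexI[of _ n])
      then show ?case by blast
    qed
    ultimately have lim: "(\<lambda>N. \<integral>\<omega>. indicator (space S - G N) \<omega> * a \<partial>S) \<longlonglongrightarrow> 0"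
      using G by (intro integral_off_increasing_events) auto
    have "a \<le> (\<integral>\<omega>. h \<omega> \<partial>S) + (\<integral>\<omega>. indicator (space S - G N) \<omega> * a \<partial>S)" for N
    proof -
      define g where "g \<omega> = indicator (space S - G N) \<omega> * a" for \<omega>
      have gi: "integrable S g" unfolding g_def
        using a0 by (intro P.integrable_const_bound[where B = a]) (auto simp: indicator_def)
      have g0: "0 \<le> g \<omega>" for \<omega> using a0 by (simp add: g_def)
      have pw: "a * n \<le> drop_sum h n \<omega> + drop_sum g n \<omega> + a * N" if \<omega>: "\<omega> \<in> space S" for n \<omega>
      proof -
        have sd: "seq_drop s \<omega> \<in> space S" for s using \<omega> by (auto simp: space_S)
        \<comment> \<open>The second summand pays for the last \<open>N\<close> positions, where a good block need not fit.\<close>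
        define e where "e p = g (seq_drop (n - p) \<omega>) + (if p < N then a else 0)" for p
        have "ereal (a * n - (\<Sum>u\<in>{1..n}. e u)) \<le> ereal (drop_sum h n (seq_drop (n - n) \<omega>))"
        proof (rule greedy_lower_bound[where V = "\<lambda>p _. ereal (drop_sum h p (seq_drop (n - p) \<omega>))"
                and n = n and J = "{()}"])
          fix p i assume p: "p \<in> {1..n}"
          show "\<exists>k\<in>{1..p}. \<exists>j\<in>{()}. ereal (a * k - e p) + ereal (drop_sum h (p - k) (seq_drop (n - (p - k)) \<omega>))
               \<le> ereal (drop_sum h p (seq_drop (n - p) \<omega>))"
          proof -
            have split: "drop_sum h p (seq_drop (n - p) \<omega>) =
              drop_sum h k (seq_drop (n - p) \<omega>) + drop_sum h (p - k) (seq_drop (n - (p - k)) \<omega>)"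
              if "k \<le> p" for k
              using drop_sum_add[of h k "p - k" "seq_drop (n - p) \<omega>"] that p by (simp add: Nat.diff_diff_right)
            show ?thesis
            proof (cases "seq_drop (n - p) \<omega> \<in> G N \<and> N \<le> p")
              case True
              then obtain k where k: "k \<in> {1..N}" "a * k \<le> drop_sum h k (seq_drop (n - p) \<omega>)"
                unfolding G_def by auto
              have "0 \<le> e p" using g0 a0 by (simp add: e_def)
              moreover have "k \<le> p" using k True by auto
              ultimately show ?thesis using k split[of k] by (intro bexI[of _ k]) auto
            next
              case False
              then have "a \<le> e p" using a0 sd by (auto simp: e_def g_def indicator_def)
              moreover have "0 \<le> drop_sum h 1 (seq_drop (n - p) \<omega>)" using nonneg by simp
              ultimately show ?thesis using p by (intro bexI[of _ 1]) (auto simp: split)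
            qed
          qed
        qed (use g0 a0 in \<open>auto simp: e_def\<close>)
        then have "a * n \<le> drop_sum h n \<omega> + (\<Sum>u\<in>{1..n}. e u)" by simp
        also have "(\<Sum>u\<in>{1..n}. e u) = (\<Sum>u\<in>{1..n}. g (seq_drop (n - u) \<omega>)) + (\<Sum>u\<in>{1..n}. if u < N then a else 0)"
          by (simp add: e_def sum.distrib)
        also have "(\<Sum>u\<in>{1..n}. g (seq_drop (n - u) \<omega>)) = drop_sum g n \<omega>"
          unfolding drop_sum_def
          by (rule sum.reindex_bij_witness[of _ "\<lambda>s. n - s" "\<lambda>u. n - u"]) auto
        also have "(\<Sum>u\<in>{1..n}. if u < N then a else 0) \<le> (\<Sum>u\<in>{1..N}. a)"
        proof -
          have "(\<Sum>u\<in>{1..n}. if u < N then a else 0) = (\<Sum>u\<in>{1..n} \<inter> {u. u < N}. a)"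
            by (subst sum.If_cases) auto
          also have "\<dots> \<le> (\<Sum>u\<in>{1..N}. a)" using a0 by (intro sum_mono2) auto
          finally show ?thesis .
        qed
        finally show ?thesis by (simp add: algebra_simps)
      qed
      have int: "a * n \<le> n * (\<integral>\<omega>. h \<omega> \<partial>S) + n * (\<integral>\<omega>. g \<omega> \<partial>S) + a * N" for n :: nat
      proof -
        have "(\<integral>\<omega>. a * n \<partial>S) \<le> (\<integral>\<omega>. drop_sum h n \<omega> + drop_sum g n \<omega> + a * N \<partial>S)"
          using pw by (intro integral_mono) (auto intro!: integral_drop_sum h gi)
        also have "\<dots> = n * (\<integral>\<omega>. h \<omega> \<partial>S) + n * (\<integral>\<omega>. g \<omega> \<partial>S) + a * N"
          by (simp add: integral_drop_sum h gi P.prob_space)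
        finally show ?thesis by (simp add: P.prob_space)
      qed
      have "a \<le> (\<integral>\<omega>. h \<omega> \<partial>S) + (\<integral>\<omega>. g \<omega> \<partial>S)"
      proof (rule ccontr)
        assume "\<not> ?thesis"
        then obtain n :: nat where "a * N < n * (a - ((\<integral>\<omega>. h \<omega> \<partial>S) + (\<integral>\<omega>. g \<omega> \<partial>S)))"
          using reals_Archimedean3[of "a - ((\<integral>\<omega>. h \<omega> \<partial>S) + (\<integral>\<omega>. g \<omega> \<partial>S))"] by auto
        with int[of n] show False by (simp add: algebra_simps)
      qed
      then show ?thesis by (simp add: g_def)
    qed
    with lim have "a \<le> (\<integral>\<omega>. h \<omega> \<partial>S) + 0"
      by (intro LIMSEQ_le_const[OF tendsto_add[OF tendsto_const lim]]) auto
    then show False using a by simp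
  qed
  then have "E \<in> null_sets S" by (simp add: P.emeasure_eq_measure null_sets_def)
  from AE_not_in[OF this] AE_space show ?thesis
    by eventually_elim (auto simp: E_def not_le intro: less_imp_le)
qed

text \<open>
Truncation: \<open>f\<close> exceeds \<open>K\<close> by an amount of mean less than \<open>\<delta>\<close>, and a single term is bounded by the
Birkhoff sum of these excesses.
\<close>

lemma AE_coordinate_sublinear:
  fixes f :: "_ \<Rightarrow> real"
  assumes f: "integrable M f" and nonneg: "\<And>x. 0 \<le> f x"
  shows "AE \<omega> in S. \<forall>\<delta>>0. \<exists>C\<ge>0. \<forall>n. f (\<omega> n) \<le> \<delta> * n + C"
proof (rule AE_all_pos)
  fix \<delta> :: real assume \<delta>: "\<delta> > 0"
  have [measurable]: "f \<in> borel_measurable M" using f by simp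
  have "(\<lambda>K. \<integral>x. max 0 (f x - real K) \<partial>M) \<longlonglongrightarrow> (\<integral>x. 0 \<partial>M)"
  proof (rule integral_dominated_convergence[where w = f])
    show "AE x in M. (\<lambda>K. max 0 (f x - real K)) \<longlonglongrightarrow> 0"
    proof (intro AE_I2 tendsto_eventually)
      fix x
      show "\<forall>\<^sub>F K in sequentially. max 0 (f x - real K) = 0"
        using eventually_ge_at_top[of "nat \<lceil>f x\<rceil>"] by eventually_elim linarith
    qed
  qed (use f nonneg in \<open>auto simp: max_def\<close>)
  then have "(\<lambda>K. \<integral>x. max 0 (f x - real K) \<partial>M) \<longlonglongrightarrow> 0" by simp
  from order_tendstoD(2)[OF this \<delta>] obtain K where K: "(\<integral>x. max 0 (f x - real K) \<partial>M) < \<delta>"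
    by (auto simp: eventually_sequentially)
  define h where "h = (\<lambda>\<omega>. max 0 (f ((\<omega> :: nat \<Rightarrow> _) 0) - real K))"
  have i: "integrable M (\<lambda>x. max 0 (f x - real K))" using f by simp
  have "AE \<omega> in S. \<exists>C::nat. \<forall>n. drop_sum h n \<omega> \<le> \<delta> * n + C"
    using integrable_coordinate[OF i, of 0] K
    by (intro ergodic_upper_bound) (auto simp: h_def)
  then show "AE \<omega> in S. \<exists>C\<ge>0. \<forall>n. f (\<omega> n) \<le> \<delta> * n + C"
  proof eventually_elim
    case (elim \<omega>)
    then obtain C :: nat where C: "\<And>n. drop_sum h n \<omega> \<le> \<delta> * n + C" by blast
    have "f (\<omega> n) \<le> \<delta> * n + (\<delta> + C + K)" for n
    proof -
      have "drop_sum h n \<omega> \<ge> 0" by (rule drop_sum_nonneg) (simp add: h_def)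
      moreover have "drop_sum h (Suc n) \<omega> = drop_sum h n \<omega> + h (seq_drop n \<omega>)"
        by (simp add: drop_sum_def)
      moreover have "f (\<omega> n) - K \<le> h (seq_drop n \<omega>)" by (simp add: h_def)
      ultimately show ?thesis using C[of "Suc n"] by (simp add: algebra_simps)
    qed
    moreover have "\<delta> + C + K \<ge> 0" using \<delta> by simp
    ultimately show ?case by blast
  qed
next
  fix \<delta> \<delta>' :: real and \<omega> assume "\<delta> \<le> \<delta>'" "\<exists>C\<ge>0. \<forall>n. f (\<omega> n) \<le> \<delta> * real n + C"
  then show "\<exists>C\<ge>0. \<forall>n. f (\<omega> n) \<le> \<delta>' * real n + C"
    by (meson add_right_mono mult_right_mono of_nat_0_le_iff order_trans)
qed

end

section \<open>Optimal walks\<close>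

text \<open>
\<open>bwalk I n \<omega> i\<close> and \<open>fwalk I n \<omega> i\<close> are the largest weights of walks of \<open>n\<close> arcs that start in \<open>i\<close> and
then stay in \<open>I\<close>, reading the matrices \<open>\<omega> (n - 1), \<dots>, \<omega> 0\<close>, respectively \<open>\<omega> 0, \<dots>, \<omega> (n - 1)\<close>.  For fixed
\<open>n\<close> they have the same law, but only the second one decomposes along the first coordinate of \<open>\<omega>\<close>.
\<close>

primrec bwalk :: "'d set \<Rightarrow> nat \<Rightarrow> (nat \<Rightarrow> 'd mp_matrix) \<Rightarrow> 'd \<Rightarrow> ereal" where
  "bwalk I 0 = (\<lambda>\<omega> i. 0)"
| "bwalk I (Suc n) = (\<lambda>\<omega> i. SUP j\<in>I. \<omega> n i j + bwalk I n \<omega> j)"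

primrec fwalk :: "'d set \<Rightarrow> nat \<Rightarrow> (nat \<Rightarrow> 'd mp_matrix) \<Rightarrow> 'd \<Rightarrow> ereal" where
  "fwalk I 0 = (\<lambda>\<omega> i. 0)"
| "fwalk I (Suc n) = (\<lambda>\<omega> i. SUP j\<in>I. \<omega> 0 i j + fwalk I n (seq_drop 1 \<omega>) j)"

definition peak :: "'d set \<Rightarrow> nat \<Rightarrow> (nat \<Rightarrow> 'd mp_matrix) \<Rightarrow> ereal" where
  "peak I n \<omega> = (SUP i\<in>I. bwalk I n \<omega> i)"

text \<open>
A sum instead of a maximum over the finite entries: \<open>real_of_ereal\<close> maps \<open>-\<infinity>\<close> to \<open>0\<close>, so that this is a
nonnegative bound for the finite entries of every matrix.
\<close>

definition entry_bound :: "('d::finite) mp_matrix \<Rightarrow> real" where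
  "entry_bound a = (\<Sum>i\<in>UNIV. \<Sum>j\<in>UNIV. \<bar>real_of_ereal (a i j)\<bar>)"

definition no_pinf :: "(nat \<Rightarrow> 'd mp_matrix) \<Rightarrow> bool" where
  "no_pinf \<omega> \<longleftrightarrow> (\<forall>k i j. \<omega> k i j \<noteq> \<infinity>)"

lemma no_pinf_seq_drop: "no_pinf \<omega> \<Longrightarrow> no_pinf (seq_drop s \<omega>)"
  by (simp add: no_pinf_def)

lemma finite_SUP_attained:
  fixes f :: "'i \<Rightarrow> ereal"
  assumes "finite I" "I \<noteq> {}"
  shows "\<exists>j\<in>I. (SUP j\<in>I. f j) = f j"
proof -
  have "Sup (f ` I) = Max (f ` I)" using assms by (intro cSup_eq_Max) auto
  moreover have "Max (f ` I) \<in> f ` I" using assms by (intro Max_in) auto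
  ultimately show ?thesis by auto
qed

lemma MAX_eq_SUP:
  fixes f :: "'i \<Rightarrow> ereal"
  assumes "finite I" "I \<noteq> {}"
  shows "(MAX j\<in>I. f j) = (SUP j\<in>I. f j)"
  using assms by (intro cSup_eq_Max[symmetric]) auto

lemma entry_bound_nonneg: "0 \<le> entry_bound a"
  unfolding entry_bound_def by (intro sum_nonneg abs_ge_zero)

lemma abs_entry_le_entry_bound: "\<bar>real_of_ereal (a i j)\<bar> \<le> entry_bound a"
proof -
  have "\<bar>real_of_ereal (a i j)\<bar> \<le> (\<Sum>j\<in>UNIV. \<bar>real_of_ereal (a i j)\<bar>)"
    by (intro member_le_sum abs_ge_zero) auto
  also have "\<dots> \<le> entry_bound a"
    unfolding entry_bound_def
    by (intro member_le_sum[of i UNIV "\<lambda>i. \<Sum>j\<in>UNIV. \<bar>real_of_ereal (a i j)\<bar>"] sum_nonneg abs_ge_zero) auto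
  finally show ?thesis .
qed

lemma entry_le_entry_bound: "a i j \<noteq> \<infinity> \<Longrightarrow> a i j \<le> ereal (entry_bound a)"
  using abs_entry_le_entry_bound[of a i j] by (cases "a i j") auto

lemma entry_ge_entry_bound: "a i j \<noteq> - \<infinity> \<Longrightarrow> ereal (- entry_bound a) \<le> a i j"
  using abs_entry_le_entry_bound[of a i j] by (cases "a i j") auto

lemma fwalk_cong: "(\<And>k. k < n \<Longrightarrow> \<omega> k = \<omega>' k) \<Longrightarrow> fwalk I n \<omega> i = fwalk I n \<omega>' i"
proof (induction n arbitrary: i \<omega> \<omega>')
  case (Suc n)
  have "fwalk I n (seq_drop 1 \<omega>) j = fwalk I n (seq_drop 1 \<omega>') j" for j
    using Suc.prems by (intro Suc.IH) auto
  then show ?case using Suc.prems[of 0] by simp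
qed simp

lemma bwalk_eq_fwalk: "bwalk I n \<omega> i = fwalk I n (\<lambda>k. \<omega> (n - Suc k)) i"
proof (induction n arbitrary: i)
  case (Suc n)
  have "seq_drop 1 (\<lambda>k. \<omega> (Suc n - Suc k)) = (\<lambda>k. \<omega> (n - Suc k))"
    by (simp add: seq_drop_def)
  then show ?case using Suc.IH by simp
qed simp

lemma bwalk_eq_fwalk_rev_prefix: "bwalk I n \<omega> i = fwalk I n (rev_prefix n \<omega>) i"
  unfolding bwalk_eq_fwalk by (rule fwalk_cong) (simp add: rev_prefix_def)

lemma bwalk_mono_set: "I \<subseteq> J \<Longrightarrow> bwalk I n \<omega> i \<le> bwalk J n \<omega> i"
proof (induction n arbitrary: i)
  case (Suc n)
  then show ?case unfolding bwalk.simps by (intro SUP_subset_mono add_left_mono)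
qed simp

lemma fwalk_mono_set: "I \<subseteq> J \<Longrightarrow> fwalk I n \<omega> i \<le> fwalk J n \<omega> i"
proof (induction n arbitrary: i \<omega>)
  case (Suc n)
  then show ?case unfolding fwalk.simps by (intro SUP_subset_mono add_left_mono)
qed simp

lemma bwalk_le_peak: "i \<in> I \<Longrightarrow> bwalk I n \<omega> i \<le> peak I n \<omega>"
  unfolding peak_def by (rule SUP_upper)

lemma bwalk_add_le:
  assumes "i \<in> I"
  shows "bwalk I (s + t) \<omega> i \<le> bwalk I t (seq_drop s \<omega>) i + peak I s \<omega>"
  using assms
proof (induction t arbitrary: i)
  case 0
  then show ?case by (simp add: bwalk_le_peak)
next
  case (Suc t)
  have "\<omega> (s + t) i j + bwalk I (s + t) \<omega> j \<le> bwalk I (Suc t) (seq_drop s \<omega>) i + peak I s \<omega>"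
    if j: "j \<in> I" for j
  proof -
    have "\<omega> (s + t) i j + bwalk I (s + t) \<omega> j \<le>
        \<omega> (s + t) i j + (bwalk I t (seq_drop s \<omega>) j + peak I s \<omega>)"
      by (intro add_left_mono Suc.IH j)
    also have "\<dots> = (seq_drop s \<omega> t i j + bwalk I t (seq_drop s \<omega>) j) + peak I s \<omega>"
      by (simp add: add.assoc)
    also have "\<dots> \<le> bwalk I (Suc t) (seq_drop s \<omega>) i + peak I s \<omega>"
      unfolding bwalk.simps by (intro add_right_mono SUP_upper j)
    finally show ?thesis .
  qed
  then show ?case
    unfolding add_Suc_right bwalk.simps(2)[of I "s + t"] by (rule SUP_least)
qed

lemma peak_add_le: "peak I (s + t) \<omega> \<le> peak I t (seq_drop s \<omega>) + peak I s \<omega>"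
  unfolding peak_def[of I "s + t"]
proof (rule SUP_least)
  fix i assume i: "i \<in> I"
  have "bwalk I (s + t) \<omega> i \<le> bwalk I t (seq_drop s \<omega>) i + peak I s \<omega>" by (rule bwalk_add_le[OF i])
  also have "\<dots> \<le> peak I t (seq_drop s \<omega>) + peak I s \<omega>"
    by (intro add_right_mono bwalk_le_peak i)
  finally show "bwalk I (s + t) \<omega> i \<le> peak I t (seq_drop s \<omega>) + peak I s \<omega>" .
qed

lemma bwalk_le_drop_sum:
  fixes \<omega> :: "nat \<Rightarrow> ('d::finite) mp_matrix"
  assumes "no_pinf \<omega>"
  shows "bwalk I n \<omega> i \<le> ereal (drop_sum (\<lambda>\<omega>. entry_bound (\<omega> 0)) n \<omega>)"
proof (induction n arbitrary: i)
  case (Suc n)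
  have "\<omega> n i j + bwalk I n \<omega> j \<le> ereal (entry_bound (\<omega> n)) + ereal (drop_sum (\<lambda>\<omega>. entry_bound (\<omega> 0)) n \<omega>)" for j
    using assms by (intro add_mono Suc.IH entry_le_entry_bound) (simp add: no_pinf_def)
  then show ?case by (auto simp: drop_sum_def SUP_le_iff add.commute)
qed (simp add: zero_ereal_def)

lemma bwalk_neq_PInf:
  fixes \<omega> :: "nat \<Rightarrow> ('d::finite) mp_matrix"
  shows "no_pinf \<omega> \<Longrightarrow> bwalk I n \<omega> i \<noteq> \<infinity>"
  using bwalk_le_drop_sum[of \<omega> I n i] by auto

lemma peak_0: "I \<noteq> {} \<Longrightarrow> peak I 0 \<omega> = 0"
  by (simp add: peak_def)

text \<open>
Reversing the last \<open>k\<close> matrices makes the first \<open>k\<close> arcs of a backward walk a forward walk; an optimal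
such piece can be followed by an optimal walk from its end node.
\<close>

lemma fwalk_segment:
  fixes I :: "('d::finite) set"
  assumes "I \<noteq> {}" "i \<in> I" "k \<le> t"
  shows "\<exists>j\<in>I. fwalk I k (\<lambda>u. \<omega> (t - Suc u)) i + bwalk I (t - k) \<omega> j \<le> bwalk I t \<omega> i"
  using assms(2,3)
proof (induction k arbitrary: i t)
  case (Suc k)
  then obtain t' where t: "t = Suc t'" by (cases t) auto
  have sd: "seq_drop 1 (\<lambda>u. \<omega> (t - Suc u)) = (\<lambda>u. \<omega> (t' - Suc u))"
    by (simp add: seq_drop_def t)
  obtain j where j1: "j \<in> I" "(SUP j\<in>I. \<omega> t' i j + fwalk I k (\<lambda>u. \<omega> (t' - Suc u)) j)
      = \<omega> t' i j + fwalk I k (\<lambda>u. \<omega> (t' - Suc u)) j"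
    using finite_SUP_attained[of I "\<lambda>j. \<omega> t' i j + fwalk I k (\<lambda>u. \<omega> (t' - Suc u)) j"] assms(1)
    by auto
  then have j: "j \<in> I" "fwalk I (Suc k) (\<lambda>u. \<omega> (t - Suc u)) i
      = \<omega> t' i j + fwalk I k (\<lambda>u. \<omega> (t' - Suc u)) j"
    unfolding fwalk.simps sd by (simp_all add: t)
  obtain j' where j': "j' \<in> I"
    "fwalk I k (\<lambda>u. \<omega> (t' - Suc u)) j + bwalk I (t' - k) \<omega> j' \<le> bwalk I t' \<omega> j"
    using Suc.IH[OF j(1), of t'] Suc.prems t by auto
  have "fwalk I (Suc k) (\<lambda>u. \<omega> (t - Suc u)) i + bwalk I (t - Suc k) \<omega> j' \<le> \<omega> t' i j + bwalk I t' \<omega> j"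
    unfolding j(2) using j'(2) by (simp add: t add.assoc add_left_mono)
  also have "\<dots> \<le> bwalk I t \<omega> i" unfolding t bwalk.simps by (rule SUP_upper[OF j(1)])
  finally show ?case using j'(1) by blast
qed auto

text \<open>
Cut an optimal walk at its first exit from \<open>c\<close>, if there is one: the arc of time \<open>u\<close> leads to a node
\<open>j\<close> of \<open>D\<close>, before it the walk stays in \<open>c\<close>.
\<close>

lemma first_exit:
  fixes \<omega> :: "nat \<Rightarrow> ('d::finite) mp_matrix"
  assumes \<omega>: "no_pinf \<omega>"
    and exit: "\<And>k i j. i \<in> c \<Longrightarrow> j \<notin> c \<Longrightarrow> \<omega> k i j \<noteq> - \<infinity> \<Longrightarrow> j \<in> D"
    and "i \<in> c"
  shows "bwalk UNIV n \<omega> i \<le> bwalk c n \<omega> i \<or>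
    (\<exists>u<n. \<exists>j\<in>D. bwalk UNIV n \<omega> i \<le>
      bwalk c (n - Suc u) (seq_drop (Suc u) \<omega>) i + (ereal (entry_bound (\<omega> u)) + bwalk UNIV u \<omega> j))"
  using assms(3)
proof (induction n arbitrary: i)
  case (Suc n)
  obtain j where j: "bwalk UNIV (Suc n) \<omega> i = \<omega> n i j + bwalk UNIV n \<omega> j"
    using finite_SUP_attained[of UNIV "\<lambda>j. \<omega> n i j + bwalk UNIV n \<omega> j"] by auto
  show ?case
  proof (cases "j \<in> c")
    case True
    from Suc.IH[OF this] show ?thesis
    proof
      assume "bwalk UNIV n \<omega> j \<le> bwalk c n \<omega> j"
      then have "bwalk UNIV (Suc n) \<omega> i \<le> \<omega> n i j + bwalk c n \<omega> j"
        unfolding j by (rule add_left_mono)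
      also have "\<dots> \<le> bwalk c (Suc n) \<omega> i" unfolding bwalk.simps by (rule SUP_upper[OF True])
      finally show ?thesis by blast
    next
      assume "\<exists>u<n. \<exists>j'\<in>D. bwalk UNIV n \<omega> j \<le>
        bwalk c (n - Suc u) (seq_drop (Suc u) \<omega>) j + (ereal (entry_bound (\<omega> u)) + bwalk UNIV u \<omega> j')"
      then obtain u j' where u: "u < n" "j' \<in> D" "bwalk UNIV n \<omega> j \<le>
        bwalk c (n - Suc u) (seq_drop (Suc u) \<omega>) j + (ereal (entry_bound (\<omega> u)) + bwalk UNIV u \<omega> j')"
        by blast
      let ?X = "ereal (entry_bound (\<omega> u)) + bwalk UNIV u \<omega> j'"
      have eq: "Suc n - Suc u = Suc (n - Suc u)" using u(1) by simp
      have "bwalk UNIV (Suc n) \<omega> i \<le> \<omega> n i j + (bwalk c (n - Suc u) (seq_drop (Suc u) \<omega>) j + ?X)"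
        unfolding j using u(3) by (rule add_left_mono)
      also have "\<dots> = (seq_drop (Suc u) \<omega> (n - Suc u) i j + bwalk c (n - Suc u) (seq_drop (Suc u) \<omega>) j) + ?X"
        using u(1) by (simp add: add.assoc)
      also have "\<dots> \<le> bwalk c (Suc n - Suc u) (seq_drop (Suc u) \<omega>) i + ?X"
        unfolding eq bwalk.simps by (intro add_right_mono SUP_upper True)
      finally show ?thesis using u(1,2) less_SucI by blast
    qed
  next
    case False
    show ?thesis
    proof (cases "\<omega> n i j = - \<infinity>")
      case True
      then have "bwalk UNIV (Suc n) \<omega> i = - \<infinity>"
        using bwalk_neq_PInf[OF \<omega>, of UNIV n j] unfolding j by (cases "bwalk UNIV n \<omega> j") auto
      then show ?thesis by simp
    next
      case fin: False
      have "bwalk UNIV (Suc n) \<omega> i \<le> ereal (entry_bound (\<omega> n)) + bwalk UNIV n \<omega> j"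
        unfolding j using \<omega> by (intro add_right_mono entry_le_entry_bound) (simp add: no_pinf_def)
      then have "bwalk UNIV (Suc n) \<omega> i \<le> bwalk c (Suc n - Suc n) (seq_drop (Suc n) \<omega>) i +
          (ereal (entry_bound (\<omega> n)) + bwalk UNIV n \<omega> j)"
        by (simp del: bwalk.simps(2))
      moreover have "j \<in> D" using exit Suc.prems False fin by blast
      ultimately show ?thesis by blast
    qed
  qed
qed simp

lemma SUP_add_const_ereal:
  fixes f :: "'i \<Rightarrow> ereal"
  assumes "finite I" "I \<noteq> {}"
  shows "(SUP j\<in>I. c + f j) = c + (SUP j\<in>I. f j)"
proof (rule antisym)
  show "(SUP j\<in>I. c + f j) \<le> c + (SUP j\<in>I. f j)"
    by (intro SUP_least add_left_mono SUP_upper)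
  obtain j where "j \<in> I" "(SUP j\<in>I. f j) = f j" using finite_SUP_attained[OF assms, of f] by blast
  then show "c + (SUP j\<in>I. f j) \<le> (SUP j\<in>I. c + f j)" by (auto intro: SUP_upper)
qed

lemma SUP_mp_prod_eq_bwalk:
  fixes I :: "('d::finite) set"
  assumes "i \<in> I"
  shows "(SUP j\<in>I. mp_prod I \<omega> n i j) = bwalk I n \<omega> i"
  using assms
proof (induction n arbitrary: i)
  case 0
  show ?case
  proof (rule antisym)
    show "(SUP j\<in>I. mp_prod I \<omega> 0 i j) \<le> bwalk I 0 \<omega> i"
      unfolding mp_prod.simps bwalk.simps by (rule SUP_least) (simp add: mp_id_def)
    show "bwalk I 0 \<omega> i \<le> (SUP j\<in>I. mp_prod I \<omega> 0 i j)"
      unfolding mp_prod.simps bwalk.simps by (rule SUP_upper2[OF 0]) (simp add: mp_id_def)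
  qed
next
  case (Suc n)
  have ne: "finite I" "I \<noteq> {}" using Suc.prems by auto
  have "(SUP j\<in>I. mp_prod I \<omega> (Suc n) i j) = (SUP j\<in>I. SUP k\<in>I. \<omega> n i k + mp_prod I \<omega> n k j)"
    by (simp add: mp_mult_def MAX_eq_SUP[OF ne])
  also have "\<dots> = (SUP k\<in>I. SUP j\<in>I. \<omega> n i k + mp_prod I \<omega> n k j)" by (rule SUP_commute)
  also have "\<dots> = (SUP k\<in>I. \<omega> n i k + (SUP j\<in>I. mp_prod I \<omega> n k j))"
    by (simp add: SUP_add_const_ereal[OF ne])
  also have "\<dots> = (SUP k\<in>I. \<omega> n i k + bwalk I n \<omega> k)"
    using Suc.IH by (intro SUP_cong) auto
  finally show ?case by simp
qed

lemma mp_orbit_eq_bwalk: "mp_orbit \<omega> n i = bwalk UNIV n \<omega> i"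
  unfolding mp_orbit_def mp_apply_def
  by (simp add: MAX_eq_SUP SUP_mp_prod_eq_bwalk)

lemma MAX_mp_prod_eq_peak:
  fixes I :: "('d::finite) set"
  assumes "I \<noteq> {}"
  shows "(MAX i\<in>I. MAX j\<in>I. mp_prod I \<omega> n i j) = peak I n \<omega>"
  using assms unfolding peak_def
  by (simp add: MAX_eq_SUP SUP_mp_prod_eq_bwalk cong: SUP_cong)

lemma measurable_mp_matrix_entry:
  "(\<lambda>a. a i j) \<in> borel_measurable (mp_matrix_space :: ('d::finite) mp_matrix measure)"
  unfolding mp_matrix_space_def
  by (rule measurable_compose[OF measurable_component_singleton[of i] measurable_component_singleton[of j]]) auto

locale iid_max_plus = sequence_space M for M :: "('d::finite) mp_matrix measure" +
  assumes sets_M: "sets M = sets mp_matrix_space"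
    and no_pinf_M: "AE a in M. \<forall>i j. a i j \<noteq> \<infinity>"
    and integrable_entry_bound: "integrable M entry_bound"
begin

lemma measurable_entry [measurable]: "(\<lambda>a. a i j) \<in> borel_measurable M"
  using measurable_mp_matrix_entry[of i j] by (simp add: measurable_cong_sets[OF sets_M refl])

lemma measurable_entry_bound [measurable]: "entry_bound \<in> borel_measurable M"
  using integrable_entry_bound by simp

lemma measurable_S_entry [measurable]: "(\<lambda>\<omega>. \<omega> k i j) \<in> borel_measurable S"
  by (rule measurable_compose[OF _ measurable_entry, of "\<lambda>\<omega>. \<omega> k"]) measurable

lemma space_M_UNIV: "space M = UNIV"
  using sets_eq_imp_space_eq[OF sets_M] by (simp add: mp_matrix_space_def space_PiM)

lemma space_S_UNIV: "space S = UNIV"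
  by (simp add: space_S space_M_UNIV)

lemma measurable_bwalk [measurable]: "(\<lambda>\<omega>. bwalk I n \<omega> i) \<in> borel_measurable S"
proof (induction n arbitrary: i)
  case (Suc n)
  note [measurable] = this
  show ?case unfolding bwalk.simps by (intro borel_measurable_SUP) auto
qed simp

lemma measurable_fwalk [measurable]: "(\<lambda>\<omega>. fwalk I n \<omega> i) \<in> borel_measurable S"
proof (induction n arbitrary: i)
  case (Suc n)
  have [measurable]: "(\<lambda>\<omega>. fwalk I n (seq_drop 1 \<omega>) j) \<in> borel_measurable S" for j
    using measurable_compose[OF measurable_seq_drop[of 1] Suc.IH[of j]] .
  show ?case unfolding fwalk.simps by (intro borel_measurable_SUP) measurable
qed simp

lemma measurable_peak [measurable]: "peak I n \<in> borel_measurable S"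
  unfolding peak_def[abs_def] by (intro borel_measurable_SUP) auto

lemma AE_no_pinf: "AE \<omega> in S. no_pinf \<omega>"
  using AE_S_coordinate[OF no_pinf_M] by (simp add: no_pinf_def)

lemma AE_entry_bound_sublinear:
  "AE \<omega> in S. \<forall>\<delta>>0. \<exists>C\<ge>0. \<forall>n. entry_bound (\<omega> n) \<le> \<delta> * n + C"
  by (intro AE_coordinate_sublinear integrable_entry_bound entry_bound_nonneg)

end

section \<open>The maximal Lyapunov exponent of a set of nodes\<close>

lemma eventually_ratio_ge:
  fixes f :: "nat \<Rightarrow> ereal" and a b C :: real
  assumes "\<And>n. ereal (a * n - C) \<le> f n" "b < a"
  shows "\<forall>\<^sub>F n in sequentially. ereal b \<le> f n / ereal (real n)"
  using eventually_gt_at_top[of "nat \<lceil>\<bar>C\<bar> / (a - b)\<rceil>"]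
proof eventually_elim
  case (elim n)
  then have "\<bar>C\<bar> / (a - b) < n" "n > 0" by linarith+
  then have "C \<le> (a - b) * n" using assms(2) by (simp add: field_simps)
  then have "ereal (n * b) \<le> ereal (a * n - C)" by (simp add: algebra_simps)
  also have "\<dots> \<le> f n" by fact
  finally show ?case using \<open>n > 0\<close> by (subst ereal_le_divide_pos) auto
qed

lemma eventually_ratio_le:
  fixes f :: "nat \<Rightarrow> ereal" and a b C :: real
  assumes "\<And>n. f n \<le> ereal (a * n + C)" "a < b"
  shows "\<forall>\<^sub>F n in sequentially. f n / ereal (real n) \<le> ereal b"
  using eventually_gt_at_top[of "nat \<lceil>\<bar>C\<bar> / (b - a)\<rceil>"]
proof eventually_elim
  case (elim n)
  then have "\<bar>C\<bar> / (b - a) < n" "n > 0" by linarith+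
  then have "C \<le> (b - a) * n" using assms(2) by (simp add: field_simps)
  have "f n \<le> ereal (a * n + C)" by fact
  also have "\<dots> \<le> ereal (n * b)" using \<open>C \<le> (b - a) * n\<close> by (simp add: algebra_simps)
  finally show ?case using \<open>n > 0\<close> by (subst ereal_divide_le_pos) auto
qed

text \<open>
Rational rates \<open>q\<close> are enough, so that almost sure bounds for each rate hold simultaneously.
\<close>

lemma LIMSEQ_ratioI:
  fixes f :: "nat \<Rightarrow> ereal" and \<gamma> :: ereal
  assumes lower: "\<And>q::rat. ereal (of_rat q) < \<gamma> \<Longrightarrow>
      \<forall>\<epsilon>>0::real. \<exists>C. \<forall>n. ereal (of_rat q * n - \<epsilon> * n - C) \<le> f n"
    and upper: "\<And>q::rat. \<gamma> < ereal (of_rat q) \<Longrightarrow>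
      \<forall>\<epsilon>>0::real. \<exists>C. \<forall>n. f n \<le> ereal (of_rat q * n + \<epsilon> * n + C)"
  shows "(\<lambda>n. f n / ereal (real n)) \<longlonglongrightarrow> \<gamma>"
proof (rule order_tendstoI)
  fix l assume "l < \<gamma>"
  then obtain q :: rat where q: "l < ereal (of_rat q)" "ereal (of_rat q) < \<gamma>" using ereal_dense3 by blast
  then obtain p :: rat where p: "l < ereal (of_rat p)" "ereal (of_rat p) < ereal (of_rat q)"
    using ereal_dense3 by blast
  define \<epsilon> :: real where "\<epsilon> = (of_rat q - of_rat p) / 2"
  have \<epsilon>: "\<epsilon> > 0" using p(2) by (simp add: \<epsilon>_def of_rat_less)
  then obtain C where "\<forall>n. ereal (of_rat q * n - \<epsilon> * n - C) \<le> f n" using lower[OF q(2)] by blast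
  then have "\<And>n. ereal ((of_rat q - \<epsilon>) * n - C) \<le> f n" by (simp add: left_diff_distrib)
  then have "\<forall>\<^sub>F n in sequentially. ereal (of_rat p) \<le> f n / ereal (real n)"
    by (rule eventually_ratio_ge) (use \<epsilon> in \<open>simp add: \<epsilon>_def field_simps of_rat_less\<close>)
  then show "\<forall>\<^sub>F n in sequentially. l < f n / ereal (real n)"
    by eventually_elim (use p(1) in order)
next
  fix l assume "\<gamma> < l"
  then obtain q :: rat where q: "ereal (of_rat q) < l" "\<gamma> < ereal (of_rat q)" using ereal_dense3 by blast
  then obtain p :: rat where p: "ereal (of_rat p) < l" "ereal (of_rat q) < ereal (of_rat p)"
    using ereal_dense3 by blast
  define \<epsilon> :: real where "\<epsilon> = (of_rat p - of_rat q) / 2"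
  have \<epsilon>: "\<epsilon> > 0" using p(2) by (simp add: \<epsilon>_def of_rat_less)
  then obtain C where "\<forall>n. f n \<le> ereal (of_rat q * n + \<epsilon> * n + C)" using upper[OF q(2)] by blast
  then have "\<And>n. f n \<le> ereal ((of_rat q + \<epsilon>) * n + C)" by (simp add: distrib_right)
  then have "\<forall>\<^sub>F n in sequentially. f n / ereal (real n) \<le> ereal (of_rat p)"
    by (rule eventually_ratio_le) (use \<epsilon> in \<open>simp add: \<epsilon>_def field_simps of_rat_less\<close>)
  then show "\<forall>\<^sub>F n in sequentially. f n / ereal (real n) < l"
    by eventually_elim (use p(1) in order)
qed

lemma reversed_sum_le_drop_sum:
  assumes "\<And>\<omega>. 0 \<le> g \<omega>" "m \<le> t"
  shows "(\<Sum>p\<in>{1..m}. g (seq_drop (t - p) \<omega>)) \<le> drop_sum g t \<omega>"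
proof -
  have "(\<Sum>p\<in>{1..m}. g (seq_drop (t - p) \<omega>)) = (\<Sum>s\<in>{t - m..<t}. g (seq_drop s \<omega>))"
    using assms(2) by (intro sum.reindex_bij_witness[of _ "\<lambda>s. t - s" "\<lambda>u. t - u"]) auto
  also have "\<dots> \<le> drop_sum g t \<omega>"
    unfolding drop_sum_def using assms by (intro sum_mono2) auto
  finally show ?thesis .
qed

lemma peak_Suc_0_le:
  fixes \<omega> :: "nat \<Rightarrow> ('d::finite) mp_matrix"
  assumes "\<forall>i j. \<omega> 0 i j \<noteq> \<infinity>"
  shows "peak I (Suc 0) \<omega> \<le> ereal (entry_bound (\<omega> 0))"
  unfolding peak_def bwalk.simps using assms
  by (intro SUP_least) (simp add: entry_le_entry_bound)

context iid_max_plus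
begin

definition falling :: "'d set \<Rightarrow> real \<Rightarrow> (nat \<Rightarrow> 'd mp_matrix) set" where
  "falling I a = {\<omega>. \<forall>C::nat. \<exists>n. peak I n \<omega> \<le> ereal (a * n - C)}"

text \<open>
The threshold between the two alternatives of the zero-one law below; it turns out to be Kingman's
limit.
\<close>

definition top_exponent :: "'d set \<Rightarrow> ereal" where
  "top_exponent I = Inf {ereal a | a. AE \<omega> in S. \<omega> \<in> falling I a}"

lemma falling_sets [measurable]: "falling I a \<in> sets S"
proof -
  have "{\<omega>\<in>space S. \<forall>C::nat. \<exists>n. peak I n \<omega> \<le> ereal (a * n - C)} \<in> sets S" by measurable
  then show ?thesis by (simp add: falling_def space_S_UNIV)
qed

lemma falling_mono: "a \<le> b \<Longrightarrow> falling I a \<subseteq> falling I b"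
proof
  fix \<omega> assume ab: "a \<le> b" and \<omega>: "\<omega> \<in> falling I a"
  have "\<exists>n. peak I n \<omega> \<le> ereal (b * n - C)" for C :: nat
  proof -
    obtain n where "peak I n \<omega> \<le> ereal (a * n - C)" using \<omega> unfolding falling_def by blast
    also have "\<dots> \<le> ereal (b * n - C)" using ab by (simp add: mult_right_mono)
    finally show ?thesis by blast
  qed
  then show "\<omega> \<in> falling I b" by (simp add: falling_def)
qed

text \<open>
Prefixing a matrix without entries \<open>\<infinity>\<close> raises the peak by at most a constant.
\<close>

lemma falling_zero_one:
  "(AE \<omega> in S. \<omega> \<in> falling I a) \<or> (AE \<omega> in S. \<omega> \<notin> falling I a)"
proof (cases "P.prob (falling I a) = 0")
  case True
  then have "falling I a \<in> null_sets S" by (simp add: P.emeasure_eq_measure null_sets_def)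
  then show ?thesis using AE_not_in by blast
next
  case False
  then have pos: "P.prob (falling I a) > 0" by (simp add: zero_less_measure_iff)
  have "AE \<omega> in S. \<omega> \<in> falling I a"
  proof (rule zero_one_step[where J = "{()}" and E = "\<lambda>_. falling I a" and q = "P.prob (falling I a)"])
    show "AE x in M. \<exists>j\<in>{()}. AE \<omega> in S. \<omega> \<in> falling I a \<longrightarrow> case_nat x \<omega> \<in> falling I a"
      using no_pinf_M
    proof eventually_elim
      case (elim x)
      have "case_nat x \<omega> \<in> falling I a" if \<omega>: "\<omega> \<in> falling I a" for \<omega>
        unfolding falling_def
      proof (intro CollectI allI)
        fix C :: nat
        obtain n where n: "peak I n \<omega> \<le> ereal (a * n - (C + nat \<lceil>entry_bound x - a\<rceil>))"
          using \<omega> unfolding falling_def by blast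
        have "peak I (Suc 0 + n) (case_nat x \<omega>) \<le> peak I n \<omega> + peak I (Suc 0) (case_nat x \<omega>)"
          using peak_add_le[of I "Suc 0" n "case_nat x \<omega>"] by simp
        also have "\<dots> \<le> ereal (a * n - (C + nat \<lceil>entry_bound x - a\<rceil>)) + ereal (entry_bound x)"
          using elim peak_Suc_0_le[of "case_nat x \<omega>" I] by (intro add_mono n) simp
        also have "\<dots> \<le> ereal (a * Suc n - C)"
        proof -
          have "entry_bound x - a \<le> nat \<lceil>entry_bound x - a\<rceil>" by linarith
          then show ?thesis by (simp add: algebra_simps)
        qed
        finally show "\<exists>n. peak I n (case_nat x \<omega>) \<le> ereal (a * n - C)"
          unfolding add_Suc add_0 by (rule exI)
      qed
      then show ?case by simp
    qed
  qed (use pos in auto)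
  then show ?thesis ..
qed

lemma peak_ge_linear:
  fixes a :: real
  assumes "ereal a < top_exponent I"
  shows "AE \<omega> in S. \<exists>C::nat. \<forall>n. ereal (a * n - C) \<le> peak I n \<omega>"
proof -
  have "\<not> (AE \<omega> in S. \<omega> \<in> falling I a)"
  proof
    assume "AE \<omega> in S. \<omega> \<in> falling I a"
    then have "top_exponent I \<le> ereal a" unfolding top_exponent_def by (intro Inf_lower) blast
    then show False using assms by simp
  qed
  then have "AE \<omega> in S. \<omega> \<notin> falling I a" using falling_zero_one by blast
  then show ?thesis
    by eventually_elim (auto simp: falling_def not_le intro: less_imp_le)
qed

text \<open>
Cut the interval from \<open>s\<close> to \<open>t\<close> greedily into blocks of rate at most \<open>a\<close> and length at most \<open>N\<close>.  The
bad starting points are those of the whole sequence, so that their cost, controlled by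
\<open>ergodic_upper_bound\<close>, does not depend on \<open>s\<close>.
\<close>

lemma peak_le_linear_of_falling:
  fixes a \<epsilon> :: real
  assumes falling: "AE \<omega> in S. \<omega> \<in> falling I a" and I: "I \<noteq> {}" and \<epsilon>: "\<epsilon> > 0"
  shows "AE \<omega> in S. \<exists>C\<ge>0. \<forall>t. \<forall>s\<le>t.
    peak I (t - s) (seq_drop s \<omega>) \<le> ereal (a * (t - s) + \<epsilon> * t + C)"
proof -
  define G where "G N = {\<omega>. \<exists>k\<in>{1..N}. peak I k \<omega> \<le> ereal (a * k)}" for N :: nat
  have G[measurable]: "G N \<in> sets S" for N
  proof -
    have "{\<omega>\<in>space S. \<exists>k\<in>{1..N}. peak I k \<omega> \<le> ereal (a * k)} \<in> sets S" by measurable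
    then show ?thesis by (simp add: G_def space_S_UNIV)
  qed
  have "incseq G" unfolding G_def incseq_def by force
  moreover have "AE \<omega> in S. \<exists>N. \<omega> \<in> G N"
    using falling
  proof eventually_elim
    case (elim \<omega>)
    then obtain n where n: "peak I n \<omega> \<le> ereal (a * n - 1)"
      unfolding falling_def by (auto dest!: spec[of _ 1])
    have "n \<noteq> 0"
    proof
      assume "n = 0"
      with n peak_0[OF I, of \<omega>] show False by (simp add: zero_ereal_def)
    qed
    moreover have "peak I n \<omega> \<le> ereal (a * n)" using n by (rule order_trans) simp
    ultimately have "\<omega> \<in> G n" unfolding G_def by (auto intro!: bexI[of _ n])
    then show ?case by blast
  qed
  moreover have h: "integrable S (\<lambda>\<omega>. entry_bound (\<omega> 0) + \<bar>a\<bar>)"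
    using integrable_coordinate(1)[OF integrable_entry_bound] by simp
  ultimately have "(\<lambda>N. \<integral>\<omega>. indicator (space S - G N) \<omega> * (entry_bound (\<omega> 0) + \<bar>a\<bar>) \<partial>S) \<longlonglongrightarrow> 0"
    using G by (intro integral_off_increasing_events) auto
  from order_tendstoD(2)[OF this, of "\<epsilon> / 2"] \<epsilon> obtain N
    where N: "(\<integral>\<omega>. indicator (space S - G N) \<omega> * (entry_bound (\<omega> 0) + \<bar>a\<bar>) \<partial>S) < \<epsilon> / 2"
    by (auto simp: eventually_sequentially)
  define g where "g \<omega> = indicator (space S - G N) \<omega> * (entry_bound (\<omega> 0) + \<bar>a\<bar>)" for \<omega>
  have g0: "0 \<le> g \<omega>" for \<omega> using entry_bound_nonneg[of "\<omega> 0"] by (simp add: g_def)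
  have gi: "integrable S g"
    using integrable_mult_indicator[of "space S - G N" S "\<lambda>\<omega>. entry_bound (\<omega> 0) + \<bar>a\<bar>"] h
    by (simp add: g_def[abs_def])
  have "AE \<omega> in S. \<exists>C::nat. \<forall>n. drop_sum g n \<omega> \<le> (\<epsilon> / 2) * n + C"
    using N by (intro ergodic_upper_bound gi g0) (simp add: g_def)
  then show ?thesis
    using AE_entry_bound_sublinear AE_no_pinf
  proof eventually_elim
    case (elim \<omega>)
    from elim(1) obtain C1 :: nat where C1: "\<And>n. drop_sum g n \<omega> \<le> (\<epsilon> / 2) * n + C1" by blast
    \<comment> \<open>At most \<open>N\<close> single steps at the end of the interval cost together at most \<open>\<epsilon> t / 2\<close> plus a constant.\<close>
    define \<delta> where "\<delta> = \<epsilon> / (2 * (N + 1))"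
    have "\<delta> > 0" using \<epsilon> by (simp add: \<delta>_def)
    then obtain C2 where C2: "C2 \<ge> 0" "\<And>n. entry_bound (\<omega> n) \<le> \<delta> * n + C2" using elim(2) by blast
    define C where "C = C1 + N * (C2 + \<bar>a\<bar>)"
    have "peak I (t - s) (seq_drop s \<omega>) \<le> ereal (a * (t - s) + \<epsilon> * t + C)" if st: "s \<le> t" for s t
    proof -
      define e where "e p = g (seq_drop (t - p) \<omega>) + (if p < N then entry_bound (\<omega> (t - p)) + \<bar>a\<bar> else 0)" for p
      have e0: "0 \<le> e p" for p
        using g0 entry_bound_nonneg by (auto simp: e_def intro!: add_nonneg_nonneg)
      have "peak I (t - s) (seq_drop (t - (t - s)) \<omega>) \<le> ereal (a * (t - s) + (\<Sum>u\<in>{1..t - s}. e u))"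
      proof (rule greedy_upper_bound[where V = "\<lambda>p _. peak I p (seq_drop (t - p) \<omega>)" and J = "{()}" and n = "t - s"])
        fix p i assume p: "p \<in> {1..t - s}"
        have split: "peak I p (seq_drop (t - p) \<omega>) \<le>
            peak I k (seq_drop (t - p) \<omega>) + peak I (p - k) (seq_drop (t - (p - k)) \<omega>)" if "k \<le> p" for k
        proof -
          have "t - p + k = t - (p - k)" using that p by auto
          then show ?thesis
            using peak_add_le[of I k "p - k" "seq_drop (t - p) \<omega>"] that by (simp add: add.commute)
        qed
        show "\<exists>k\<in>{1..p}. \<exists>j\<in>{()}. peak I p (seq_drop (t - p) \<omega>)
            \<le> ereal (a * k + e p) + peak I (p - k) (seq_drop (t - (p - k)) \<omega>)"
        proof (cases "seq_drop (t - p) \<omega> \<in> G N \<and> N \<le> p")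
          case True
          then obtain k where k: "k \<in> {1..N}" "peak I k (seq_drop (t - p) \<omega>) \<le> ereal (a * k)"
            unfolding G_def by auto
          have "peak I k (seq_drop (t - p) \<omega>) \<le> ereal (a * k + e p)"
            using k(2) e0[of p] by (meson dual_order.trans ereal_less_eq(3) le_add_same_cancel1)
          then have "peak I p (seq_drop (t - p) \<omega>) \<le> ereal (a * k + e p) + peak I (p - k) (seq_drop (t - (p - k)) \<omega>)"
            using split[of k] k True by (meson add_right_mono atLeastAtMost_iff order_trans)
          then show ?thesis using k True by (intro bexI[of _ k]) auto
        next
          case False
          have "entry_bound (\<omega> (t - p)) + \<bar>a\<bar> \<le> e p"
            using False g0[of "seq_drop (t - p) \<omega>"] entry_bound_nonneg[of "\<omega> (t - p)"]
            by (auto simp: e_def g_def indicator_def space_S_UNIV)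
          then have "entry_bound (\<omega> (t - p)) \<le> a + e p" by linarith
          moreover have "peak I (Suc 0) (seq_drop (t - p) \<omega>) \<le> ereal (entry_bound (\<omega> (t - p)))"
            using peak_Suc_0_le[of "seq_drop (t - p) \<omega>" I] elim(3) by (simp add: no_pinf_def)
          ultimately have "peak I 1 (seq_drop (t - p) \<omega>) \<le> ereal (a * (1::nat) + e p)"
            by (simp add: order_trans)
          then have "peak I p (seq_drop (t - p) \<omega>) \<le> ereal (a * (1::nat) + e p) + peak I (p - 1) (seq_drop (t - (p - 1)) \<omega>)"
            using split[of 1] p by (meson add_right_mono atLeastAtMost_iff order_trans)
          then show ?thesis using p by (intro bexI[of _ 1]) auto
        qed
      qed (use e0 peak_0[OF I] in auto)
      moreover have "(\<Sum>u\<in>{1..t - s}. e u) \<le> \<epsilon> * t + C"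
      proof -
        have "(\<Sum>u\<in>{1..t - s}. e u) = (\<Sum>u\<in>{1..t - s}. g (seq_drop (t - u) \<omega>)) +
            (\<Sum>u\<in>{1..t - s}. if u < N then entry_bound (\<omega> (t - u)) + \<bar>a\<bar> else 0)"
          by (simp add: e_def sum.distrib)
        also have "(\<Sum>u\<in>{1..t - s}. g (seq_drop (t - u) \<omega>)) \<le> (\<epsilon> / 2) * t + C1"
          using reversed_sum_le_drop_sum[OF g0 diff_le_self] C1 by (rule order_trans)
        also have "(\<Sum>u\<in>{1..t - s}. if u < N then entry_bound (\<omega> (t - u)) + \<bar>a\<bar> else 0)
            \<le> (\<Sum>u\<in>{1..N}. \<delta> * t + C2 + \<bar>a\<bar>)"
        proof -
          have "(\<Sum>u\<in>{1..t - s}. if u < N then entry_bound (\<omega> (t - u)) + \<bar>a\<bar> else 0) =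
              (\<Sum>u\<in>{1..t - s} \<inter> {u. u < N}. entry_bound (\<omega> (t - u)) + \<bar>a\<bar>)"
            by (subst sum.If_cases) auto
          also have "\<dots> \<le> (\<Sum>u\<in>{1..t - s} \<inter> {u. u < N}. \<delta> * t + C2 + \<bar>a\<bar>)"
          proof (rule sum_mono)
            fix u
            have "\<delta> * (t - u) \<le> \<delta> * t" using \<open>\<delta> > 0\<close> by (simp add: mult_left_mono)
            then show "entry_bound (\<omega> (t - u)) + \<bar>a\<bar> \<le> \<delta> * t + C2 + \<bar>a\<bar>"
              using C2(2)[of "t - u"] by linarith
          qed
          also have "\<dots> \<le> (\<Sum>u\<in>{1..N}. \<delta> * t + C2 + \<bar>a\<bar>)"
            using \<open>\<delta> > 0\<close> C2(1) by (intro sum_mono2) auto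
          finally show ?thesis .
        qed
        also have "(\<Sum>u\<in>{1..N}. \<delta> * t + C2 + \<bar>a\<bar>) = (N * \<delta>) * t + N * (C2 + \<bar>a\<bar>)"
          by (simp add: algebra_simps)
        also have "N * \<delta> \<le> \<epsilon> / 2" using \<epsilon> by (simp add: \<delta>_def field_simps)
        finally show ?thesis by (simp add: C_def algebra_simps mult_right_mono)
      qed
      ultimately have "peak I (t - s) (seq_drop (t - (t - s)) \<omega>) \<le> ereal (a * (t - s) + (\<epsilon> * t + C))"
        by (meson add_left_mono ereal_less_eq(3) order_trans)
      then show ?thesis using st by (simp add: add.assoc)
    qed
    moreover have "C \<ge> 0" using C2(1) by (simp add: C_def)
    ultimately show ?case by blast
  qed
qed

lemma peak_le_linear:
  fixes a :: real
  assumes a: "top_exponent I < ereal a" and I: "I \<noteq> {}"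
  shows "AE \<omega> in S. \<forall>\<epsilon>>0::real. \<exists>C\<ge>0. \<forall>t. \<forall>s\<le>t.
    peak I (t - s) (seq_drop s \<omega>) \<le> ereal (a * (t - s) + \<epsilon> * t + C)"
proof (rule AE_all_pos)
  obtain b where b: "AE \<omega> in S. \<omega> \<in> falling I b" "b < a"
    using a unfolding top_exponent_def Inf_less_iff by auto
  have "AE \<omega> in S. \<omega> \<in> falling I a"
    using b(1) by eventually_elim (use falling_mono[of b a I] b(2) in auto)
  then show "AE \<omega> in S. \<exists>C\<ge>0. \<forall>t. \<forall>s\<le>t.
      peak I (t - s) (seq_drop s \<omega>) \<le> ereal (a * (t - s) + \<epsilon> * t + C)" if "\<epsilon> > 0" for \<epsilon> :: real
    using I that by (rule peak_le_linear_of_falling)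
next
  fix \<epsilon> \<epsilon>' :: real and \<omega>
  assume le: "\<epsilon> \<le> \<epsilon>'" and "\<exists>C\<ge>0. \<forall>t. \<forall>s\<le>t.
      peak I (t - s) (seq_drop s \<omega>) \<le> ereal (a * (t - s) + \<epsilon> * t + C)"
  then obtain C where C: "C \<ge> 0" "\<And>s t. s \<le> t \<Longrightarrow>
      peak I (t - s) (seq_drop s \<omega>) \<le> ereal (a * (t - s) + \<epsilon> * t + C)" by blast
  have "peak I (t - s) (seq_drop s \<omega>) \<le> ereal (a * (t - s) + \<epsilon>' * t + C)" if "s \<le> t" for s t
  proof -
    have "\<epsilon> * t \<le> \<epsilon>' * t" using le by (rule mult_right_mono) simp
    then show ?thesis using C(2)[OF that] by (auto elim!: order_trans)
  qed
  then show "\<exists>C\<ge>0. \<forall>t. \<forall>s\<le>t.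
      peak I (t - s) (seq_drop s \<omega>) \<le> ereal (a * (t - s) + \<epsilon>' * t + C)" using C(1) by blast
qed

text \<open>
Kingman's theorem for the maximal entry of the products.
\<close>

theorem peak_ratio_tendsto:
  assumes I: "I \<noteq> {}"
  shows "AE \<omega> in S. (\<lambda>n. peak I n \<omega> / ereal (real n)) \<longlonglongrightarrow> top_exponent I"
proof -
  have "AE \<omega> in S. \<forall>q::rat. ereal (of_rat q) < top_exponent I \<longrightarrow>
      (\<exists>C::nat. \<forall>n. ereal (of_rat q * n - C) \<le> peak I n \<omega>)"
    unfolding AE_all_countable using peak_ge_linear[where I = I]
    by (intro allI impI AE_impI) auto
  moreover have "AE \<omega> in S. \<forall>q::rat. top_exponent I < ereal (of_rat q) \<longrightarrow>
      (\<forall>\<epsilon>>0::real. \<exists>C\<ge>0. \<forall>t. \<forall>s\<le>t.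
        peak I (t - s) (seq_drop s \<omega>) \<le> ereal (of_rat q * (t - s) + \<epsilon> * t + C))"
    unfolding AE_all_countable using peak_le_linear[OF _ I]
    by (intro allI impI AE_impI) auto
  ultimately show ?thesis
  proof eventually_elim
    case (elim \<omega>)
    show ?case
    proof (rule LIMSEQ_ratioI)
      fix q :: rat assume "ereal (of_rat q) < top_exponent I"
      with elim(1) obtain C :: nat where C: "\<And>n. ereal (of_rat q * n - C) \<le> peak I n \<omega>" by blast
      show "\<forall>\<epsilon>>0::real. \<exists>C. \<forall>n. ereal (of_rat q * n - \<epsilon> * n - C) \<le> peak I n \<omega>"
      proof (intro allI impI exI)
        fix \<epsilon> :: real and n :: nat assume "\<epsilon> > 0"
        then have "ereal (of_rat q * n - \<epsilon> * n - C) \<le> ereal (of_rat q * n - C)" by simp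
        then show "ereal (of_rat q * n - \<epsilon> * n - C) \<le> peak I n \<omega>" using C by (rule order_trans)
      qed
    next
      fix q :: rat assume "top_exponent I < ereal (of_rat q)"
      with elim(2) have *: "\<forall>\<epsilon>>0::real. \<exists>C\<ge>0. \<forall>t. \<forall>s\<le>t.
        peak I (t - s) (seq_drop s \<omega>) \<le> ereal (of_rat q * (t - s) + \<epsilon> * t + C)" by blast
      show "\<forall>\<epsilon>>0::real. \<exists>C. \<forall>n. peak I n \<omega> \<le> ereal (of_rat q * n + \<epsilon> * n + C)"
      proof (intro allI impI)
        fix \<epsilon> :: real assume "\<epsilon> > 0"
        with * obtain C where C: "\<And>s t. s \<le> t \<Longrightarrow>
          peak I (t - s) (seq_drop s \<omega>) \<le> ereal (of_rat q * (t - s) + \<epsilon> * t + C)" by blast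
        show "\<exists>C. \<forall>n. peak I n \<omega> \<le> ereal (of_rat q * n + \<epsilon> * n + C)"
          using C[of 0] by (intro exI[of _ C]) simp
      qed
    qed
  qed
qed

end

section \<open>Upper and lower bounds for optimal walks\<close>

definition scc_of :: "('d \<times> 'd) set \<Rightarrow> 'd \<Rightarrow> 'd set" where
  "scc_of r i = {j. (i, j) \<in> r\<^sup>* \<and> (j, i) \<in> r\<^sup>*}"

text \<open>
A node that reaches the largest number of nodes lies in a component that is not entered from the
rest of \<open>R\<close>.
\<close>

lemma source_component_exists:
  fixes R :: "('d::finite) set"
  assumes "R \<noteq> {}"
  shows "\<exists>i\<in>R. \<forall>j\<in>R. \<forall>k\<in>scc_of r i. (j, k) \<in> r \<longrightarrow> j \<in> scc_of r i"
proof -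
  define m where "m = Max ((\<lambda>j. card (r\<^sup>* `` {j})) ` R)"
  have "m \<in> (\<lambda>j. card (r\<^sup>* `` {j})) ` R" unfolding m_def using assms by (intro Max_in) auto
  moreover have "card (r\<^sup>* `` {j}) \<le> m" if "j \<in> R" for j
    unfolding m_def using that by (intro Max_ge) auto
  ultimately obtain i where i: "i \<in> R" "\<And>j. j \<in> R \<Longrightarrow> card (r\<^sup>* `` {j}) \<le> card (r\<^sup>* `` {i})"
    by auto
  have "j \<in> scc_of r i" if "j \<in> R" "k \<in> scc_of r i" "(j, k) \<in> r" for j k
  proof -
    have ji: "(j, i) \<in> r\<^sup>*" using that by (auto simp: scc_of_def intro: converse_rtrancl_into_rtrancl)
    then have "r\<^sup>* `` {i} \<subseteq> r\<^sup>* `` {j}" by (auto intro: rtrancl_trans)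
    moreover have "card (r\<^sup>* `` {j}) \<le> card (r\<^sup>* `` {i})" by (rule i(2)[OF that(1)])
    ultimately have "r\<^sup>* `` {i} = r\<^sup>* `` {j}" by (intro card_seteq) auto
    then have "(i, j) \<in> r\<^sup>*" by auto
    with ji show ?thesis by (simp add: scc_of_def)
  qed
  with i(1) show ?thesis by blast
qed

context iid_max_plus
begin

definition arcs :: "('d \<times> 'd) set" where
  "arcs = {(i, j). measure M {a. a i j \<noteq> - \<infinity>} > 0}"

lemma entry_finite_sets [measurable]: "{a. a i j \<noteq> - \<infinity>} \<in> sets M"
proof -
  have "{a\<in>space M. a i j \<noteq> - \<infinity>} \<in> sets M" by measurable
  then show ?thesis by (simp add: space_M_UNIV)
qed

lemma AE_arcs: "AE \<omega> in S. \<forall>k i j. \<omega> k i j \<noteq> - \<infinity> \<longrightarrow> (i, j) \<in> arcs"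
proof -
  have "AE a in M. a i j \<noteq> - \<infinity> \<longrightarrow> (i, j) \<in> arcs" for i j
  proof (cases "(i, j) \<in> arcs")
    case False
    then have "measure M {a. a i j \<noteq> - \<infinity>} = 0"
      unfolding arcs_def by (auto simp: zero_less_measure_iff)
    then have "{a. a i j \<noteq> - \<infinity>} \<in> null_sets M" by (simp add: M.emeasure_eq_measure null_sets_def)
    from AE_not_in[OF this] show ?thesis by eventually_elim simp
  qed simp
  then have "AE a in M. \<forall>i j. a i j \<noteq> - \<infinity> \<longrightarrow> (i, j) \<in> arcs"
    by (intro AE_all_countable[THEN iffD2] allI)
  from AE_S_coordinate[OF this] show ?thesis by simp
qed

text \<open>
Induction on the set \<open>R\<close>, which no arc leaves: a source component \<open>c\<close> of \<open>R\<close> is left at most once, for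
the smaller set \<open>R - c\<close>, and never entered again.  The part in \<open>c\<close> occupies some unknown subinterval of
time, which is why the bounds must hold for all time intervals simultaneously.
\<close>

theorem walk_upper_bound:
  fixes a :: real
  assumes closed: "\<And>i j. i \<in> R \<Longrightarrow> (i, j) \<in> arcs \<Longrightarrow> j \<in> R"
    and top: "\<And>i. i \<in> R \<Longrightarrow> top_exponent (scc_of arcs i) < ereal a"
  shows "AE \<omega> in S. \<forall>\<epsilon>>0::real. \<exists>C\<ge>0. \<forall>t. \<forall>s\<le>t. \<forall>i\<in>R.
    bwalk UNIV (t - s) (seq_drop s \<omega>) i \<le> ereal (a * (t - s) + \<epsilon> * t + C)"
  using finite[of R] closed top
proof (induction R rule: finite_psubset_induct)
  case (psubset R)
  show ?case
  proof (cases "R = {}")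
    case True
    then show ?thesis by (auto intro!: AE_I2 exI[of _ 0])
  next
    case False
    obtain i0 where i0: "i0 \<in> R"
      "\<And>j k. j \<in> R \<Longrightarrow> k \<in> scc_of arcs i0 \<Longrightarrow> (j, k) \<in> arcs \<Longrightarrow> j \<in> scc_of arcs i0"
      using source_component_exists[OF False, of arcs] by blast
    define c where "c = scc_of arcs i0"
    have ne: "c \<noteq> {}" "i0 \<in> c" by (auto simp: c_def scc_of_def)
    have cR: "c \<subseteq> R"
    proof
      fix j assume "j \<in> c"
      then have "(i0, j) \<in> arcs\<^sup>*" by (simp add: c_def scc_of_def)
      then show "j \<in> R" by (induction rule: rtrancl_induct) (use i0(1) psubset.prems(1) in auto)
    qed
    define D where "D = R - c"
    have "AE \<omega> in S. \<forall>\<epsilon>>0::real. \<exists>C\<ge>0. \<forall>t. \<forall>s\<le>t. \<forall>i\<in>D.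
        bwalk UNIV (t - s) (seq_drop s \<omega>) i \<le> ereal (a * (t - s) + \<epsilon> * t + C)"
    proof (rule psubset.IH)
      show "D \<subset> R" using ne cR by (auto simp: D_def)
      show "j \<in> D" if "i \<in> D" "(i, j) \<in> arcs" for i j
        using that psubset.prems(1) i0(2)[of i j] by (auto simp: D_def c_def)
      show "top_exponent (scc_of arcs i) < ereal a" if "i \<in> D" for i
        using that psubset.prems(2) by (auto simp: D_def)
    qed
    moreover have "AE \<omega> in S. \<forall>\<epsilon>>0::real. \<exists>C\<ge>0. \<forall>t. \<forall>s\<le>t.
        peak c (t - s) (seq_drop s \<omega>) \<le> ereal (a * (t - s) + \<epsilon> * t + C)"
      using psubset.prems(2)[OF i0(1)] ne by (intro peak_le_linear) (auto simp: c_def)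
    ultimately show ?thesis
      using AE_entry_bound_sublinear AE_arcs AE_no_pinf
    proof eventually_elim
      case (elim \<omega>)
      show ?case
      proof (intro allI impI)
        fix \<epsilon> :: real assume "\<epsilon> > 0"
        then have e3: "\<epsilon> / 3 > 0" by simp
        obtain C1 where C1: "C1 \<ge> 0" "\<And>s t i. s \<le> t \<Longrightarrow> i \<in> D \<Longrightarrow>
          bwalk UNIV (t - s) (seq_drop s \<omega>) i \<le> ereal (a * (t - s) + \<epsilon> / 3 * t + C1)"
          using elim(1) e3 by meson
        obtain C2 where C2: "C2 \<ge> 0" "\<And>s t. s \<le> t \<Longrightarrow>
          peak c (t - s) (seq_drop s \<omega>) \<le> ereal (a * (t - s) + \<epsilon> / 3 * t + C2)"
          using elim(2) e3 by meson
        obtain C3 where C3: "C3 \<ge> 0" "\<And>n. entry_bound (\<omega> n) \<le> \<epsilon> / 3 * n + C3"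
          using elim(3) e3 by meson
        define C where "C = C1 + C2 + C3 + \<bar>a\<bar>"
        have "bwalk UNIV (t - s) (seq_drop s \<omega>) i \<le> ereal (a * (t - s) + \<epsilon> * t + C)"
          if st: "s \<le> t" and i: "i \<in> R" for s t i
        proof (cases "i \<in> c")
          case False
          then have "i \<in> D" using i by (simp add: D_def)
          moreover have "\<epsilon> / 3 * t \<le> \<epsilon> * t" using \<open>\<epsilon> > 0\<close> by (intro mult_right_mono) auto
          moreover have "C1 \<le> C" using C2(1) C3(1) by (simp add: C_def)
          ultimately have "ereal (a * (t - s) + \<epsilon> / 3 * t + C1) \<le> ereal (a * (t - s) + \<epsilon> * t + C)"
            unfolding ereal_less_eq by linarith
          with C1(2)[OF st \<open>i \<in> D\<close>] show ?thesis by (rule order_trans)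
        next
          case True
          let ?\<omega> = "seq_drop s \<omega>"
          have et: "0 \<le> \<epsilon> * t" using \<open>\<epsilon> > 0\<close> by simp
          have "bwalk UNIV (t - s) ?\<omega> i \<le> bwalk c (t - s) ?\<omega> i \<or>
            (\<exists>u<t - s. \<exists>j\<in>D. bwalk UNIV (t - s) ?\<omega> i \<le>
              bwalk c (t - s - Suc u) (seq_drop (Suc u) ?\<omega>) i +
              (ereal (entry_bound (?\<omega> u)) + bwalk UNIV u ?\<omega> j))"
          proof (rule first_exit[OF no_pinf_seq_drop[OF elim(5)] _ True])
            fix k i j assume "i \<in> c" "j \<notin> c" "?\<omega> k i j \<noteq> - \<infinity>"
            then show "j \<in> D" using elim(4) cR psubset.prems(1) by (auto simp: D_def)
          qed
          then show ?thesis
          proof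
            assume "bwalk UNIV (t - s) ?\<omega> i \<le> bwalk c (t - s) ?\<omega> i"
            also have "\<dots> \<le> peak c (t - s) ?\<omega>" by (rule bwalk_le_peak[OF True])
            also have "\<dots> \<le> ereal (a * (t - s) + \<epsilon> / 3 * t + C2)" by (rule C2(2)[OF st])
            also have "\<dots> \<le> ereal (a * (t - s) + \<epsilon> * t + C)"
              using C1(1) C3(1) et by (simp add: C_def)
            finally show ?thesis .
          next
            assume "\<exists>u<t - s. \<exists>j\<in>D. bwalk UNIV (t - s) ?\<omega> i \<le>
              bwalk c (t - s - Suc u) (seq_drop (Suc u) ?\<omega>) i +
              (ereal (entry_bound (?\<omega> u)) + bwalk UNIV u ?\<omega> j)"
            then obtain u j where u: "u < t - s" "j \<in> D" "bwalk UNIV (t - s) ?\<omega> i \<le>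
              bwalk c (t - s - Suc u) (seq_drop (Suc u) ?\<omega>) i +
              (ereal (entry_bound (?\<omega> u)) + bwalk UNIV u ?\<omega> j)" by blast
            have le: "s + Suc u \<le> t" "s + u \<le> t" "t - s - Suc u = t - (s + Suc u)" "s + u - s = u"
              using u(1) by auto
            have 1: "bwalk c (t - s - Suc u) (seq_drop (Suc u) ?\<omega>) i \<le>
                ereal (a * (t - (s + Suc u)) + \<epsilon> / 3 * t + C2)"
              using bwalk_le_peak[OF True] C2(2)[OF le(1)] unfolding le(3) seq_drop_seq_drop
              by (rule order_trans)
            have eu: "\<epsilon> / 3 * (s + u) \<le> \<epsilon> / 3 * t" using le(2) e3 by (intro mult_left_mono) auto
            have 2: "ereal (entry_bound (?\<omega> u)) \<le> ereal (\<epsilon> / 3 * t + C3)"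
              using C3(2)[of "s + u"] eu by simp
            have 3: "bwalk UNIV u ?\<omega> j \<le> ereal (a * u + \<epsilon> / 3 * t + C1)"
              using C1(2)[OF le_add1 u(2), of s u] eu by (auto simp: elim!: order_trans)
            have "bwalk UNIV (t - s) ?\<omega> i \<le> ereal (a * (t - (s + Suc u)) + \<epsilon> / 3 * t + C2) +
                (ereal (\<epsilon> / 3 * t + C3) + ereal (a * u + \<epsilon> / 3 * t + C1))"
              using u(3) add_mono[OF 1 add_mono[OF 2 3]] by (rule order_trans)
            also have "\<dots> = ereal (a * (t - s) - a + \<epsilon> * t + (C1 + C2 + C3))"
              using le st by (simp add: of_nat_diff algebra_simps)
            also have "\<dots> \<le> ereal (a * (t - s) + \<epsilon> * t + C)"
              by (simp add: C_def)
            finally show ?thesis .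
          qed
        qed
        moreover have "C \<ge> 0" using C1(1) C2(1) C3(1) by (simp add: C_def)
        ultimately show "\<exists>C\<ge>0. \<forall>t. \<forall>s\<le>t. \<forall>i\<in>R.
          bwalk UNIV (t - s) (seq_drop s \<omega>) i \<le> ereal (a * (t - s) + \<epsilon> * t + C)" by blast
      qed
    qed
  qed
qed

definition rising :: "'d set \<Rightarrow> real \<Rightarrow> 'd \<Rightarrow> (nat \<Rightarrow> 'd mp_matrix) set" where
  "rising H a i = {\<omega>. \<forall>C::nat. \<exists>n. ereal (a * real n + real C) \<le> fwalk H n \<omega> i}"

lemma rising_sets [measurable]: "rising H a i \<in> sets S"
proof -
  have "{\<omega>\<in>space S. \<forall>C::nat. \<exists>n. ereal (a * n + C) \<le> fwalk H n \<omega> i} \<in> sets S" by measurable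
  then show ?thesis by (simp add: rising_def space_S_UNIV)
qed

lemma rising_mono_set: "I \<subseteq> H \<Longrightarrow> rising I a i \<subseteq> rising H a i"
  unfolding rising_def using fwalk_mono_set[of I H] by (blast intro: order_trans)

lemma rising_Cons:
  assumes x: "x i j \<noteq> - \<infinity>" and j: "j \<in> H" and \<omega>: "\<omega> \<in> rising H a j"
  shows "case_nat x \<omega> \<in> rising H a i"
  unfolding rising_def
proof (intro CollectI allI)
  fix C :: nat
  define C' where "C' = C + nat \<lceil>entry_bound x + a\<rceil>"
  obtain n where n: "ereal (a * n + C') \<le> fwalk H n \<omega> j" using \<omega> unfolding rising_def by blast
  have "entry_bound x + a \<le> nat \<lceil>entry_bound x + a\<rceil>" by linarith
  then have "ereal (a * Suc n + C) \<le> ereal (- entry_bound x) + ereal (a * n + C')"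
    by (simp add: C'_def algebra_simps)
  also have "\<dots> \<le> x i j + fwalk H n \<omega> j"
    using n entry_ge_entry_bound[of x i j, OF x] by (intro add_mono)
  also have "\<dots> \<le> fwalk H (Suc n) (case_nat x \<omega>) i"
  proof -
    have "seq_drop 1 (case_nat x \<omega>) = \<omega>" using seq_drop_case_nat[of 0 x \<omega>] by simp
    then show ?thesis unfolding fwalk.simps by (intro SUP_upper2[OF j]) simp
  qed
  finally show "\<exists>n. ereal (a * n + C) \<le> fwalk H n (case_nat x \<omega>) i" by (rule exI)
qed

text \<open>
The exponent of \<open>c\<close> is defined by backward walks, while \<open>rising\<close> is about forward walks.  For each
single \<open>n\<close> the best values over \<open>c\<close> of both have the same law, and a lower bound that holds with
probability tending to one is enough to make the forward walks exceed \<open>a n + C\<close> at some time.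
\<close>

lemma rising_positive_in_component:
  assumes c: "c \<noteq> {}" "c \<subseteq> H" and a: "ereal a < top_exponent c"
  shows "\<exists>j\<in>c. 0 < P.prob (rising H a j)"
proof -
  obtain b where b: "a < b" "ereal b < top_exponent c" using ereal_dense2[OF a] by auto
  have "AE \<omega> in S. \<exists>n. ereal (a * n + C) \<le> (SUP i\<in>c. fwalk c n \<omega> i)" for C :: nat
  proof -
    define B where "B n = {\<omega>. ereal (a * n + C) \<le> peak c n \<omega>}" for n :: nat
    define B' where "B' n = {\<omega>. ereal (a * n + C) \<le> (SUP i\<in>c. fwalk c n \<omega> i)}" for n :: nat
    have [measurable]: "B n \<in> sets S" for n
    proof -
      have "{\<omega>\<in>space S. ereal (a * n + C) \<le> peak c n \<omega>} \<in> sets S" by measurable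
      then show ?thesis by (simp add: B_def space_S_UNIV)
    qed
    have [measurable]: "(\<lambda>\<omega>. SUP i\<in>c. fwalk c n \<omega> i) \<in> borel_measurable S" for n
      by (intro borel_measurable_SUP) auto
    have B'[measurable]: "B' n \<in> sets S" for n
    proof -
      have "{\<omega>\<in>space S. ereal (a * n + C) \<le> (SUP i\<in>c. fwalk c n \<omega> i)} \<in> sets S" by measurable
      then show ?thesis by (simp add: B'_def space_S_UNIV)
    qed
    \<comment> \<open>Reversal of the first \<open>n\<close> coordinates maps one event to the other and preserves the law.\<close>
    have "P.prob (B n) = P.prob (B' n)" for n
    proof -
      have "P.prob (B' n) = measure (distr S S (rev_prefix n)) (B' n)" by (simp only: distr_rev_prefix)
      also have "\<dots> = P.prob (rev_prefix n -` B' n \<inter> space S)" by (rule measure_distr) auto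
      also have "rev_prefix n -` B' n \<inter> space S = B n"
        by (auto simp: B_def B'_def space_S_UNIV peak_def bwalk_eq_fwalk_rev_prefix)
      finally show ?thesis by simp
    qed
    moreover have "(\<lambda>n. \<integral>\<omega>. indicat_real (B n) \<omega> \<partial>S) \<longlonglongrightarrow> (\<integral>\<omega>. 1 \<partial>S)"
    proof (rule integral_dominated_convergence[where w = "\<lambda>_. 1"])
      show "AE \<omega> in S. (\<lambda>n. indicat_real (B n) \<omega>) \<longlonglongrightarrow> 1"
        using peak_ge_linear[OF b(2)]
      proof eventually_elim
        case (elim \<omega>)
        then obtain C0 :: nat where C0: "\<And>n. ereal (b * n - C0) \<le> peak c n \<omega>" by blast
        have "\<forall>\<^sub>F n in sequentially. \<omega> \<in> B n"
          using eventually_gt_at_top[of "nat \<lceil>(C + C0) / (b - a)\<rceil>"]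
        proof eventually_elim
          case (elim n)
          then have "(C + C0) / (b - a) < n" by linarith
          then have "C + C0 \<le> (b - a) * n" using b(1) by (simp add: field_simps)
          then have "ereal (a * n + C) \<le> ereal (b * n - C0)" by (simp add: algebra_simps)
          also have "\<dots> \<le> peak c n \<omega>" by (rule C0)
          finally show ?case by (simp add: B_def)
        qed
        then show ?case by (intro tendsto_eventually) (auto elim: eventually_mono)
      qed
    qed auto
    ultimately have lim: "(\<lambda>n. P.prob (B' n)) \<longlonglongrightarrow> 1" by (simp add: P.prob_space)
    have "P.prob (\<Union>n. B' n) \<ge> 1"
      by (rule LIMSEQ_le_const2[OF lim]) (auto intro!: P.finite_measure_mono exI[of _ 0])
    then have "P.prob (\<Union>n. B' n) = 1" using P.prob_le_1 by (intro antisym) auto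
    then have "AE \<omega> in S. \<omega> \<in> (\<Union>n. B' n)" by (subst (asm) P.prob_eq_1) auto
    then show ?thesis by eventually_elim (auto simp: B'_def)
  qed
  then have all: "AE \<omega> in S. \<forall>C::nat. \<exists>n. ereal (a * n + C) \<le> (SUP i\<in>c. fwalk c n \<omega> i)"
    by (simp add: AE_all_countable)
  have ex: "AE \<omega> in S. \<exists>j\<in>c. \<omega> \<in> rising H a j"
    using all
  proof eventually_elim
    case (elim \<omega>)
    show ?case
    proof (rule ccontr)
      assume "\<not> ?case"
      then have "\<forall>j\<in>c. \<omega> \<notin> rising c a j" using rising_mono_set[OF c(2)] by blast
      then have "\<forall>j\<in>c. \<exists>C::nat. \<forall>n. \<not> ereal (a * n + C) \<le> fwalk c n \<omega> j"
        unfolding rising_def by blast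
      then obtain K :: "'d \<Rightarrow> nat" where K: "\<And>j n. j \<in> c \<Longrightarrow> \<not> ereal (a * n + K j) \<le> fwalk c n \<omega> j"
        by metis
      \<comment> \<open>The best node may change with the level; a level above all the bounds \<open>K j\<close> excludes every node.\<close>
      obtain n where n: "ereal (a * n + (\<Sum>j\<in>c. K j)) \<le> (SUP i\<in>c. fwalk c n \<omega> i)"
        using elim by blast
      obtain j where j: "j \<in> c" "(SUP i\<in>c. fwalk c n \<omega> i) = fwalk c n \<omega> j"
        using finite_SUP_attained[of c "\<lambda>i. fwalk c n \<omega> i"] c(1) by auto
      have "K j \<le> (\<Sum>j\<in>c. K j)" using j(1) by (intro member_le_sum) auto
      then have "ereal (a * n + K j) \<le> ereal (a * n + (\<Sum>j\<in>c. K j))"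
        by (simp del: of_nat_sum)
      also have "\<dots> \<le> fwalk c n \<omega> j" using n by (simp only: j(2))
      finally show False using K[OF j(1)] by blast
    qed
  qed
  show ?thesis
  proof (rule ccontr)
    assume "\<not> ?thesis"
    then have "P.prob (rising H a j) = 0" if "j \<in> c" for j
      using that by (metis zero_less_measure_iff)
    then have "rising H a j \<in> null_sets S" if "j \<in> c" for j
      using that by (simp add: P.emeasure_eq_measure null_sets_def)
    then have "(\<Union>j\<in>c. rising H a j) \<in> null_sets S" by (intro null_sets.finite_UN) auto
    from AE_not_in[OF this] ex have "AE \<omega> in S. False" by eventually_elim auto
    then show False by simp
  qed
qed

lemma rising_positive_arc:
  assumes ij: "(i, j) \<in> arcs" and j: "j \<in> H" and pos: "0 < P.prob (rising H a j)"
  shows "0 < P.prob (rising H a i)"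
proof -
  have "0 < emeasure M {x. x i j \<noteq> - \<infinity>} * emeasure S (rising H a j)"
    using ij pos by (auto simp: arcs_def P.emeasure_eq_measure M.emeasure_eq_measure
        simp flip: ennreal_mult'' intro!: mult_pos_pos)
  also have "\<dots> = (\<integral>\<^sup>+x. emeasure S (rising H a j) * indicator {x. x i j \<noteq> - \<infinity>} x \<partial>M)"
    by (subst nn_integral_cmult_indicator) (auto simp: mult.commute)
  also have "\<dots> \<le> (\<integral>\<^sup>+x. emeasure S {\<omega>\<in>space S. case_nat x \<omega> \<in> rising H a i} \<partial>M)"
  proof (intro nn_integral_mono)
    fix x assume [measurable]: "x \<in> space M"
    have "{\<omega>\<in>space S. case_nat x \<omega> \<in> rising H a i} \<in> sets S" by measurable
    then show "emeasure S (rising H a j) * indicator {x. x i j \<noteq> - \<infinity>} x \<le>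
        emeasure S {\<omega>\<in>space S. case_nat x \<omega> \<in> rising H a i}"
      using rising_Cons[of x i j H _ a] j
      by (auto simp: indicator_def space_S_UNIV intro!: emeasure_mono)
  qed
  also have "\<dots> = emeasure S (rising H a i)" by (rule emeasure_S_Cons[symmetric]) simp
  finally show ?thesis by (simp add: P.emeasure_eq_measure)
qed

text \<open>
Positive probability propagates backwards along the arcs inside \<open>H\<close>; the zero-one law applies since a
finite entry of row \<open>i\<close> inside \<open>H\<close> leads to a node of \<open>H\<close>.
\<close>

lemma AE_rising:
  assumes rows: "AE x in M. \<forall>i\<in>H. \<exists>j\<in>H. x i j \<noteq> - \<infinity>"
    and reach: "\<And>i. i \<in> H \<Longrightarrow> \<exists>c\<subseteq>H. c \<noteq> {} \<and> ereal a < top_exponent c \<and>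
      (\<forall>j\<in>c. (i, j) \<in> (arcs \<inter> H \<times> H)\<^sup>*)"
    and i: "i \<in> H"
  shows "AE \<omega> in S. \<omega> \<in> rising H a i"
proof -
  have pos: "0 < P.prob (rising H a i)" if i: "i \<in> H" for i
  proof -
    obtain c where c: "c \<subseteq> H" "c \<noteq> {}" "ereal a < top_exponent c"
      "\<And>j. j \<in> c \<Longrightarrow> (i, j) \<in> (arcs \<inter> H \<times> H)\<^sup>*"
      using reach[OF i] by blast
    obtain j where j: "j \<in> c" "0 < P.prob (rising H a j)"
      using rising_positive_in_component[OF c(2,1,3)] by blast
    have "(i, j) \<in> (arcs \<inter> H \<times> H)\<^sup>*" by (rule c(4)[OF j(1)])
    then show ?thesis
      by (induction rule: converse_rtrancl_induct) (use j(2) rising_positive_arc in auto)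
  qed
  define q where "q = Min ((\<lambda>i. P.prob (rising H a i)) ` H)"
  have "H \<noteq> {}" using i by auto
  show ?thesis
  proof (rule zero_one_step[where J = H and q = q])
    show "AE x in M. \<exists>j\<in>H. AE \<omega> in S. \<omega> \<in> rising H a j \<longrightarrow> case_nat x \<omega> \<in> rising H a i"
      if "i \<in> H" for i
      using rows by eventually_elim (use that rising_Cons in \<open>fastforce\<close>)
    show "q > 0" using pos \<open>H \<noteq> {}\<close> by (simp add: q_def)
  qed (use i in \<open>auto simp: q_def\<close>)
qed

text \<open>
By \<open>AE_rising\<close>, good forward blocks start in every node of \<open>H\<close> with high probability if their length
may be up to some large \<open>N\<close>.  Reversing the \<open>N\<close> matrices before time \<open>p\<close> (the shift by \<open>p - N\<close>, then
\<open>rev_prefix N\<close>) yields good backward blocks at time \<open>p\<close>, and the greedy decomposition applies.  At bad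
times a single step is taken, which is possible inside \<open>H\<close> by the assumption on the rows.
\<close>

theorem walk_lower_bound:
  fixes a :: real
  assumes rows: "AE x in M. \<forall>i\<in>H. \<exists>j\<in>H. x i j \<noteq> - \<infinity>"
    and reach: "\<And>i. i \<in> H \<Longrightarrow> \<exists>c\<subseteq>H. c \<noteq> {} \<and> ereal a < top_exponent c \<and>
      (\<forall>j\<in>c. (i, j) \<in> (arcs \<inter> H \<times> H)\<^sup>*)"
    and \<epsilon>: "\<epsilon> > 0"
  shows "AE \<omega> in S. \<exists>C\<ge>0. \<forall>n. \<forall>i\<in>H. ereal (a * n - \<epsilon> * n - C) \<le> bwalk H n \<omega> i"
proof (cases "H = {}")
  case True
  then show ?thesis by (auto intro!: AE_I2 exI[of _ 0])
next
  case False
  define G where "G N = {\<omega>. \<forall>i\<in>H. \<exists>k\<in>{1..N}. ereal (a * k) \<le> fwalk H k \<omega> i}" for N :: nat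
  have G[measurable]: "G N \<in> sets S" for N
  proof -
    have "{\<omega>\<in>space S. \<forall>i\<in>H. \<exists>k\<in>{1..N}. ereal (a * k) \<le> fwalk H k \<omega> i} \<in> sets S" by measurable
    then show ?thesis by (simp add: G_def space_S_UNIV)
  qed
  have "incseq G" unfolding G_def incseq_def by force
  moreover have "AE \<omega> in S. \<exists>N. \<omega> \<in> G N"
  proof -
    have "AE \<omega> in S. \<forall>i\<in>H. \<omega> \<in> rising H a i"
      using AE_rising[OF rows reach] by (simp add: AE_finite_all)
    then show ?thesis
    proof eventually_elim
      case (elim \<omega>)
      have "\<forall>i\<in>H. \<exists>k\<ge>1. ereal (a * k) \<le> fwalk H k \<omega> i"
      proof
        fix i assume "i \<in> H"
        then obtain k where k: "ereal (a * k + 1) \<le> fwalk H k \<omega> i"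
          using elim unfolding rising_def by (auto dest!: bspec[of _ _ i] spec[of _ 1])
        have "k \<noteq> 0"
        proof
          assume "k = 0"
          with k show False by (simp add: zero_ereal_def)
        qed
        moreover have "ereal (a * k) \<le> fwalk H k \<omega> i" using _ k by (rule order_trans) simp
        ultimately show "\<exists>k\<ge>1. ereal (a * k) \<le> fwalk H k \<omega> i" by (intro exI[of _ k]) auto
      qed
      then obtain \<kappa> where \<kappa>: "\<And>i. i \<in> H \<Longrightarrow> \<kappa> i \<ge> 1" "\<And>i. i \<in> H \<Longrightarrow> ereal (a * \<kappa> i) \<le> fwalk H (\<kappa> i) \<omega> i"
        by metis
      have "\<kappa> i \<le> (\<Sum>i\<in>H. \<kappa> i)" if "i \<in> H" for i using that by (intro member_le_sum) auto
      then have "\<omega> \<in> G (\<Sum>i\<in>H. \<kappa> i)" unfolding G_def using \<kappa> by fastforce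
      then show ?case by blast
    qed
  qed
  moreover have h: "integrable S (\<lambda>\<omega>. entry_bound (\<omega> 0) + \<bar>a\<bar>)"
    using integrable_coordinate(1)[OF integrable_entry_bound] by simp
  ultimately have "(\<lambda>N. \<integral>\<omega>. indicator (space S - G N) \<omega> * (entry_bound (\<omega> 0) + \<bar>a\<bar>) \<partial>S) \<longlonglongrightarrow> 0"
    using G by (intro integral_off_increasing_events) auto
  from eventually_conj[OF order_tendstoD(2)[OF this \<epsilon>] eventually_ge_at_top[of 1]] obtain N
    where N: "(\<integral>\<omega>. indicator (space S - G N) \<omega> * (entry_bound (\<omega> 0) + \<bar>a\<bar>) \<partial>S) < \<epsilon>" "N \<ge> 1"
    by (auto simp: eventually_sequentially)
  define g where "g = (\<lambda>\<omega>. indicator (space S - G N) \<omega> * (entry_bound (\<omega> 0) + \<bar>a\<bar>))"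
  have g0: "0 \<le> g \<omega>" for \<omega> using entry_bound_nonneg[of "\<omega> 0"] by (simp add: g_def)
  have gi: "integrable S g"
    using integrable_mult_indicator[of "space S - G N" S "\<lambda>\<omega>. entry_bound (\<omega> 0) + \<bar>a\<bar>"] h
    by (simp add: g_def)
  define g' where "g' = (\<lambda>\<omega>. g (rev_prefix N \<omega>))"
  have g'0: "0 \<le> g' \<omega>" for \<omega> by (simp add: g'_def g0)
  have g'i: "integrable S g'"
    using integrable_distr[OF measurable_rev_prefix[of N], of g] gi unfolding distr_rev_prefix g'_def by simp
  have "(\<integral>\<omega>. g' \<omega> \<partial>S) = (\<integral>\<omega>. g \<omega> \<partial>S)"
    using integral_distr[OF measurable_rev_prefix[of N], of g] gi
    unfolding distr_rev_prefix g'_def by simp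
  then have "AE \<omega> in S. \<exists>C::nat. \<forall>n. drop_sum g' n \<omega> \<le> \<epsilon> * n + C"
    using N by (intro ergodic_upper_bound g'i g'0) (simp add: g_def)
  then show ?thesis
    using AE_S_coordinate[OF rows]
  proof eventually_elim
    case (elim \<omega>)
    from elim(1) obtain C1 :: nat where C1: "\<And>n. drop_sum g' n \<omega> \<le> \<epsilon> * n + C1" by blast
    define b where "b p = entry_bound (\<omega> (p - 1)) + \<bar>a\<bar>" for p
    have b0: "0 \<le> b p" for p unfolding b_def by (intro add_nonneg_nonneg entry_bound_nonneg abs_ge_zero)
    \<comment> \<open>The positions \<open>p < N\<close> contribute a constant that depends on \<open>\<omega>\<close> only.\<close>
    define e where "e p = (if p < N then b p else g' (seq_drop (p - N) \<omega>))" for p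
    have e0: "0 \<le> e p" for p using b0 g'0 by (simp add: e_def)
    define C where "C = C1 + (\<Sum>p<N. b p)"
    have "ereal (a * n - \<epsilon> * n - C) \<le> bwalk H n \<omega> i" if i: "i \<in> H" for n i
    proof -
      have "ereal (a * n - (\<Sum>u\<in>{1..n}. e u)) \<le> bwalk H n \<omega> i"
      proof (rule greedy_lower_bound[where V = "\<lambda>p i. bwalk H p \<omega> i" and n = n and J = H])
        fix p i assume p: "p \<in> {1..n}" and i: "i \<in> H"
        show "\<exists>k\<in>{1..p}. \<exists>j\<in>H. ereal (a * k - e p) + bwalk H (p - k) \<omega> j \<le> bwalk H p \<omega> i"
        proof (cases "N \<le> p \<and> rev_prefix N (seq_drop (p - N) \<omega>) \<in> G N")
          case True
          then obtain k where k: "k \<in> {1..N}"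
            "ereal (a * k) \<le> fwalk H k (rev_prefix N (seq_drop (p - N) \<omega>)) i"
            unfolding G_def using i by blast
          have "fwalk H k (rev_prefix N (seq_drop (p - N) \<omega>)) i = fwalk H k (\<lambda>u. \<omega> (p - Suc u)) i"
            by (rule fwalk_cong) (use k True in \<open>auto simp: rev_prefix_def\<close>)
          moreover obtain j where j: "j \<in> H"
            "fwalk H k (\<lambda>u. \<omega> (p - Suc u)) i + bwalk H (p - k) \<omega> j \<le> bwalk H p \<omega> i"
            using fwalk_segment[OF False i, of k p \<omega>] k True by auto
          ultimately have "ereal (a * k) + bwalk H (p - k) \<omega> j \<le> bwalk H p \<omega> i"
            using k(2) by (metis add_right_mono order_trans)
          moreover have "ereal (a * k - e p) \<le> ereal (a * k)" using e0 by simp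
          ultimately have "ereal (a * k - e p) + bwalk H (p - k) \<omega> j \<le> bwalk H p \<omega> i"
            by (meson add_right_mono order_trans)
          then show ?thesis using k True j(1) by (intro bexI[of _ k] bexI[of _ j]) auto
        next
          case bad: False
          have "b p \<le> e p"
          proof (cases "p < N")
            case False
            then have "rev_prefix N (seq_drop (p - N) \<omega>) 0 = \<omega> (p - 1)"
              using N(2) by (simp add: rev_prefix_def)
            then show ?thesis using bad False by (simp add: e_def g'_def g_def b_def space_S_UNIV)
          qed (simp add: e_def)
          then have le: "a - e p \<le> - entry_bound (\<omega> (p - 1))" by (simp add: b_def)
          obtain j where j: "j \<in> H" "\<omega> (p - 1) i j \<noteq> - \<infinity>" using elim(2) i by blast
          have "ereal (a * (1::nat) - e p) \<le> ereal (- entry_bound (\<omega> (p - 1)))" using le by simp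
          also have "\<dots> \<le> \<omega> (p - 1) i j" by (rule entry_ge_entry_bound[of "\<omega> (p - 1)" i j, OF j(2)])
          finally have "ereal (a * (1::nat) - e p) + bwalk H (p - 1) \<omega> j \<le> \<omega> (p - 1) i j + bwalk H (p - 1) \<omega> j"
            by (rule add_right_mono)
          also have "\<dots> \<le> bwalk H (Suc (p - 1)) \<omega> i" unfolding bwalk.simps by (rule SUP_upper[OF j(1)])
          also have "Suc (p - 1) = p" using p by simp
          finally show ?thesis using p j(1) by (intro bexI[of _ 1] bexI[of _ j]) auto
        qed
      qed (use e0 i in auto)
      moreover have "(\<Sum>u\<in>{1..n}. e u) \<le> \<epsilon> * n + C"
      proof -
        have "(\<Sum>u\<in>{1..n}. e u) = (\<Sum>u\<in>{1..n} \<inter> {u. u < N}. b u) +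
            (\<Sum>u\<in>{1..n} \<inter> - {u. u < N}. g' (seq_drop (u - N) \<omega>))"
          unfolding e_def by (subst sum.If_cases) auto
        also have "(\<Sum>u\<in>{1..n} \<inter> {u. u < N}. b u) \<le> (\<Sum>p<N. b p)"
          using b0 by (intro sum_mono2) auto
        also have "(\<Sum>u\<in>{1..n} \<inter> - {u. u < N}. g' (seq_drop (u - N) \<omega>)) = (\<Sum>s\<in>{..<Suc n - N}. g' (seq_drop s \<omega>))"
          using N(2) by (intro sum.reindex_bij_witness[of _ "\<lambda>s. s + N" "\<lambda>u. u - N"]) auto
        also have "\<dots> \<le> drop_sum g' n \<omega>"
          unfolding drop_sum_def using N(2) g'0 by (intro sum_mono2) auto
        finally show ?thesis using C1[of n] by (simp add: C_def)
      qed
      moreover have "ereal (a * n - \<epsilon> * n - C) \<le> ereal (a * n - (\<Sum>u\<in>{1..n}. e u))"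
        using calculation(2) by simp
      ultimately show ?thesis by (meson order_trans)
    qed
    moreover have "C \<ge> 0" using b0 by (simp add: C_def sum_nonneg)
    ultimately show ?case by blast
  qed
qed

end

section \<open>Limits of the orbit\<close>

lemma frequently_ratio_compare:
  fixes f g :: "nat \<Rightarrow> ereal" and e :: "nat \<Rightarrow> real" and l l' :: real
  assumes f: "(\<lambda>n. f n / ereal (real n)) \<longlonglongrightarrow> ereal l"
    and g: "(\<lambda>n. g n / ereal (real n)) \<longlonglongrightarrow> ereal l'"
    and e: "\<forall>\<delta>>0. \<exists>C\<ge>0. \<forall>n. e n \<le> \<delta> * real n + C"
    and freq: "\<exists>\<^sub>F n in sequentially. g n \<le> ereal (e n) + f (Suc n)"
  shows "l' \<le> l"
proof (rule ccontr)
  assume "\<not> l' \<le> l"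
  define \<delta> where "\<delta> = (l' - l) / 4"
  have \<delta>: "\<delta> > 0" using \<open>\<not> l' \<le> l\<close> by (simp add: \<delta>_def)
  obtain C where C: "C \<ge> 0" "\<And>n. e n \<le> \<delta> * real n + C" using e \<delta> by blast
  have f': "(\<lambda>n. f (Suc n) / ereal (real (Suc n))) \<longlonglongrightarrow> ereal l" using f by (rule LIMSEQ_Suc)
  have "\<forall>\<^sub>F n in sequentially. f (Suc n) / ereal (real (Suc n)) < ereal (l + \<delta>)"
    using \<delta> by (intro order_tendstoD(2)[OF f']) simp
  moreover have "\<forall>\<^sub>F n in sequentially. ereal (l' - \<delta>) < g n / ereal (real n)"
    using \<delta> by (intro order_tendstoD(1)[OF g]) simp
  moreover have "\<forall>\<^sub>F n in sequentially. C + \<bar>l\<bar> + \<delta> < \<delta> * real n"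
    using eventually_gt_at_top[of "nat \<lceil>(C + \<bar>l\<bar> + \<delta>) / \<delta>\<rceil>"]
  proof eventually_elim
    case (elim n)
    then have "(C + \<bar>l\<bar> + \<delta>) / \<delta> < n" by linarith
    then show ?case using \<delta> by (simp add: field_simps)
  qed
  moreover have "\<forall>\<^sub>F n in sequentially. n > (0::nat)" by (rule eventually_gt_at_top)
  ultimately have "\<forall>\<^sub>F n in sequentially. \<not> (g n \<le> ereal (e n) + f (Suc n))"
  proof eventually_elim
    case (elim n)
    show ?case
    proof
      assume *: "g n \<le> ereal (e n) + f (Suc n)"
      have "f (Suc n) \<le> ereal (real (Suc n) * (l + \<delta>))"
        using elim(1) by (subst (asm) ereal_divide_less_pos) (auto intro: less_imp_le)
      then have "ereal (e n) + f (Suc n) \<le> ereal (e n) + ereal (real (Suc n) * (l + \<delta>))"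
        by (rule add_left_mono)
      moreover have "ereal (real n * (l' - \<delta>)) \<le> g n"
        using elim(2,4) by (subst (asm) ereal_less_divide_pos) (auto intro: less_imp_le)
      ultimately have "ereal (real n * (l' - \<delta>)) \<le> ereal (e n) + ereal (real (Suc n) * (l + \<delta>))"
        using * by order
      then have "real n * (l' - \<delta>) \<le> e n + real (Suc n) * (l + \<delta>)" by simp
      then have "real n * (l' - l - 2 * \<delta>) \<le> e n + l + \<delta>" by (simp add: algebra_simps)
      also have "\<dots> \<le> \<delta> * real n + C + l + \<delta>" using C(2)[of n] by simp
      finally have "real n * \<delta> \<le> C + l + \<delta>" by (simp add: \<delta>_def field_simps)
      then show False using elim(3) by (simp add: mult.commute)
    qed
  qed
  with freq show False by (simp add: frequently_def)
qed

lemma frequently_ratio_compare':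
  fixes f g :: "nat \<Rightarrow> ereal" and e :: "nat \<Rightarrow> real" and l l' :: real
  assumes f: "(\<lambda>n. f n / ereal (real n)) \<longlonglongrightarrow> ereal l"
    and g: "(\<lambda>n. g n / ereal (real n)) \<longlonglongrightarrow> ereal l'"
    and e: "\<forall>\<delta>>0. \<exists>C\<ge>0. \<forall>n. e n \<le> \<delta> * real n + C"
    and freq: "\<exists>\<^sub>F n in sequentially. f (Suc n) \<le> ereal (e n) + g n"
  shows "l \<le> l'"
proof -
  have neg: "(\<lambda>n. - h n / ereal (real n)) \<longlonglongrightarrow> ereal (- m)"
    if "(\<lambda>n. h n / ereal (real n)) \<longlonglongrightarrow> ereal m" for h :: "nat \<Rightarrow> ereal" and m
    using tendsto_uminus_ereal[OF that] by (simp add: divide_ereal_def)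
  have "- l' \<le> - l"
  proof (rule frequently_ratio_compare[OF neg[OF f] neg[OF g] e])
    show "\<exists>\<^sub>F n in sequentially. - g n \<le> ereal (e n) + - f (Suc n)"
      using freq
    proof (rule frequently_elim1)
      fix n assume "f (Suc n) \<le> ereal (e n) + g n"
      then show "- g n \<le> ereal (e n) + - f (Suc n)"
        by (cases "f (Suc n)"; cases "g n") auto
    qed
  qed
  then show ?thesis by simp
qed

lemma bwalk_ge_drop_sum:
  fixes \<omega> :: "nat \<Rightarrow> ('d::finite) mp_matrix"
  assumes rows: "\<And>k i. \<exists>j. \<omega> k i j \<noteq> - \<infinity>"
  shows "ereal (- drop_sum (\<lambda>\<omega>. entry_bound (\<omega> 0)) n \<omega>) \<le> bwalk UNIV n \<omega> i"
proof (induction n arbitrary: i)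
  case (Suc n)
  obtain j where "\<omega> n i j \<noteq> - \<infinity>" using rows by blast
  from entry_ge_entry_bound[of "\<omega> n" i j, OF this]
  have "ereal (- entry_bound (\<omega> n)) + ereal (- drop_sum (\<lambda>\<omega>. entry_bound (\<omega> 0)) n \<omega>)
      \<le> \<omega> n i j + bwalk UNIV n \<omega> j"
    by (intro add_mono Suc.IH)
  also have "\<dots> \<le> bwalk UNIV (Suc n) \<omega> i" unfolding bwalk.simps by (rule SUP_upper) simp
  finally show ?case by (simp del: bwalk.simps add: drop_sum_def add.commute)
qed (simp add: zero_ereal_def)

context iid_max_plus
begin

definition limit_rate :: "'d \<Rightarrow> ereal" where
  "limit_rate i = (MAX c\<in>scc_of arcs ` (arcs\<^sup>* `` {i}). top_exponent c)"

text \<open>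
This is the set of nodes written $\{c\}$, for the component \<open>c\<close> of \<open>k\<close>: a node reachable from \<open>k\<close> reaches a
component of the largest exponent found from \<open>k\<close> if and only if it has the same rate as \<open>k\<close>.
\<close>

definition dominant_from :: "'d \<Rightarrow> 'd set" where
  "dominant_from k = {i. (k, i) \<in> arcs\<^sup>* \<and> limit_rate i = limit_rate k}"

lemma limit_rate_ge: "(i, k) \<in> arcs\<^sup>* \<Longrightarrow> top_exponent (scc_of arcs k) \<le> limit_rate i"
  unfolding limit_rate_def by (intro Max_ge) auto

lemma limit_rate_attained: "\<exists>k. (i, k) \<in> arcs\<^sup>* \<and> limit_rate i = top_exponent (scc_of arcs k)"
proof -
  have "limit_rate i \<in> top_exponent ` scc_of arcs ` (arcs\<^sup>* `` {i})"
    unfolding limit_rate_def by (intro Max_in) auto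
  then show ?thesis by auto
qed

lemma limit_rate_antimono: "(i, j) \<in> arcs\<^sup>* \<Longrightarrow> limit_rate j \<le> limit_rate i"
  using limit_rate_attained[of j] limit_rate_ge[of i] by (metis rtrancl_trans)

lemma AE_walk_upper:
  "AE \<omega> in S. \<forall>i. \<forall>q::rat. limit_rate i < ereal (of_rat q) \<longrightarrow>
     (\<forall>\<epsilon>>0. \<exists>C. \<forall>n. bwalk UNIV n \<omega> i \<le> ereal (of_rat q * real n + \<epsilon> * real n + C))"
  unfolding AE_all_countable
proof (intro allI AE_impI)
  fix i and q :: rat assume q: "limit_rate i < ereal (of_rat q)"
  have "AE \<omega> in S. \<forall>\<epsilon>>0::real. \<exists>C\<ge>0. \<forall>t. \<forall>s\<le>t. \<forall>j\<in>arcs\<^sup>* `` {i}.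
    bwalk UNIV (t - s) (seq_drop s \<omega>) j \<le> ereal (of_rat q * real (t - s) + \<epsilon> * real t + C)"
  proof (rule walk_upper_bound)
    show "top_exponent (scc_of arcs j) < ereal (of_rat q)" if "j \<in> arcs\<^sup>* `` {i}" for j
      using limit_rate_ge[of i j] q that by auto
  qed (auto intro: rtrancl_into_rtrancl)
  then show "AE \<omega> in S. \<forall>\<epsilon>>0. \<exists>C. \<forall>n. bwalk UNIV n \<omega> i \<le> ereal (of_rat q * real n + \<epsilon> * real n + C)"
  proof eventually_elim
    case (elim \<omega>)
    show ?case
    proof (intro allI impI)
      fix \<epsilon> :: real assume "\<epsilon> > 0"
      with elim obtain C where C: "\<And>s t j. s \<le> t \<Longrightarrow> j \<in> arcs\<^sup>* `` {i} \<Longrightarrow>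
        bwalk UNIV (t - s) (seq_drop s \<omega>) j \<le> ereal (of_rat q * real (t - s) + \<epsilon> * real t + C)" by meson
      show "\<exists>C. \<forall>n. bwalk UNIV n \<omega> i \<le> ereal (of_rat q * real n + \<epsilon> * real n + C)"
        using C[of 0 _ i] by (intro exI[of _ C]) simp
    qed
  qed
qed

text \<open>
Along a path the rate does not increase, so if it is the same at both ends it is constant.
\<close>

lemma dominant_from_path:
  assumes "(j, m) \<in> arcs\<^sup>*" "j \<in> dominant_from i" "limit_rate m = limit_rate i"
  shows "(j, m) \<in> (arcs \<inter> dominant_from i \<times> dominant_from i)\<^sup>*"
  using assms
proof (induction rule: converse_rtrancl_induct)
  case (step j j')
  have "limit_rate j' \<le> limit_rate j" using step by (intro limit_rate_antimono) auto
  moreover have "limit_rate m \<le> limit_rate j'" using step by (intro limit_rate_antimono) auto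
  ultimately have "j' \<in> dominant_from i"
    using step by (auto simp: dominant_from_def intro: rtrancl_into_rtrancl)
  then show ?case using step by (auto intro: converse_rtrancl_into_rtrancl)
qed simp

lemma AE_walk_lower:
  assumes rows: "\<And>k. AE x in M. \<forall>i\<in>dominant_from k. \<exists>j\<in>dominant_from k. x i j \<noteq> - \<infinity>"
  shows "AE \<omega> in S. \<forall>i. \<forall>q::rat. ereal (of_rat q) < limit_rate i \<longrightarrow>
     (\<forall>\<epsilon>>0. \<exists>C. \<forall>n. ereal (of_rat q * real n - \<epsilon> * real n - C) \<le> bwalk UNIV n \<omega> i)"
  unfolding AE_all_countable
proof (intro allI AE_impI)
  fix i and q :: rat assume q: "ereal (of_rat q) < limit_rate i"
  let ?H = "dominant_from i"
  have reach: "\<exists>c\<subseteq>?H. c \<noteq> {} \<and> ereal (of_rat q) < top_exponent c \<and> (\<forall>m\<in>c. (j, m) \<in> (arcs \<inter> ?H \<times> ?H)\<^sup>*)"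
    if j: "j \<in> ?H" for j
  proof -
    obtain k where k: "(j, k) \<in> arcs\<^sup>*" "limit_rate j = top_exponent (scc_of arcs k)"
      using limit_rate_attained by blast
    have eq: "limit_rate j = limit_rate i" and ij: "(i, j) \<in> arcs\<^sup>*" using j by (auto simp: dominant_from_def)
    have m: "(j, m) \<in> arcs\<^sup>* \<and> limit_rate m = limit_rate i" if "m \<in> scc_of arcs k" for m
    proof -
      have jm: "(j, m) \<in> arcs\<^sup>*" "(m, k) \<in> arcs\<^sup>*" using that k(1) by (auto simp: scc_of_def)
      have "limit_rate m \<le> limit_rate j" by (rule limit_rate_antimono[OF jm(1)])
      moreover have "limit_rate j \<le> limit_rate m" unfolding k(2) by (rule limit_rate_ge[OF jm(2)])
      ultimately show ?thesis using jm eq by auto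
    qed
    have "scc_of arcs k \<subseteq> ?H"
      using m ij by (auto simp: dominant_from_def intro: rtrancl_trans)
    moreover have "k \<in> scc_of arcs k" by (simp add: scc_of_def)
    ultimately show ?thesis using m dominant_from_path[OF _ j] q k(2) eq
      by (intro exI[of _ "scc_of arcs k"]) auto
  qed
  have i: "i \<in> ?H" by (simp add: dominant_from_def)
  show "AE \<omega> in S. \<forall>\<epsilon>>0. \<exists>C. \<forall>n. ereal (of_rat q * real n - \<epsilon> * real n - C) \<le> bwalk UNIV n \<omega> i"
  proof (rule AE_all_pos)
    fix \<epsilon> :: real assume "\<epsilon> > 0"
    from walk_lower_bound[OF rows reach this]
    have "AE \<omega> in S. \<exists>C\<ge>0. \<forall>n. \<forall>j\<in>?H. ereal (of_rat q * n - \<epsilon> * n - C) \<le> bwalk ?H n \<omega> j" by blast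
    then show "AE \<omega> in S. \<exists>C. \<forall>n. ereal (of_rat q * real n - \<epsilon> * real n - C) \<le> bwalk UNIV n \<omega> i"
    proof eventually_elim
      case (elim \<omega>)
      then obtain C where C: "\<And>n j. j \<in> ?H \<Longrightarrow> ereal (of_rat q * n - \<epsilon> * n - C) \<le> bwalk ?H n \<omega> j" by blast
      have "ereal (of_rat q * n - \<epsilon> * n - C) \<le> bwalk UNIV n \<omega> i" for n :: nat
        using C[OF i] bwalk_mono_set[of ?H UNIV] by (meson order_trans subset_UNIV)
      then show ?case by blast
    qed
  next
    fix \<epsilon> \<epsilon>' :: real and \<omega>
    assume le: "\<epsilon> \<le> \<epsilon>'" and "\<exists>C. \<forall>n. ereal (of_rat q * real n - \<epsilon> * real n - C) \<le> bwalk UNIV n \<omega> i"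
    then obtain C where C: "\<And>n. ereal (of_rat q * real n - \<epsilon> * real n - C) \<le> bwalk UNIV n \<omega> i" by blast
    have "ereal (of_rat q * real n - \<epsilon>' * real n - C) \<le> bwalk UNIV n \<omega> i" for n
    proof -
      have "\<epsilon> * real n \<le> \<epsilon>' * real n" using le by (rule mult_right_mono) simp
      then have "ereal (of_rat q * real n - \<epsilon>' * real n - C) \<le> ereal (of_rat q * real n - \<epsilon> * real n - C)" by simp
      then show ?thesis using C by (rule order_trans)
    qed
    then show "\<exists>C. \<forall>n. ereal (of_rat q * real n - \<epsilon>' * real n - C) \<le> bwalk UNIV n \<omega> i" by blast
  qed
qed

theorem walk_ratio_tendsto:
  assumes rows: "\<And>k. AE x in M. \<forall>i\<in>dominant_from k. \<exists>j\<in>dominant_from k. x i j \<noteq> - \<infinity>"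
  shows "AE \<omega> in S. \<forall>i. (\<lambda>n. bwalk UNIV n \<omega> i / ereal (real n)) \<longlonglongrightarrow> limit_rate i"
  using AE_walk_upper AE_walk_lower[OF rows]
proof eventually_elim
  case (elim \<omega>)
  show ?case by (intro allI LIMSEQ_ratioI) (use elim in blast)+
qed

text \<open>
The orbit is squeezed between two multiples of \<open>n\<close>, because all rows have finite entries.
\<close>

lemma limit_rate_finite:
  assumes rows: "\<And>k. AE x in M. \<forall>i\<in>dominant_from k. \<exists>j\<in>dominant_from k. x i j \<noteq> - \<infinity>"
  shows "\<exists>l. limit_rate i = ereal l"
proof -
  let ?h = "\<lambda>\<omega>::nat \<Rightarrow> 'd mp_matrix. entry_bound (\<omega> 0)"
  define K where "K = (\<integral>a. entry_bound a \<partial>M) + 1"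
  have "AE x in M. \<forall>i. \<exists>j. x i j \<noteq> - \<infinity>"
    unfolding AE_all_countable
  proof
    fix i
    have "i \<in> dominant_from i" by (simp add: dominant_from_def)
    with rows[of i] show "AE x in M. \<exists>j. x i j \<noteq> - \<infinity>" by (auto elim!: eventually_mono)
  qed
  from AE_S_coordinate[OF this] have r: "AE \<omega> in S. \<forall>k i. \<exists>j. \<omega> k i j \<noteq> - \<infinity>" by simp
  have "AE \<omega> in S. \<exists>C::nat. \<forall>n. drop_sum ?h n \<omega> \<le> K * n + C"
    using integrable_coordinate[OF integrable_entry_bound, of 0]
    by (intro ergodic_upper_bound) (auto simp: K_def entry_bound_nonneg)
  then have "AE \<omega> in S. \<exists>l. limit_rate i = ereal l"
    using r AE_no_pinf walk_ratio_tendsto[OF rows]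
  proof eventually_elim
    case (elim \<omega>)
    obtain C :: nat where C: "\<And>n. drop_sum ?h n \<omega> \<le> K * n + C" using elim(1) by blast
    have lim: "(\<lambda>n. bwalk UNIV n \<omega> i / ereal (real n)) \<longlonglongrightarrow> limit_rate i" using elim(4) by blast
    have "bwalk UNIV n \<omega> i \<le> ereal (K * n + C)" for n
      using bwalk_le_drop_sum[OF elim(3), of UNIV n i] C[of n] by (meson ereal_less_eq(3) order_trans)
    then have "\<forall>\<^sub>F n in sequentially. bwalk UNIV n \<omega> i / ereal (real n) \<le> ereal (K + 1)"
      by (rule eventually_ratio_le) simp
    then have "limit_rate i \<le> ereal (K + 1)" using tendsto_upperbound[OF lim] by simp
    moreover have "ereal (- K * n - C) \<le> bwalk UNIV n \<omega> i" for n
    proof -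
      have "ereal (- K * n - C) \<le> ereal (- drop_sum ?h n \<omega>)" using C[of n] by simp
      also have "\<dots> \<le> bwalk UNIV n \<omega> i" by (rule bwalk_ge_drop_sum) (use elim(2) in blast)
      finally show ?thesis .
    qed
    then have "\<forall>\<^sub>F n in sequentially. ereal (- K - 1) \<le> bwalk UNIV n \<omega> i / ereal (real n)"
      by (rule eventually_ratio_ge) simp
    then have "ereal (- K - 1) \<le> limit_rate i" using tendsto_lowerbound[OF lim] by simp
    ultimately show ?case by (cases "limit_rate i") auto
  qed
  then show ?thesis by simp
qed

lemma AE_infinitely_often:
  assumes Q[measurable]: "Q \<in> sets M" and pos: "measure M Q > 0"
  shows "AE \<omega> in S. \<exists>\<^sub>F n in sequentially. \<omega> n \<in> Q"
proof -
  define E where "E = {\<omega>\<in>space S. \<exists>n. \<omega> n \<in> Q}"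
  have E[measurable]: "E \<in> sets S" unfolding E_def by measurable
  have "emeasure M Q = emeasure (distr S M (\<lambda>\<omega>. \<omega> 0)) Q" by (subst PiM_component) auto
  also have "\<dots> = emeasure S ((\<lambda>\<omega>. \<omega> 0) -` Q \<inter> space S)" by (rule emeasure_distr) auto
  also have "\<dots> \<le> emeasure S E" by (intro emeasure_mono) (auto simp: E_def)
  finally have posE: "P.prob E > 0"
    using pos by (simp add: M.emeasure_eq_measure P.emeasure_eq_measure)
  have "AE \<omega> in S. \<omega> \<in> E"
  proof (rule zero_one_step[where J = "{()}" and E = "\<lambda>_. E" and q = "P.prob E"])
    have "case_nat x \<omega> \<in> E" if \<omega>: "\<omega> \<in> E" for x \<omega>
    proof -
      obtain n where "\<omega> n \<in> Q" using \<omega> by (auto simp: E_def)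
      then have "case_nat x \<omega> (Suc n) \<in> Q" by simp
      then show ?thesis unfolding E_def space_S_UNIV by blast
    qed
    then show "AE x in M. \<exists>j\<in>{()}. AE \<omega> in S. \<omega> \<in> E \<longrightarrow> case_nat x \<omega> \<in> E" by simp
  qed (use posE in auto)
  from AE_seq_drop[OF this] show ?thesis
  proof eventually_elim
    case (elim \<omega>)
    have "\<exists>n\<ge>m. \<omega> n \<in> Q" for m
    proof -
      have "seq_drop m \<omega> \<in> E" using elim by blast
      then obtain n where "\<omega> (m + n) \<in> Q" by (auto simp: E_def)
      then show ?thesis by (intro exI[of _ "m + n"]) auto
    qed
    then show ?case unfolding frequently_sequentially by blast
  qed
qed

text \<open>
The limits \<open>l i\<close> decrease along arcs, as each arc is present infinitely often.  So \<open>l\<close> is constant on a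
component \<open>c\<close>, and there it is at least the exponent of \<open>c\<close>, since the peak over \<open>c\<close> is a maximum of
finitely many walks from \<open>c\<close>.
\<close>

theorem convergent_rate_eq:
  "AE \<omega> in S. \<forall>l :: 'd \<Rightarrow> real. (\<forall>i. (\<lambda>n. bwalk UNIV n \<omega> i / ereal (real n)) \<longlonglongrightarrow> ereal (l i)) \<longrightarrow>
     (\<forall>i. ereal (l i) = limit_rate i)"
proof -
  have "AE \<omega> in S. \<forall>i j. (i, j) \<in> arcs \<longrightarrow> (\<exists>\<^sub>F n in sequentially. \<omega> n i j \<noteq> - \<infinity>)"
    unfolding AE_all_countable
  proof (intro allI AE_impI)
    fix i j assume "(i, j) \<in> arcs"
    then have "measure M {a. a i j \<noteq> - \<infinity>} > 0" by (simp add: arcs_def)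
    from AE_infinitely_often[OF entry_finite_sets this]
    show "AE \<omega> in S. \<exists>\<^sub>F n in sequentially. \<omega> n i j \<noteq> - \<infinity>" by simp
  qed
  moreover have "AE \<omega> in S. \<forall>k. (\<lambda>n. peak (scc_of arcs k) n \<omega> / ereal (real n)) \<longlonglongrightarrow> top_exponent (scc_of arcs k)"
    unfolding AE_all_countable by (intro allI peak_ratio_tendsto) (auto simp: scc_of_def)
  ultimately show ?thesis
    using AE_entry_bound_sublinear AE_walk_upper
  proof eventually_elim
    case (elim \<omega>)
    show ?case
    proof (intro allI impI)
      fix l :: "'d \<Rightarrow> real" and i
      assume l: "\<forall>i. (\<lambda>n. bwalk UNIV n \<omega> i / ereal (real n)) \<longlonglongrightarrow> ereal (l i)"
      have arc: "l j \<le> l i" if "(i, j) \<in> arcs" for i j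
      proof (rule frequently_ratio_compare[OF l[rule_format] l[rule_format] elim(3)])
        have "\<exists>\<^sub>F n in sequentially. \<omega> n i j \<noteq> - \<infinity>" using elim(1) that by blast
        then show "\<exists>\<^sub>F n in sequentially. bwalk UNIV n \<omega> j \<le> ereal (entry_bound (\<omega> n)) + bwalk UNIV (Suc n) \<omega> i"
        proof (rule frequently_elim1)
          fix n assume ne: "\<omega> n i j \<noteq> - \<infinity>"
          have "ereal (- entry_bound (\<omega> n)) + bwalk UNIV n \<omega> j \<le> \<omega> n i j + bwalk UNIV n \<omega> j"
            by (intro add_right_mono entry_ge_entry_bound ne)
          also have "\<dots> \<le> bwalk UNIV (Suc n) \<omega> i" unfolding bwalk.simps by (rule SUP_upper) simp
          finally have "ereal (entry_bound (\<omega> n)) + (ereal (- entry_bound (\<omega> n)) + bwalk UNIV n \<omega> j)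
            \<le> ereal (entry_bound (\<omega> n)) + bwalk UNIV (Suc n) \<omega> i" by (rule add_left_mono)
          moreover have "ereal (entry_bound (\<omega> n)) + (ereal (- entry_bound (\<omega> n)) + bwalk UNIV n \<omega> j) = bwalk UNIV n \<omega> j"
            by (cases "bwalk UNIV n \<omega> j") auto
          ultimately show "bwalk UNIV n \<omega> j \<le> ereal (entry_bound (\<omega> n)) + bwalk UNIV (Suc n) \<omega> i" by simp
        qed
      qed
      have path: "l j \<le> l i" if "(i, j) \<in> arcs\<^sup>*" for i j
        using that by (induction rule: rtrancl_induct) (use arc in \<open>auto intro: order_trans\<close>)
      have scc: "top_exponent (scc_of arcs k) \<le> ereal (l k)" for k
      proof (rule ccontr)
        assume "\<not> ?thesis"
        then have "ereal (l k) < top_exponent (scc_of arcs k)" by simp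
        from dense[OF this] obtain u where u: "ereal (l k) < u" "u < top_exponent (scc_of arcs k)"
          by blast
        let ?c = "scc_of arcs k"
        have "\<forall>\<^sub>F n in sequentially. \<forall>j\<in>?c. bwalk UNIV n \<omega> j / ereal (real n) < u"
        proof (rule eventually_ball_finite, simp, intro ballI)
          fix j assume "j \<in> ?c"
          then have "l j \<le> l k" by (intro path) (simp add: scc_of_def)
          then have "ereal (l j) < u" using u(1) by (metis ereal_less_eq(3) le_less_trans)
          with l show "\<forall>\<^sub>F n in sequentially. bwalk UNIV n \<omega> j / ereal (real n) < u"
            by (intro order_tendstoD(2)) auto
        qed
        moreover have "\<forall>\<^sub>F n in sequentially. u < peak ?c n \<omega> / ereal (real n)"
          using elim(2) u(2) by (intro order_tendstoD(1)) auto
        moreover have "\<forall>\<^sub>F n in sequentially. n > (0::nat)" by (rule eventually_gt_at_top)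
        ultimately have "\<forall>\<^sub>F n::nat in sequentially. False"
        proof eventually_elim
          case (elim n)
          obtain j where j: "j \<in> ?c" "peak ?c n \<omega> = bwalk ?c n \<omega> j"
            using finite_SUP_attained[of ?c "bwalk ?c n \<omega>"] unfolding peak_def
            by (auto simp: scc_of_def)
          have "peak ?c n \<omega> / ereal (real n) \<le> bwalk UNIV n \<omega> j / ereal (real n)"
            unfolding j(2) using elim(3) by (intro ereal_divide_right_mono bwalk_mono_set) auto
          then show False using elim(1,2) j(1) by (meson le_less_trans not_less_iff_gr_or_eq)
        qed
        then show False by simp
      qed
      show "ereal (l i) = limit_rate i"
      proof (rule antisym)
        obtain k where "(i, k) \<in> arcs\<^sup>*" "limit_rate i = top_exponent (scc_of arcs k)"
          using limit_rate_attained by blast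
        then show "limit_rate i \<le> ereal (l i)"
          using scc[of k] path[of i k] by (metis ereal_less_eq(3) order_trans)
        show "ereal (l i) \<le> limit_rate i"
        proof (rule ccontr)
          assume "\<not> ?thesis"
          then have "limit_rate i < ereal (l i)" by simp
          from ereal_dense3[OF this] obtain q :: rat
            where q: "limit_rate i < ereal (of_rat q)" "ereal (of_rat q) < ereal (l i)" by blast
          define \<epsilon> where "\<epsilon> = (l i - of_rat q) / 4"
          have \<epsilon>: "\<epsilon> > 0" using q(2) by (simp add: \<epsilon>_def)
          then obtain C where C: "\<And>n. bwalk UNIV n \<omega> i \<le> ereal (of_rat q * real n + \<epsilon> * real n + C)"
            using elim(4) q(1) by meson
          have "\<forall>\<^sub>F n in sequentially. bwalk UNIV n \<omega> i / ereal (real n) \<le> ereal (of_rat q + 2 * \<epsilon>)"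
            using \<epsilon> C by (intro eventually_ratio_le[where a = "of_rat q + \<epsilon>" and C = C]) (auto simp: distrib_right)
          from tendsto_upperbound[OF l[rule_format] this]
          have "ereal (l i) \<le> ereal (of_rat q + 2 * \<epsilon>)" by simp
          then show False using \<epsilon> by (simp add: \<epsilon>_def field_simps)
        qed
      qed
    qed
  qed
qed

text \<open>
Infinitely often the row of some \<open>i\<close> in the dominant set has no finite entry inside this set.  The
walk from \<open>i\<close> then continues in a node outside, and one node \<open>j\<close> serves infinitely often.  Convergence
would give \<open>limit_rate i \<le> limit_rate j\<close>, which puts \<open>j\<close> into the dominant set.
\<close>

theorem diverges_of_row_escape:
  assumes esc: "\<not> (AE x in M. \<forall>i\<in>dominant_from k. \<exists>j\<in>dominant_from k. x i j \<noteq> - \<infinity>)"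
  shows "AE \<omega> in S. \<not> (\<exists>l :: 'd \<Rightarrow> real. \<forall>i. (\<lambda>n. bwalk UNIV n \<omega> i / ereal (real n)) \<longlonglongrightarrow> ereal (l i))"
proof -
  let ?D = "dominant_from k"
  have "\<exists>i\<in>?D. \<not> (AE x in M. \<exists>j\<in>?D. x i j \<noteq> - \<infinity>)"
    using esc by (auto simp: AE_finite_all)
  then obtain i where i: "i \<in> ?D" "\<not> (AE x in M. \<exists>j\<in>?D. x i j \<noteq> - \<infinity>)" by blast
  define Q :: "'d mp_matrix set" where "Q = {x. \<forall>j\<in>?D. x i j = - \<infinity>}"
  have "{x\<in>space M. \<forall>j\<in>?D. x i j = - \<infinity>} \<in> sets M" by measurable
  then have Q[measurable]: "Q \<in> sets M" by (simp add: Q_def space_M_UNIV)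
  have "measure M Q > 0"
  proof (rule ccontr)
    assume "\<not> ?thesis"
    then have "measure M Q = 0" by (simp add: zero_less_measure_iff)
    then have "Q \<in> null_sets M" by (simp add: M.emeasure_eq_measure null_sets_def)
    from AE_not_in[OF this] have "AE x in M. \<exists>j\<in>?D. x i j \<noteq> - \<infinity>"
      by eventually_elim (auto simp: Q_def)
    with i(2) show False by simp
  qed
  from AE_infinitely_often[OF Q this] show ?thesis
    using convergent_rate_eq AE_entry_bound_sublinear AE_arcs AE_no_pinf
  proof eventually_elim
    case (elim \<omega>)
    note ar = elim(4) and np = elim(5)
    show ?case
    proof
      assume "\<exists>l :: 'd \<Rightarrow> real. \<forall>i. (\<lambda>n. bwalk UNIV n \<omega> i / ereal (real n)) \<longlonglongrightarrow> ereal (l i)"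
      then obtain l :: "'d \<Rightarrow> real"
        where l: "\<And>i. (\<lambda>n. bwalk UNIV n \<omega> i / ereal (real n)) \<longlonglongrightarrow> ereal (l i)" by blast
      with elim(2) have rate: "ereal (l i) = limit_rate i" for i by blast
      have "\<forall>\<^sub>F n in sequentially. ereal (l i - 1) < bwalk UNIV (Suc n) \<omega> i / ereal (real (Suc n))"
        using LIMSEQ_Suc[OF l[of i]] by (intro order_tendstoD(1)) auto
      then have "\<forall>\<^sub>F n in sequentially. \<omega> n \<in> Q \<longrightarrow> (\<exists>j. (i, j) \<in> arcs \<and> j \<notin> ?D \<and>
          bwalk UNIV (Suc n) \<omega> i \<le> ereal (entry_bound (\<omega> n)) + bwalk UNIV n \<omega> j)"
      proof eventually_elim
        case (elim n)
        show ?case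
        proof
          assume Qn: "\<omega> n \<in> Q"
          obtain j where j: "bwalk UNIV (Suc n) \<omega> i = \<omega> n i j + bwalk UNIV n \<omega> j"
            using finite_SUP_attained[of UNIV "\<lambda>j. \<omega> n i j + bwalk UNIV n \<omega> j"] by auto
          have "\<omega> n i j \<noteq> - \<infinity>"
          proof
            assume "\<omega> n i j = - \<infinity>"
            then have "bwalk UNIV (Suc n) \<omega> i = - \<infinity>"
              using bwalk_neq_PInf[OF np, of UNIV n j] unfolding j by (cases "bwalk UNIV n \<omega> j") auto
            with elim show False by (simp del: bwalk.simps)
          qed
          moreover have "\<omega> n i j \<le> ereal (entry_bound (\<omega> n))"
            using np by (intro entry_le_entry_bound) (simp add: no_pinf_def)
          ultimately show "\<exists>j. (i, j) \<in> arcs \<and> j \<notin> ?D \<and>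
              bwalk UNIV (Suc n) \<omega> i \<le> ereal (entry_bound (\<omega> n)) + bwalk UNIV n \<omega> j"
            using ar Qn j by (intro exI[of _ j]) (auto simp: Q_def intro: add_right_mono)
        qed
      qed
      from frequently_rev_mp[OF elim(1) this]
      have "\<exists>\<^sub>F n in sequentially. \<exists>j. (i, j) \<in> arcs \<and> j \<notin> ?D \<and>
          bwalk UNIV (Suc n) \<omega> i \<le> ereal (entry_bound (\<omega> n)) + bwalk UNIV n \<omega> j" .
      then have "\<exists>j. \<exists>\<^sub>F n in sequentially. (i, j) \<in> arcs \<and> j \<notin> ?D \<and>
          bwalk UNIV (Suc n) \<omega> i \<le> ereal (entry_bound (\<omega> n)) + bwalk UNIV n \<omega> j"
        unfolding frequently_def not_ex
        using eventually_all_finite[of "\<lambda>n j. \<not> ((i, j) \<in> arcs \<and> j \<notin> ?D \<and>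
          bwalk UNIV (Suc n) \<omega> i \<le> ereal (entry_bound (\<omega> n)) + bwalk UNIV n \<omega> j)" sequentially] by auto
      then obtain j where j: "\<exists>\<^sub>F n in sequentially. (i, j) \<in> arcs \<and> j \<notin> ?D \<and>
          bwalk UNIV (Suc n) \<omega> i \<le> ereal (entry_bound (\<omega> n)) + bwalk UNIV n \<omega> j" ..
      then have ij: "(i, j) \<in> arcs" "j \<notin> ?D" by (auto dest: frequently_ex)
      have "l i \<le> l j"
        by (rule frequently_ratio_compare'[OF l l elim(3)]) (use j in \<open>auto elim: frequently_elim1\<close>)
      then have "limit_rate i \<le> limit_rate j" by (simp flip: rate)
      moreover have "limit_rate j \<le> limit_rate i" using ij by (intro limit_rate_antimono) auto
      ultimately have "j \<in> ?D" using i(1) ij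
        by (auto simp: dominant_from_def intro: rtrancl_into_rtrancl)
      then show False using ij by simp
    qed
  qed
qed

end

section \<open>The theorem\<close>

lemma integrable_entry_bound_of_Max:
  fixes X :: "'w \<Rightarrow> ('d::finite) mp_matrix"
  assumes X: "X \<in> measurable N mp_matrix_space"
    and rows: "AE \<omega> in N. \<forall>i. \<exists>j. X \<omega> i j \<noteq> - \<infinity>"
    and int: "integrable N (\<lambda>\<omega>. Max {\<bar>real_of_ereal (X \<omega> i j)\<bar> | i j. X \<omega> i j \<noteq> - \<infinity>})"
  shows "integrable N (\<lambda>\<omega>. entry_bound (X \<omega>))"
proof -
  let ?F = "\<lambda>\<omega>. {\<bar>real_of_ereal (X \<omega> i j)\<bar> | i j. X \<omega> i j \<noteq> - \<infinity>}"
  have [measurable]: "(\<lambda>\<omega>. X \<omega> i j) \<in> borel_measurable N" for i j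
    by (rule measurable_compose[OF X measurable_mp_matrix_entry])
  show ?thesis
  proof (rule Bochner_Integration.integrable_bound)
    show "integrable N (\<lambda>\<omega>. real (CARD('d) * CARD('d)) * Max (?F \<omega>))"
      using int by simp
    show "(\<lambda>\<omega>. entry_bound (X \<omega>)) \<in> borel_measurable N"
      unfolding entry_bound_def by measurable
    show "AE \<omega> in N. norm (entry_bound (X \<omega>)) \<le> norm (real (CARD('d) * CARD('d)) * Max (?F \<omega>))"
      using rows
    proof eventually_elim
      case (elim \<omega>)
      have fin: "finite (?F \<omega>)"
      proof (rule finite_subset)
        show "?F \<omega> \<subseteq> (\<lambda>(i, j). \<bar>real_of_ereal (X \<omega> i j)\<bar>) ` UNIV" by auto
      qed simp
      have le: "\<bar>real_of_ereal (X \<omega> i j)\<bar> \<le> Max (?F \<omega>)" if "X \<omega> i j \<noteq> - \<infinity>" for i j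
        using that by (intro Max_ge fin) blast
      obtain i j where "X \<omega> i j \<noteq> - \<infinity>" using elim by blast
      from le[OF this] have nonneg: "0 \<le> Max (?F \<omega>)" by (rule order_trans[OF abs_ge_zero])
      have "\<bar>real_of_ereal (X \<omega> i j)\<bar> \<le> Max (?F \<omega>)" for i j
        using le[of i j] nonneg by (cases "X \<omega> i j = - \<infinity>") auto
      then have "entry_bound (X \<omega>) \<le> (\<Sum>i\<in>(UNIV::'d set). \<Sum>j\<in>(UNIV::'d set). Max (?F \<omega>))"
        unfolding entry_bound_def by (intro sum_mono)
      also have "\<dots> = real (CARD('d) * CARD('d)) * Max (?F \<omega>)" by simp
      finally show ?case using nonneg entry_bound_nonneg[of "X \<omega>"] by simp
    qed
  qed
qed

lemma quotient_eq_scc_of: "UNIV // (r\<^sup>* \<inter> (r\<^sup>*)\<inverse>) = range (scc_of r)"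
  by (auto simp: quotient_def scc_of_def Image_def)

lemma scc_reachable_iff: "(\<exists>j\<in>scc_of r k. (i, j) \<in> r\<^sup>*) \<longleftrightarrow> (i, k) \<in> r\<^sup>*"
  by (auto simp: scc_of_def intro: rtrancl_trans)

theorem theorem2p4:
  fixes M :: "'w measure"
    and A :: "nat \<Rightarrow> 'w \<Rightarrow> ('d::finite) mp_matrix"
  assumes "prob_space M"
    and "iid_mp_matrices M A"
    and "AE \<omega> in M. \<forall>i. \<exists>j. A 0 \<omega> i j \<noteq> -\<infinity>"
    and "integrable M (\<lambda>\<omega>. Max {\<bar>real_of_ereal (A 0 \<omega> i j)\<bar> | i j. A 0 \<omega> i j \<noteq> -\<infinity>})"
  shows "((AE \<omega> in M. \<exists>l :: 'd \<Rightarrow> real. \<forall>i.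
             (\<lambda>n. mp_orbit (\<lambda>k. A k \<omega>) n i / ereal (real n)) \<longlonglongrightarrow> ereal (l i))
          \<longleftrightarrow> (\<forall>c\<in>mp_sccs M A. AE \<omega> in M.
                 \<forall>i\<in>dominant_nodes M A c. \<exists>j\<in>dominant_nodes M A c. A 0 \<omega> i j \<noteq> -\<infinity>))
       \<and> ((AE \<omega> in M. \<exists>l :: 'd \<Rightarrow> real. \<forall>i.
             (\<lambda>n. mp_orbit (\<lambda>k. A k \<omega>) n i / ereal (real n)) \<longlonglongrightarrow> ereal (l i))
          \<longrightarrow> (\<forall>i. AE \<omega> in M.
                 (\<lambda>n. mp_orbit (\<lambda>k. A k \<omega>) n i / ereal (real n))
                   \<longlonglongrightarrow> (MAX c\<in>sccs_from M A i. lyapunov M A c)))"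
proof -
  interpret N: prob_space M by fact
  have A[measurable]: "A n \<in> measurable M mp_matrix_space" for n
    using assms(2) by (simp add: iid_mp_matrices_def)
  have no_inf: "A n \<omega> i j \<noteq> \<infinity>" if "\<omega> \<in> space M" for n \<omega> i j
    using assms(2) that by (simp add: iid_mp_matrices_def)
  define \<mu> where "\<mu> = distr M mp_matrix_space (A 0)"
  have law: "distr M mp_matrix_space (A n) = \<mu>" for n
    using assms(2) by (simp add: iid_mp_matrices_def \<mu>_def)
  have sets_\<mu>: "sets \<mu> = sets mp_matrix_space" by (simp add: \<mu>_def)
  have A\<mu>[measurable]: "A n \<in> measurable M \<mu>" for n
    using A by (simp add: measurable_cong_sets[OF refl sets_\<mu>])
  have distr_\<mu>: "distr M \<mu> (A 0) = \<mu>"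
    unfolding \<mu>_def by (rule distr_cong) auto
  have \<mu>_prob: "prob_space \<mu>" unfolding \<mu>_def by (rule N.prob_space_distr) (rule A)
  have [measurable]: "(\<lambda>a. a i j) \<in> borel_measurable \<mu>" for i j
    using measurable_mp_matrix_entry[of i j] by (simp add: measurable_cong_sets[OF sets_\<mu> refl])
  have eb_meas[measurable]: "entry_bound \<in> borel_measurable \<mu>"
    unfolding entry_bound_def[abs_def] by measurable
  interpret iid_max_plus \<mu>
  proof (intro iid_max_plus.intro iid_max_plus_axioms.intro sequence_space.intro product_prob_spaceI)
    have "AE \<omega> in M. \<forall>i j. A 0 \<omega> i j \<noteq> \<infinity>" using no_inf by (intro AE_I2) auto
    then have "AE a in distr M \<mu> (A 0). \<forall>i j. a i j \<noteq> \<infinity>"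
      by (subst AE_distr_iff) auto
    then show "AE a in \<mu>. \<forall>i j. a i j \<noteq> \<infinity>" by (simp only: distr_\<mu>)
    have "integrable M (\<lambda>\<omega>. entry_bound (A 0 \<omega>))"
      by (rule integrable_entry_bound_of_Max[OF A assms(3,4)])
    then have "integrable (distr M \<mu> (A 0)) entry_bound"
      by (subst integrable_distr_eq) auto
    then show "integrable \<mu> entry_bound" by (simp only: distr_\<mu>)
  qed (use sets_\<mu> \<mu>_prob in auto)
  define T where "T \<omega> = (\<lambda>k. A k \<omega>)" for \<omega>
  have T[measurable]: "T \<in> measurable M S"
    unfolding T_def[abs_def]
    by (rule measurable_PiM_single') (auto simp: space_M_UNIV)
  \<comment> \<open>The joint law of the matrices is the product law: independence and identical distribution.\<close>
  have distr_T: "distr M S T = S"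
  proof -
    have "N.indep_vars (\<lambda>_. mp_matrix_space) A UNIV" using assms(2) by (simp add: iid_mp_matrices_def)
    then have "distr M (\<Pi>\<^sub>M i\<in>UNIV. mp_matrix_space) (\<lambda>\<omega>. \<lambda>i\<in>UNIV. A i \<omega>) = S"
      by (subst (asm) N.indep_vars_iff_distr_eq_PiM) (auto simp: law)
    moreover have "distr M (\<Pi>\<^sub>M i\<in>UNIV. mp_matrix_space) (\<lambda>\<omega>. \<lambda>i\<in>UNIV. A i \<omega>) = distr M S T"
      by (rule distr_cong) (auto simp: T_def sets_\<mu> intro!: sets_PiM_cong)
    ultimately show ?thesis by simp
  qed
  have transfer: "AE \<omega> in M. Q (T \<omega>)" if "AE \<omega> in S. Q \<omega>" for Q
    by (rule AE_distrD[OF T]) (use that in \<open>simp only: distr_T\<close>)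
  \<comment> \<open>Kingman's limit exists on the sequence space, so the definite description denotes it.\<close>
  have lyap: "lyapunov M A I = top_exponent I" if I: "I \<noteq> {}" for I
  proof -
    have lim: "AE \<omega> in M. (\<lambda>n. peak I n (T \<omega>) / ereal (real n)) \<longlonglongrightarrow> top_exponent I"
      by (rule transfer[OF peak_ratio_tendsto[OF I]])
    show ?thesis
      unfolding lyapunov_def MAX_mp_prod_eq_peak[OF I] T_def[symmetric]
    proof (rule the_equality, rule lim)
      fix \<gamma> assume "AE \<omega> in M. (\<lambda>n. peak I n (T \<omega>) / ereal (real n)) \<longlonglongrightarrow> \<gamma>"
      with lim have "AE \<omega> in M. \<gamma> = top_exponent I"
        by eventually_elim (rule LIMSEQ_unique)
      then show "\<gamma> = top_exponent I" by simp
    qed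
  qed
  have meas_eq: "measure M {\<omega>\<in>space M. A 0 \<omega> i j \<noteq> - \<infinity>} = measure \<mu> {a. a i j \<noteq> - \<infinity>}" for i j
  proof -
    have "measure \<mu> {a. a i j \<noteq> - \<infinity>} = measure (distr M \<mu> (A 0)) {a. a i j \<noteq> - \<infinity>}"
      by (simp only: distr_\<mu>)
    also have "\<dots> = measure M (A 0 -` {a. a i j \<noteq> - \<infinity>} \<inter> space M)"
      by (rule measure_distr[OF A\<mu> entry_finite_sets])
    also have "A 0 -` {a. a i j \<noteq> - \<infinity>} \<inter> space M = {\<omega>\<in>space M. A 0 \<omega> i j \<noteq> - \<infinity>}" by auto
    finally show ?thesis by simp
  qed
  have arcs_eq: "mp_arcs M A = arcs" by (simp add: mp_arcs_def arcs_def meas_eq)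
  have sccs: "mp_sccs M A = range (scc_of arcs)"
    by (simp add: mp_sccs_def arcs_eq quotient_eq_scc_of)
  have ne: "scc_of arcs k \<noteq> {}" for k by (auto simp: scc_of_def)
  have from_node: "sccs_from M A i = scc_of arcs ` (arcs\<^sup>* `` {i})" for i
  proof -
    have "{c \<in> range (scc_of arcs). \<exists>j\<in>c. (i, j) \<in> arcs\<^sup>*} = scc_of arcs ` {k. \<exists>j\<in>scc_of arcs k. (i, j) \<in> arcs\<^sup>*}"
      by blast
    then show ?thesis
      by (simp add: sccs_from_def sccs arcs_eq scc_reachable_iff Image_singleton)
  qed
  have rate: "(MAX c\<in>sccs_from M A i. lyapunov M A c) = limit_rate i" for i
    unfolding from_node limit_rate_def using lyap[OF ne] by (simp add: image_image)
  have from_scc: "sccs_from_scc M A (scc_of arcs k) = sccs_from M A k" for k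
    unfolding sccs_from_scc_def sccs_from_def arcs_eq
    by (auto simp: scc_of_def intro: rtrancl_trans)
  have dominant: "dominant_nodes M A (scc_of arcs k) = dominant_from k" for k
  proof -
    have "(\<exists>c'\<in>sccs_from M A i. lyapunov M A c' = limit_rate k) \<longleftrightarrow> limit_rate i = limit_rate k"
      if "(k, i) \<in> arcs\<^sup>*" for i
    proof
      assume "\<exists>c'\<in>sccs_from M A i. lyapunov M A c' = limit_rate k"
      then obtain m where "(i, m) \<in> arcs\<^sup>*" "top_exponent (scc_of arcs m) = limit_rate k"
        unfolding from_node using lyap[OF ne] by auto
      then have "limit_rate k \<le> limit_rate i" using limit_rate_ge[of i m] by simp
      with limit_rate_antimono[OF that] show "limit_rate i = limit_rate k" by simp
    next
      assume "limit_rate i = limit_rate k"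
      then show "\<exists>c'\<in>sccs_from M A i. lyapunov M A c' = limit_rate k"
        unfolding from_node using lyap[OF ne] limit_rate_attained[of i] by auto
    qed
    moreover have "(\<exists>m\<in>scc_of arcs k. (m, i) \<in> arcs\<^sup>*) \<longleftrightarrow> (k, i) \<in> arcs\<^sup>*" for i
      by (auto simp: scc_of_def intro: rtrancl_trans)
    ultimately show ?thesis
      unfolding dominant_nodes_def dominant_from_def from_scc rate arcs_eq by auto
  qed
  have rows_iff: "(AE \<omega> in M. \<forall>i\<in>D. \<exists>j\<in>D. A 0 \<omega> i j \<noteq> - \<infinity>) \<longleftrightarrow>
      (AE a in \<mu>. \<forall>i\<in>D. \<exists>j\<in>D. a i j \<noteq> - \<infinity>)" for D
  proof -
    have "(AE a in distr M \<mu> (A 0). \<forall>i\<in>D. \<exists>j\<in>D. a i j \<noteq> - \<infinity>) \<longleftrightarrow>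
        (AE \<omega> in M. \<forall>i\<in>D. \<exists>j\<in>D. A 0 \<omega> i j \<noteq> - \<infinity>)"
      by (rule AE_distr_iff) auto
    then show ?thesis by (simp only: distr_\<mu>)
  qed
  let ?conv = "\<lambda>\<omega>. \<exists>l :: 'd \<Rightarrow> real. \<forall>i. (\<lambda>n. bwalk UNIV n (T \<omega>) i / ereal (real n)) \<longlonglongrightarrow> ereal (l i)"
  have orbit: "mp_orbit (\<lambda>k. A k \<omega>) n i = bwalk UNIV n (T \<omega>) i" for \<omega> n i
    by (simp add: mp_orbit_eq_bwalk T_def)
  have "(AE \<omega> in M. ?conv \<omega>) \<longleftrightarrow>
      (\<forall>k. AE a in \<mu>. \<forall>i\<in>dominant_from k. \<exists>j\<in>dominant_from k. a i j \<noteq> - \<infinity>)" (is "_ \<longleftrightarrow> ?rows")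
  proof
    assume conv: "AE \<omega> in M. ?conv \<omega>"
    show ?rows
    proof (rule ccontr)
      assume "\<not> ?rows"
      then obtain k where "\<not> (AE a in \<mu>. \<forall>i\<in>dominant_from k. \<exists>j\<in>dominant_from k. a i j \<noteq> - \<infinity>)"
        by blast
      from conv transfer[OF diverges_of_row_escape[OF this]] have "AE \<omega> in M. False"
        by eventually_elim blast
      then show False by simp
    qed
  next
    assume rows: ?rows
    then have r: "AE a in \<mu>. \<forall>i\<in>dominant_from k. \<exists>j\<in>dominant_from k. a i j \<noteq> - \<infinity>" for k
      by blast
    obtain l where l: "\<And>i. limit_rate i = ereal (l i)"
      using limit_rate_finite[OF r] by metis
    from transfer[OF walk_ratio_tendsto[OF r]] show "AE \<omega> in M. ?conv \<omega>"
      by eventually_elim (intro exI[of _ l], simp add: l)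
  qed
  moreover have "AE \<omega> in M. (\<lambda>n. bwalk UNIV n (T \<omega>) i / ereal (real n)) \<longlonglongrightarrow> limit_rate i"
    if "AE \<omega> in M. ?conv \<omega>" for i
    using that transfer[OF convergent_rate_eq]
  proof eventually_elim
    case (elim \<omega>)
    then obtain l where l: "\<And>i. (\<lambda>n. bwalk UNIV n (T \<omega>) i / ereal (real n)) \<longlonglongrightarrow> ereal (l i)" by blast
    with elim(2) have "ereal (l i) = limit_rate i" by blast
    with l[of i] show ?case by simp
  qed
  ultimately show ?thesis
    unfolding orbit rate sccs by (simp add: dominant rows_iff)
qed

end
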